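(* Let $V$ be a finite-dimensional real Hilbert space, let $\mathbf A=(\delta^A:A_1\to A_0,\gtrdot,\lessdot)$ be a crossed module of Banach algebras, and let $(\alpha,\gamma)$ be a continuous 2-connection on $V$ valued in $\mathbf A$. Let $\widetilde\alpha:E_0(V)\to A_0$ and $\widetilde\gamma:E_1(V)\to A_1$ be the unique continuous algebra morphisms with $\alpha=\widetilde\alpha\circ\zeta$ and $\gamma=\widetilde\gamma\circ Z$, and extend $\widetilde\gamma$ unitally to $\mathbb R\oplus E_1(V)\to\hat A_1$. Then for every smooth surface $X:[s_-,s_+]\times[t_-,t_+]\to V$, $$\widehat H^{\alpha,\gamma}(X)=\widetilde\gamma\big(\widehat R(X)\big).$$
   Context: Algebraic setup. $V$ has orthonormal basis $e_1,\dots,e_d$. $T_0(V)=\bigoplus_{n\ge0}V^{\otimes n}$ is the tensor algebra (product $\cdot$, unit $1$), $V^{\otimes n}$ having the Hilbert structure in which the words $e_{i_1}\cdots e_{i_n}$ are orthonormal; $\Lambda^2V$ has orthonormal basis $e_i\wedge e_j$ ($i<j$). Let $\overline T_1(V)=T_0(V)\otimes\Lambda^2V\otimes T_0(V)=\bigoplus_{n\ge2}\bigoplus_{k=0}^{n-2}V^{\otimes k}\otimes\Lambda^2V\otimes V^{\otimes(n-k-2)}$ (the part indexed by $n$ is "level $n$"), with the Hilbert structure making $e_{q_1}\cdots e_{q_k}\otimes(e_i\wedge e_j)\otimes e_{q_{k+1}}\cdots e_{q_{n-2}}$ orthonormal, with left/right $T_0(V)$-actions by multiplication on the outer factors (written $a\cdot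 E$, $E\cdot a$), and with $\delta:\overline T_1(V)\to T_0(V)$, $\delta(a\otimes(v\wedge w)\otimes b)=a\cdot(v\cdot w-w\cdot v)\cdot b$. The Peiffer subspace $\mathrm{Pf}$ is the span of all $\delta(E)\cdot F-E\cdot\delta(F)$; $T_1(V)=\overline T_1(V)/\mathrm{Pf}$, whose level-$n$ part $T_1^{(n)}(V)$ is identified with the orthogonal complement of the level-$n$ part of $\mathrm{Pf}$ and normed accordingly. The actions and $\delta$ descend to $T_1(V)$, which is an algebra with product $E*F=\delta(E)\cdot F=E\cdot\delta(F)$. Superscript $(k)$ denotes the level-$k$ component. $E_0(V)=\{a\in\prod_{n\ge0}V^{\otimes n}:\sum_k\lambda^k\|a^{(k)}\|<\infty\ \forall\lambda>0\}$ and $E_1(V)=\{E\in\prod_{n\ge2}T_1^{(n)}(V):\sum_k\lambda^k\|E^{(k)}\|<\infty\ \forall\lambda>0\}$, with the (locally $m$-convex) topologies generated by these seminorms; $\mathbf E(V)=(\delta:E_1(V)\to E_0(V),\cdot,\cdot)$. The universal 2-connection is $\zeta:V\to E_0(V)$ the inclusion and $Z:\Lambda^2V\to E_1(V)$, $v\wedge w\mapsto$ class of $1\otimes(v\wedge w)\otimes1$. Elements of $\mathbb R\oplus\prod_{n\ge2}T_1^{(n)}(V)$ multiply by $(\lambda,E)*(\mu,F)=(\lambda\mu,\lambda F+\mu E+E*F)$; an invertible $g\in\prod_nV^{\otimes n}$ acts by $g\triangleright(\lambda,E)=(\lambda,g\cdot E\cdot g^{-1})$. Crossed modules of algebras. $\mathbf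 A=(\delta^A:A_1\to A_0,\gtrdot,\lessdot)$ consists of a unital algebra $A_0$, an algebra $A_1$ which is an $A_0$-bimodule (actions $\gtrdot,\lessdot$) with $a\gtrdot(E*E')=(a\gtrdot E)*E'$, $(E*E')\lessdot a=E*(E'\lessdot a)$, $(E\lessdot a)*(a'\gtrdot E')=E*((aa')\gtrdot E')=(E\lessdot(aa'))*E'$, and an algebra morphism $\delta^A$ with $\delta^A(a\gtrdot E)=a\,\delta^A(E)$, $\delta^A(E\lessdot a)=\delta^A(E)a$, $\delta^A(E)\gtrdot E'=E*E'=E\lessdot\delta^A(E')$. It is a crossed module of Banach algebras if $A_0,A_1$ are Banach algebras, $\delta^A$ is continuous and $\|a\gtrdot E\|,\|E\lessdot a\|\le\|a\|\|E\|$. A 2-connection is a pair of linear maps $\alpha:V\to A_0$, $\gamma:\Lambda^2V\to A_1$ with $\delta^A(\gamma(v\wedge w))=\alpha(v)\alpha(w)-\alpha(w)\alpha(v)$; continuous if both are continuous. For such data the paper shows the continuous morphisms $\widetilde\alpha,\widetilde\gamma$ above exist and are unique. $\hat A_1=\mathbb R\oplus A_1$ is the unitalization, with invertible $a\in A_0$ acting by $a\triangleright(\lambda,E)=(\lambda,a\gtrdot E\lessdot a^{-1})$; the unital extension of $\widetilde\gamma$ is $(\lambda,E)\mapsto(\lambda,\widetilde\gamma(E))$. Paths and surfaces. For smooth $x:[a,b]\to V$, the parallel transport $F^\alpha(x)=F_b$ solves $\frac{d}{dt}F_t=F_t\,\alpha(\dot x_t)$, $F_a=1$; the path signature is $S(x)=1+\sum_{n\ge1}\int_{a<u_1<\dots<u_n<b}dx_{u_1}\cdots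 dx_{u_n}$ (it lies in $E_0(V)$). For smooth $X:[s_-,s_+]\times[t_-,t_+]\to V$ with coordinates $X^i$, the tail path $x^{s,t}:[0,(s-s_-)+(t-t_-)]\to V$ is $x^{s,t}_u=X_{u+s_-,t_-}$ for $u\le s-s_-$ and $x^{s,t}_u=X_{s,u-(s-s_-)+t_-}$ otherwise, and $J_{s,t}(X)=\sum_{i<j}(\partial_sX^i\partial_tX^j-\partial_sX^j\partial_tX^i)(s,t)\,e_i\wedge e_j$. The surface holonomy is $\widehat H^{\alpha,\gamma}(X)=\widehat H_{s_+,t_+}$ where $\partial_t\widehat H_{s,t}=\widehat H_{s,t}*\int_{s_-}^{s}F^\alpha(x^{s',t})\triangleright\gamma(J_{s',t}(X))\,ds'$, $\widehat H_{s,t_-}=1$. The surface signature is $\widehat R(X)=\widehat R_{s_+,t_+}(X)$ where $\partial_t\widehat R_{s,t}=\widehat R_{s,t}*\int_{s_-}^sS(x^{s',t})\triangleright J_{s',t}(X)\,ds'$, $\widehat R_{s,t_-}=1$ (solved level by level, $J$ viewed in $T_1^{(2)}(V)=\Lambda^2V$); it is known to lie in $\mathbb R\oplus E_1(V)$.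
   Formalization: The extension (α̃, γ̃) is taken to be a continuous morphism of crossed modules E(V) → A (α̃ unital, compatible with δ and with both actions); as bare continuous algebra morphisms extending (α, γ) they are not unique and the identity can fail. *)

theory Defs
  imports "HOL-Analysis.Analysis"
begin

section \<open>Tensor algebra T0(V), V = R^d with orthonormal basis e_0..e_(d-1)\<close>

text \<open>An element of prod_n V^(tensor n) is a coefficient function on words (lists of basis
indices). Only words with letters < d are meaningful.\<close>

type_synonym t0 = "nat list \<Rightarrow> real"

text \<open>Basis element  u (x) (e_i wedge e_j) (x) v  of the bar-T1(V), encoded as (u,(i,j),v), i<j.\<close>
type_synonym tb = "nat list \<times> (nat \<times> nat) \<times> nat list"
type_synonym t1 = "tb \<Rightarrow> real"

definition valid0 :: "nat \<Rightarrow> nat list \<Rightarrow> bool" where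
  "valid0 d w \<longleftrightarrow> set w \<subseteq> {..<d}"

definition valid1 :: "nat \<Rightarrow> tb \<Rightarrow> bool" where
  "valid1 d b \<longleftrightarrow> (case b of (u,(i,j),v) \<Rightarrow> set u \<subseteq> {..<d} \<and> set v \<subseteq> {..<d} \<and> i < j \<and> j < d)"

definition level1 :: "tb \<Rightarrow> nat" where
  "level1 b = (case b of (u,p,v) \<Rightarrow> length u + length v + 2)"

definition words :: "nat \<Rightarrow> nat \<Rightarrow> nat list set" where
  "words d k = {w. length w = k \<and> valid0 d w}"

definition basis1 :: "nat \<Rightarrow> nat \<Rightarrow> tb set" where
  "basis1 d n = {b. valid1 d b \<and> level1 b = n}"

definition one0 :: t0 where
  "one0 w = (if w = [] then 1 else 0)"

definition mul0 :: "t0 \<Rightarrow> t0 \<Rightarrow> t0" where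
  "mul0 a b w = (\<Sum>k\<le>length w. a (take k w) * b (drop k w))"

definition inv0 :: "t0 \<Rightarrow> t0" where
  "inv0 a = (THE b. mul0 a b = one0 \<and> mul0 b a = one0)"

definition lact :: "t0 \<Rightarrow> t1 \<Rightarrow> t1" where
  "lact a E b = (case b of (u,p,v) \<Rightarrow> (\<Sum>k\<le>length u. a (take k u) * E (drop k u, p, v)))"

definition ract :: "t1 \<Rightarrow> t0 \<Rightarrow> t1" where
  "ract E a b = (case b of (u,p,v) \<Rightarrow> (\<Sum>k\<le>length v. E (u, p, take k v) * a (drop k v)))"

definition delta :: "t1 \<Rightarrow> t0" where
  "delta E w = (\<Sum>k<length w - 1.
      (let u = take k w; i = w ! k; j = w ! (k+1); v = drop (k+2) w in
        if i < j then E (u,(i,j),v) else if j < i then - E (u,(j,i),v) else 0))"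

definition mul1 :: "t1 \<Rightarrow> t1 \<Rightarrow> t1" where
  "mul1 E F = lact (delta E) F"

definition T1bar :: "nat \<Rightarrow> t1 set" where
  "T1bar d = {E. finite {b. E b \<noteq> 0} \<and> (\<forall>b. \<not> valid1 d b \<longrightarrow> E b = 0)}"

inductive_set Pf :: "nat \<Rightarrow> t1 set" for d :: nat where
  Pf_zero: "(\<lambda>b. 0) \<in> Pf d"
| Pf_gen: "E \<in> T1bar d \<Longrightarrow> F \<in> T1bar d \<Longrightarrow> (\<lambda>b. lact (delta E) F b - ract E (delta F) b) \<in> Pf d"
| Pf_add: "P \<in> Pf d \<Longrightarrow> Q \<in> Pf d \<Longrightarrow> (\<lambda>b. P b + Q b) \<in> Pf d"
| Pf_scale: "P \<in> Pf d \<Longrightarrow> (\<lambda>b. c * P b) \<in> Pf d"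

definition Pfn :: "nat \<Rightarrow> nat \<Rightarrow> t1 set" where
  "Pfn d n = {P \<in> Pf d. \<forall>b. level1 b \<noteq> n \<longrightarrow> P b = 0}"

definition norm0 :: "nat \<Rightarrow> nat \<Rightarrow> t0 \<Rightarrow> real" where
  "norm0 d k a = sqrt (\<Sum>w\<in>words d k. (a w)\<^sup>2)"

text \<open>norm of the class of the level-n component of E in T1^(n) = (level-n part of bar-T1)/Pf^(n),
 identified with the orthogonal complement of Pf^(n): the norm of the orthogonal projection,
 i.e. the distance of E^(n) to Pf^(n).\<close>
definition norm1 :: "nat \<Rightarrow> nat \<Rightarrow> t1 \<Rightarrow> real" where
  "norm1 d n E = Inf {sqrt (\<Sum>b\<in>basis1 d n. (E b - P b)\<^sup>2) | P. P \<in> Pfn d n}"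

text \<open>E and F represent the same element of prod_n T1^(n)\<close>
definition equiv1 :: "nat \<Rightarrow> t1 \<Rightarrow> t1 \<Rightarrow> bool" where
  "equiv1 d E F \<longleftrightarrow> (\<forall>n. (\<lambda>b. if level1 b = n then E b - F b else 0) \<in> Pfn d n)"

definition E0 :: "nat \<Rightarrow> t0 set" where
  "E0 d = {a. (\<forall>w. \<not> valid0 d w \<longrightarrow> a w = 0) \<and> (\<forall>l>0. summable (\<lambda>k. l ^ k * norm0 d k a))}"

definition sn0 :: "nat \<Rightarrow> real \<Rightarrow> t0 \<Rightarrow> real" where
  "sn0 d l a = (\<Sum>k. l ^ k * norm0 d k a)"

definition E1 :: "nat \<Rightarrow> t1 set" where
  "E1 d = {E. (\<forall>b. \<not> valid1 d b \<longrightarrow> E b = 0) \<and> (\<forall>l>0. summable (\<lambda>k. l ^ k * norm1 d k E))}"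

definition sn1 :: "nat \<Rightarrow> real \<Rightarrow> t1 \<Rightarrow> real" where
  "sn1 d l E = (\<Sum>k. l ^ k * norm1 d k E)"

definition top0 :: "nat \<Rightarrow> t0 topology" where
  "top0 d = topology_generated_by
     {{b \<in> E0 d. sn0 d l (\<lambda>w. b w - a w) < r} | a l r. a \<in> E0 d \<and> l > 0 \<and> r > 0}"

definition top1 :: "nat \<Rightarrow> t1 topology" where
  "top1 d = topology_generated_by
     {{F \<in> E1 d. sn1 d l (\<lambda>b. F b - E b) < r} | E l r. E \<in> E1 d \<and> l > 0 \<and> r > 0}"

definition zeta :: "nat \<Rightarrow> t0" where
  "zeta i w = (if w = [i] then 1 else 0)"

definition Zc :: "nat \<Rightarrow> nat \<Rightarrow> t1" where
  "Zc i j b = (if b = ([],(i,j),[]) then 1 else 0)"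

definition ainv :: "'a::ring_1 \<Rightarrow> 'a" where
  "ainv a = (THE b. a * b = 1 \<and> b * a = 1)"

definition xmod_banach ::
  "('b::{real_normed_algebra,banach} \<Rightarrow> 'a::{real_normed_algebra,real_algebra_1,banach})
    \<Rightarrow> ('a \<Rightarrow> 'b \<Rightarrow> 'b) \<Rightarrow> ('b \<Rightarrow> 'a \<Rightarrow> 'b) \<Rightarrow> bool" where
  "xmod_banach dA l r \<longleftrightarrow>
     bounded_linear dA \<and> (\<forall>E F. dA (E * F) = dA E * dA F) \<and>
     (\<forall>a. linear (l a)) \<and> (\<forall>E. linear (\<lambda>a. l a E)) \<and>
     (\<forall>a. linear (\<lambda>E. r E a)) \<and> (\<forall>E. linear (r E)) \<and>
     (\<forall>a a' E. l (a * a') E = l a (l a' E)) \<and>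
     (\<forall>a a' E. r E (a * a') = r (r E a) a') \<and>
     (\<forall>a a' E. r (l a E) a' = l a (r E a')) \<and>
     (\<forall>a E E'. l a (E * E') = l a E * E') \<and>
     (\<forall>a E E'. r (E * E') a = E * r E' a) \<and>
     (\<forall>a a' E E'. r E a * l a' E' = E * l (a * a') E' \<and> E * l (a * a') E' = r E (a * a') * E') \<and>
     (\<forall>a E. dA (l a E) = a * dA E) \<and> (\<forall>a E. dA (r E a) = dA E * a) \<and>
     (\<forall>E E'. l (dA E) E' = E * E' \<and> r E (dA E') = E * E') \<and>
     (\<forall>a E. norm (l a E) \<le> norm a * norm E) \<and> (\<forall>a E. norm (r E a) \<le> norm E * norm a)"

text \<open>2-connection given by its values on the basis: alpha(e_i) = alp i, gamma(e_i wedge e_j) = gam i j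
  (linear maps on finite-dimensional spaces, hence automatically continuous).\<close>
definition two_connection :: "nat \<Rightarrow> ('b::{real_normed_algebra,banach} \<Rightarrow> 'a::{real_normed_algebra,real_algebra_1,banach})
    \<Rightarrow> (nat \<Rightarrow> 'a) \<Rightarrow> (nat \<Rightarrow> nat \<Rightarrow> 'b) \<Rightarrow> bool" where
  "two_connection d dA alp gam \<longleftrightarrow>
     (\<forall>i j. i < j \<and> j < d \<longrightarrow> dA (gam i j) = alp i * alp j - alp j * alp i)"

text \<open>(alpha~, gamma~) : E(V) -> A continuous morphism of crossed modules extending (alpha, gamma);
 gamma~ is given on representatives and must be well defined on classes modulo Pf.\<close>
definition ext_morphism ::
  "nat \<Rightarrow> ('b::{real_normed_algebra,banach} \<Rightarrow> 'a::{real_normed_algebra,real_algebra_1,banach})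
    \<Rightarrow> ('a \<Rightarrow> 'b \<Rightarrow> 'b) \<Rightarrow> ('b \<Rightarrow> 'a \<Rightarrow> 'b) \<Rightarrow> (nat \<Rightarrow> 'a) \<Rightarrow> (nat \<Rightarrow> nat \<Rightarrow> 'b)
    \<Rightarrow> (t0 \<Rightarrow> 'a) \<Rightarrow> (t1 \<Rightarrow> 'b) \<Rightarrow> bool" where
  "ext_morphism d dA l r alp gam atl gt \<longleftrightarrow>
     (\<forall>a\<in>E0 d. \<forall>b\<in>E0 d. \<forall>c. atl (\<lambda>w. c * a w + b w) = c *\<^sub>R atl a + atl b) \<and>
     (\<forall>a\<in>E0 d. \<forall>b\<in>E0 d. atl (mul0 a b) = atl a * atl b) \<and> atl one0 = 1 \<and>
     continuous_map (top0 d) euclidean atl \<and>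
     (\<forall>i<d. atl (zeta i) = alp i) \<and>
     (\<forall>E\<in>E1 d. \<forall>F\<in>E1 d. equiv1 d E F \<longrightarrow> gt E = gt F) \<and>
     (\<forall>E\<in>E1 d. \<forall>F\<in>E1 d. \<forall>c. gt (\<lambda>b. c * E b + F b) = c *\<^sub>R gt E + gt F) \<and>
     (\<forall>E\<in>E1 d. \<forall>F\<in>E1 d. gt (mul1 E F) = gt E * gt F) \<and>
     continuous_map (top1 d) euclidean gt \<and>
     (\<forall>i j. i < j \<and> j < d \<longrightarrow> gt (Zc i j) = gam i j) \<and>
     (\<forall>E\<in>E1 d. dA (gt E) = atl (delta E)) \<and>
     (\<forall>a\<in>E0 d. \<forall>E\<in>E1 d. gt (lact a E) = l (atl a) (gt E) \<and> gt (ract E a) = r (gt E) (atl a))"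

fun Ck :: "nat \<Rightarrow> (real \<times> real) set \<Rightarrow> (real \<times> real \<Rightarrow> real) \<Rightarrow> bool" where
  "Ck 0 U f = continuous_on U f"
| "Ck (Suc k) U f = ((\<forall>z\<in>U. f differentiable (at z)) \<and>
      Ck k U (\<lambda>z. frechet_derivative f (at z) (1,0)) \<and> Ck k U (\<lambda>z. frechet_derivative f (at z) (0,1)))"

text \<open>X i is the i-th coordinate of the surface; smooth = C^infinity on an open neighbourhood\<close>
definition smooth_surface :: "nat \<Rightarrow> real \<Rightarrow> real \<Rightarrow> real \<Rightarrow> real \<Rightarrow> (nat \<Rightarrow> real \<times> real \<Rightarrow> real) \<Rightarrow> bool" where
  "smooth_surface d sm sp tm tp X \<longleftrightarrow>
     (\<exists>U. open U \<and> {sm..sp} \<times> {tm..tp} \<subseteq> U \<and> (\<forall>i<d. \<forall>k. Ck k U (X i)))"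

definition dS :: "(nat \<Rightarrow> real \<times> real \<Rightarrow> real) \<Rightarrow> nat \<Rightarrow> real \<times> real \<Rightarrow> real" where
  "dS X i z = frechet_derivative (X i) (at z) (1,0)"

definition dT :: "(nat \<Rightarrow> real \<times> real \<Rightarrow> real) \<Rightarrow> nat \<Rightarrow> real \<times> real \<Rightarrow> real" where
  "dT X i z = frechet_derivative (X i) (at z) (0,1)"

text \<open>coefficient of e_i wedge e_j (i<j) in J_{s,t}(X)\<close>
definition Jco :: "(nat \<Rightarrow> real \<times> real \<Rightarrow> real) \<Rightarrow> nat \<Rightarrow> nat \<Rightarrow> real \<times> real \<Rightarrow> real" where
  "Jco X i j z = dS X i z * dT X j z - dS X j z * dT X i z"

definition tail_len :: "real \<Rightarrow> real \<Rightarrow> real \<Rightarrow> real \<Rightarrow> real" where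
  "tail_len sm tm s t = (s - sm) + (t - tm)"

definition tail_path :: "(nat \<Rightarrow> real \<times> real \<Rightarrow> real) \<Rightarrow> real \<Rightarrow> real \<Rightarrow> real \<Rightarrow> real \<Rightarrow> nat \<Rightarrow> real \<Rightarrow> real" where
  "tail_path X sm tm s t i u =
     (if u \<le> s - sm then X i (u + sm, tm) else X i (s, u - (s - sm) + tm))"

definition ptrans :: "nat \<Rightarrow> (nat \<Rightarrow> 'a::{real_normed_algebra,real_algebra_1,banach}) \<Rightarrow> real
    \<Rightarrow> (nat \<Rightarrow> real \<Rightarrow> real) \<Rightarrow> 'a" where
  "ptrans d alp L x = (THE y. \<exists>F. F 0 = 1 \<and> F L = y \<and> continuous_on {0..L} F \<and>
     (\<exists>S. finite S \<and> (\<forall>u\<in>{0..L} - S.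
        (F has_vector_derivative (F u * (\<Sum>i<d. vector_derivative (x i) (at u within {0..L}) *\<^sub>R alp i)))
          (at u within {0..L}))))"

text \<open>iterated integrals; sigr on reversed words\<close>
fun sigr :: "nat \<Rightarrow> real \<Rightarrow> (nat \<Rightarrow> real \<Rightarrow> real) \<Rightarrow> real \<Rightarrow> nat list \<Rightarrow> real" where
  "sigr d L x t [] = 1"
| "sigr d L x t (i # w) = (if i < d then
      integral {0..t} (\<lambda>u. sigr d L x u w * vector_derivative (x i) (at u within {0..L})) else 0)"

text \<open>path signature S(x) of x : [0,L] -> V: coefficient of the word w is the iterated integral
  int_{0<u_1<...<u_n<L} dx^{w_1}_{u_1} ... dx^{w_n}_{u_n}\<close>
definition sig :: "nat \<Rightarrow> real \<Rightarrow> (nat \<Rightarrow> real \<Rightarrow> real) \<Rightarrow> t0" where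
  "sig d L x w = sigr d L x L (rev w)"

definition umul :: "real \<times> 'b::real_algebra \<Rightarrow> real \<times> 'b \<Rightarrow> real \<times> 'b" where
  "umul x y = (case x of (lam, E) \<Rightarrow> case y of (mu, F) \<Rightarrow>
      (lam * mu, lam *\<^sub>R F + mu *\<^sub>R E + E * F))"

text \<open>multiplication in R (+) prod_n T1^(n), on representatives\<close>
definition umul1 :: "real \<times> t1 \<Rightarrow> real \<times> t1 \<Rightarrow> real \<times> t1" where
  "umul1 x y = (case x of (lam, E) \<Rightarrow> case y of (mu, F) \<Rightarrow>
      (lam * mu, \<lambda>b. lam * F b + mu * E b + mul1 E F b))"

definition Hhat :: "nat \<Rightarrow> (nat \<Rightarrow> 'a::{real_normed_algebra,real_algebra_1,banach})
    \<Rightarrow> (nat \<Rightarrow> nat \<Rightarrow> 'b::{real_normed_algebra,banach})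
    \<Rightarrow> ('a \<Rightarrow> 'b \<Rightarrow> 'b) \<Rightarrow> ('b \<Rightarrow> 'a \<Rightarrow> 'b)
    \<Rightarrow> real \<Rightarrow> real \<Rightarrow> real \<Rightarrow> real \<Rightarrow> (nat \<Rightarrow> real \<times> real \<Rightarrow> real) \<Rightarrow> real \<times> 'b" where
  "Hhat d alp gam l r sm sp tm tp X =
    (let G = (\<lambda>t. integral {sm..sp} (\<lambda>s'.
               let F = ptrans d alp (tail_len sm tm s' t) (tail_path X sm tm s' t)
               in r (l F (\<Sum>i<d. \<Sum>j<d. if i < j then Jco X i j (s',t) *\<^sub>R gam i j else 0)) (ainv F)))
     in THE y. \<exists>H. H tm = (1, 0) \<and> H tp = y \<and>
          (\<forall>t\<in>{tm..tp}. (H has_vector_derivative umul (H t) (0, G t)) (at t within {tm..tp})))"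

definition Jt1 :: "nat \<Rightarrow> (nat \<Rightarrow> real \<times> real \<Rightarrow> real) \<Rightarrow> real \<times> real \<Rightarrow> t1" where
  "Jt1 d X z b = (case b of (u,(i,j),v) \<Rightarrow>
      if u = [] \<and> v = [] \<and> i < j \<and> j < d then Jco X i j z else 0)"

definition Rhat :: "nat \<Rightarrow> real \<Rightarrow> real \<Rightarrow> real \<Rightarrow> real \<Rightarrow> (nat \<Rightarrow> real \<times> real \<Rightarrow> real) \<Rightarrow> real \<times> t1" where
  "Rhat d sm sp tm tp X =
    (let G = (\<lambda>t b. integral {sm..sp} (\<lambda>s'.
               let g = sig d (tail_len sm tm s' t) (tail_path X sm tm s' t)
               in ract (lact g (Jt1 d X (s',t))) (inv0 g) b))
     in THE y. \<exists>R. R tm = (1, \<lambda>b. 0) \<and> R tp = y \<and>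
          (\<forall>t\<in>{tm..tp}.
             ((\<lambda>t. fst (R t)) has_real_derivative fst (umul1 (R t) (0, G t))) (at t within {tm..tp}) \<and>
             (\<forall>b. ((\<lambda>t. snd (R t) b) has_real_derivative snd (umul1 (R t) (0, G t)) b) (at t within {tm..tp}))))"

definition uext :: "(t1 \<Rightarrow> 'b) \<Rightarrow> real \<times> t1 \<Rightarrow> real \<times> 'b" where
  "uext g x = (fst x, g (snd x))"

end

theory Submission
  imports Defs
begin

text \<open>A continuous morphism is determined by its values on basis elements, as a series converging
  uniformly over families of coefficients that decay super-exponentially in the level. It therefore
  commutes with derivatives and integrals of such families. The coefficients of the signature of the
  tail path are iterated integrals, bounded factorially in the level, and those of the surface
  signature are obtained level by level with weighted \<open>\<ell>\<close>-1 bounds for every weight. Hence the image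
  of the path signature solves the equation of parallel transport, the image of the surface signature
  solves the equation of surface holonomy, and both equations have unique solutions.\<close>

section \<open>Graded sequence spaces and their continuous functionals\<close>

text \<open>The quotient by \<open>Pf\<close> never has to be computed: \<open>norm1\<close> is an
  infimum over representatives, hence at most the l1 norm of the representative at hand, and l1
  bounds on explicit coefficient functions are enough to place them in \<open>E1\<close> and to use
  continuity there. The objects compared are defined by \<open>THE\<close>, so each equation needs
  uniqueness in the full generality of its definition: parallel transport admits any finite
  exceptional set, because the tail path has a corner, and a surface signature is a coefficientwise
  solution with no growth condition. The latter is unique because every element of \<open>T1\<close>
  starts at level 2, so that right multiplication by the driver makes the system strictly triangular
  in the level. For the same reason Picard iteration becomes stationary at each level, but this says
  nothing about growth across levels. Membership in \<open>E1\<close> comes from a separate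
  induction on the level, which bounds \<rho>^n times the level-n norm by an exponential in time
  that does not depend on n, for every weight \<rho>.\<close>

definition unit_coeff :: "'i \<Rightarrow> 'i \<Rightarrow> real" where
  "unit_coeff b = (\<lambda>x. if x = b then 1 else 0)"

text \<open>The growth condition of \<open>E0\<close> and \<open>E1\<close>, imposed on a scalar
  majorant so that one sequence can serve a whole family of coefficient functions.\<close>

definition rapid :: "(nat \<Rightarrow> real) \<Rightarrow> bool" where
  "rapid c \<longleftrightarrow> (\<forall>l>0. summable (\<lambda>n. l ^ n * c n))"

lemma rapidD: "rapid c \<Longrightarrow> l > 0 \<Longrightarrow> summable (\<lambda>n. l ^ n * c n)"
  by (simp add: rapid_def)

lemma summable_le_comparison:
  fixes f g :: "nat \<Rightarrow> real"
  assumes "summable g" "\<And>n. 0 \<le> f n" "\<And>n. f n \<le> g n"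
  shows "summable f"
  by (rule summable_comparison_test'[OF assms(1), of 0]) (simp add: assms(2,3))

lemma rapid_add: "rapid c \<Longrightarrow> rapid c' \<Longrightarrow> rapid (\<lambda>n. c n + c' n)"
  unfolding rapid_def by (auto simp: distrib_left intro: summable_add)

lemma rapid_cmult: "rapid c \<Longrightarrow> rapid (\<lambda>n. k * c n)"
  unfolding rapid_def by (auto simp: mult.left_commute intro: summable_mult)

text \<open>The weight is multiplicative, l^n = l^k l^(n-k), so the weighted convolution is the
  Cauchy product of two absolutely convergent series.\<close>

lemma rapid_Cauchy_product:
  assumes "rapid c" "rapid c'" "\<And>n. 0 \<le> c n" "\<And>n. 0 \<le> c' n"
  shows "rapid (\<lambda>n. \<Sum>k\<le>n. c k * c' (n - k))"
  unfolding rapid_def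
proof (intro allI impI)
  fix l :: real assume l: "l > 0"
  have "summable (\<lambda>n. \<Sum>k\<le>n. (l ^ k * c k) * (l ^ (n - k) * c' (n - k)))"
    using l assms by (intro summable_Cauchy_product) (auto simp: abs_mult dest: rapidD)
  also have "(\<lambda>n. \<Sum>k\<le>n. (l ^ k * c k) * (l ^ (n - k) * c' (n - k)))
      = (\<lambda>n. l ^ n * (\<Sum>k\<le>n. c k * c' (n - k)))"
  proof
    fix n
    have "(l ^ k * c k) * (l ^ (n - k) * c' (n - k)) = l ^ n * (c k * c' (n - k))" if "k \<le> n" for k
    proof -
      have "l ^ n = l ^ k * l ^ (n - k)" using that by (simp flip: power_add)
      then show ?thesis by simp
    qed
    then show "(\<Sum>k\<le>n. (l ^ k * c k) * (l ^ (n - k) * c' (n - k))) = l ^ n * (\<Sum>k\<le>n. c k * c' (n - k))"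
      unfolding sum_distrib_left by (intro sum.cong) auto
  qed
  finally show "summable (\<lambda>n. l ^ n * (\<Sum>k\<le>n. c k * c' (n - k)))" .
qed

lemma rapid_finite: "finite {n. c n \<noteq> 0} \<Longrightarrow> rapid c"
  unfolding rapid_def by (auto intro!: summable_finite)

text \<open>Boundedness for all weights already gives summability for all weights: the bound at
  weight 2l leaves a factor (1/2)^n at weight l.\<close>

lemma rapid_if_geometric:
  assumes "\<And>l. l > 0 \<Longrightarrow> \<exists>B. \<forall>n. l ^ n * c n \<le> B" "\<And>n. 0 \<le> c n"
  shows "rapid c"
  unfolding rapid_def
proof (intro allI impI)
  fix l :: real assume l: "l > 0"
  then obtain B where B: "\<And>n. (2*l) ^ n * c n \<le> B" using assms(1)[of "2*l"] by auto
  have le: "l ^ n * c n \<le> B * (1/2) ^ n" for n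
  proof -
    have "l ^ n * c n = ((2*l) ^ n * c n) * (1/2) ^ n"
      by (simp add: power_mult_distrib power_one_over)
    also have "\<dots> \<le> B * (1/2) ^ n" by (intro mult_right_mono B) simp
    finally show ?thesis .
  qed
  then show "summable (\<lambda>n. l ^ n * c n)"
    using l assms(2)
    by (intro summable_le_comparison[OF _ _ le] summable_mult summable_geometric) auto
qed

text \<open>The balls are only a subbasis, with arbitrary centres, so convergence in every
  \<open>D l\<close> has to be carried to all generated open sets. Unions and finite intersections
  are formal; for a ball centred elsewhere the triangle inequality leaves room around the limit
  point.\<close>

lemma tendsto_topology_generated_by:
  fixes D :: "real \<Rightarrow> 'x \<Rightarrow> 'x \<Rightarrow> real" and f :: "'x \<Rightarrow> 'c::topological_space"
  assumes cont: "continuous_map (topology_generated_by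
        {{b \<in> S. D l b a < r} | a l r. a \<in> S \<and> l > 0 \<and> r > 0}) euclidean f"
    and tri: "\<And>l x y z. l > 0 \<Longrightarrow> x \<in> S \<Longrightarrow> y \<in> S \<Longrightarrow> z \<in> S \<Longrightarrow> D l x z \<le> D l x y + D l y z"
    and inS: "\<And>n. X n \<in> S" "x \<in> S" and refl: "D 1 x x < 1"
    and lim: "\<And>l. l > 0 \<Longrightarrow> (\<lambda>n. D l (X n) x) \<longlonglongrightarrow> 0"
  shows "(\<lambda>n::nat. f (X n)) \<longlonglongrightarrow> f x"
proof (rule topological_tendstoI)
  fix V :: "'c set" assume V: "open V" "f x \<in> V"
  define BB where "BB = {{b \<in> S. D l b a < r} | a l r. a \<in> S \<and> l > 0 \<and> (r::real) > 0}"
  have ev: "x \<in> U \<longrightarrow> (\<forall>\<^sub>F n in sequentially. X n \<in> U)" if "generate_topology_on BB U" for U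
    using that
  proof induction
    case (Int a b)
    then show ?case by (auto intro: eventually_conj)
  next
    case (UN K)
    show ?case
    proof
      assume "x \<in> \<Union>K"
      then obtain k where "k \<in> K" "x \<in> k" by blast
      with UN have "\<forall>\<^sub>F n in sequentially. X n \<in> k" by blast
      then show "\<forall>\<^sub>F n in sequentially. X n \<in> \<Union>K"
        by (rule eventually_mono) (use \<open>k \<in> K\<close> in blast)
    qed
  next
    case (Basis s)
    then obtain a l r where s: "s = {b \<in> S. D l b a < r}" "a \<in> S" "l > 0" "r > 0"
      by (auto simp: BB_def)
    show ?case
    proof
      assume "x \<in> s"
      then have "0 < r - D l x a" using s by auto
      then have "\<forall>\<^sub>F n in sequentially. D l (X n) x < r - D l x a"
        using lim[OF \<open>l > 0\<close>] by (simp add: order_tendstoD)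
      then show "\<forall>\<^sub>F n in sequentially. X n \<in> s"
      proof eventually_elim
        case (elim n)
        then have "D l (X n) a < r"
          using tri[OF \<open>l > 0\<close> inS(1) inS(2) \<open>a \<in> S\<close>, of n] by linarith
        then show ?case using inS(1) s(1) by simp
      qed
    qed
  qed auto
  \<comment> \<open>The topspace is the union of the generating sets, so some ball has to contain
    the limit point.\<close>
  have "{b \<in> S. D 1 b x < 1} \<in> BB" using inS by (force simp: BB_def)
  then have xt: "x \<in> topspace (topology_generated_by BB)"
    unfolding topology_generated_by_topspace
    by (rule UnionI) (use inS(2) refl in simp)
  have "openin (topology_generated_by BB) {y \<in> topspace (topology_generated_by BB). f y \<in> V}"
    using cont V unfolding BB_def by (intro openin_continuous_map_preimage) auto
  from ev[OF this[unfolded openin_topology_generated_by_iff]] xt V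
  show "\<forall>\<^sub>F n in sequentially. f (X n) \<in> V" by (auto elim: eventually_mono)
qed

text \<open>The common core of the Hilbert norms on words and of the quotient norms modulo
  \<open>Pf\<close>. The comparison with l1 is the only upper bound on \<open>N\<close> that is
  needed.\<close>

locale graded_seminorms =
  fixes V :: "'i \<Rightarrow> bool" and lev :: "'i \<Rightarrow> nat" and N :: "nat \<Rightarrow> ('i \<Rightarrow> real) \<Rightarrow> real"
  assumes finite_level: "\<And>n. finite {b. V b \<and> lev b = n}"
    and N_nonneg: "\<And>k x. 0 \<le> N k x"
    and N_triangle: "\<And>k x y. N k (\<lambda>b. x b + y b) \<le> N k x + N k y"
    and N_uminus: "\<And>k x. N k (\<lambda>b. - x b) = N k x"
    and N_le_l1: "\<And>k x. N k x \<le> (\<Sum>b | V b \<and> lev b = k. \<bar>x b\<bar>)"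
begin

definition l1 :: "nat \<Rightarrow> ('i \<Rightarrow> real) \<Rightarrow> real" where
  "l1 n x = (\<Sum>b | V b \<and> lev b = n. \<bar>x b\<bar>)"

text \<open>Sharing one majorant \<open>c\<close> among all members of a family is what makes the
  series for \<open>f\<close> converge uniformly over the family.\<close>

definition dom :: "(nat \<Rightarrow> real) \<Rightarrow> ('i \<Rightarrow> real) \<Rightarrow> bool" where
  "dom c x \<longleftrightarrow> (\<forall>b. \<not> V b \<longrightarrow> x b = 0) \<and> (\<forall>n. l1 n x \<le> c n)"

definition entire :: "('i \<Rightarrow> real) set" where
  "entire = {a. (\<forall>b. \<not> V b \<longrightarrow> a b = 0) \<and> (\<forall>l>0. summable (\<lambda>k. l ^ k * N k a))}"

lemma l1_nonneg: "0 \<le> l1 n x"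
  by (simp add: l1_def sum_nonneg)

lemma dom_nonneg: "dom c x \<Longrightarrow> 0 \<le> c n"
  unfolding dom_def using order_trans[OF l1_nonneg] by blast

lemma l1_mono: "(\<And>b. V b \<Longrightarrow> \<bar>x b\<bar> \<le> \<bar>y b\<bar>) \<Longrightarrow> l1 n x \<le> l1 n y"
  unfolding l1_def by (rule sum_mono) auto

lemma l1_add: "l1 n (\<lambda>b. x b + y b) \<le> l1 n x + l1 n y"
  unfolding l1_def sum.distrib[symmetric] by (rule sum_mono) auto

lemma dom_add: "dom c x \<Longrightarrow> dom c' y \<Longrightarrow> dom (\<lambda>n. c n + c' n) (\<lambda>b. x b + y b)"
  unfolding dom_def by (auto intro!: order_trans[OF l1_add] add_mono)

lemma dom_rapid_entire:
  assumes "dom c x" "rapid c"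
  shows "x \<in> entire"
proof -
  have "summable (\<lambda>k. l ^ k * N k x)" if "l > 0" for l
  proof (rule summable_le_comparison[OF rapidD[OF assms(2) that]])
    have "N n x \<le> c n" for n
      using N_le_l1[of n x] assms(1) order_trans unfolding dom_def l1_def by blast
    then show "l ^ n * N n x \<le> l ^ n * c n" for n
      using that by (simp add: mult_left_mono)
  qed (use that N_nonneg in simp)
  then show ?thesis using assms by (auto simp: entire_def dom_def)
qed

lemma N_zero: "N k (\<lambda>b. 0) = 0"
  using N_le_l1[of k "\<lambda>b. 0"] N_nonneg[of k "\<lambda>b. 0"] by simp

lemma entire_summable_diff:
  assumes "x \<in> entire" "y \<in> entire" "l > 0"
  shows "summable (\<lambda>k. l ^ k * N k (\<lambda>b. x b - y b))"
proof -
  have le: "N k (\<lambda>b. x b - y b) \<le> N k x + N k y" for k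
    using N_triangle[of k x "\<lambda>b. - y b"] N_uminus[of k y] by simp
  have "summable (\<lambda>k. l ^ k * N k x + l ^ k * N k y)"
    using assms by (intro summable_add) (auto simp: entire_def)
  then show ?thesis
  proof (rule summable_le_comparison)
    show "l ^ k * N k (\<lambda>b. x b - y b) \<le> l ^ k * N k x + l ^ k * N k y" for k
      unfolding distrib_left[symmetric] using assms(3) by (intro mult_left_mono le) simp
  qed (use assms(3) N_nonneg in simp)
qed

lemma entire_triangle:
  assumes "x \<in> entire" "y \<in> entire" "z \<in> entire" "l > 0"
  shows "(\<Sum>k. l ^ k * N k (\<lambda>b. x b - z b))
    \<le> (\<Sum>k. l ^ k * N k (\<lambda>b. x b - y b)) + (\<Sum>k. l ^ k * N k (\<lambda>b. y b - z b))"
proof -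
  have le: "N k (\<lambda>b. x b - z b) \<le> N k (\<lambda>b. x b - y b) + N k (\<lambda>b. y b - z b)" for k
    using N_triangle[of k "\<lambda>b. x b - y b" "\<lambda>b. y b - z b"] by simp
  note s = entire_summable_diff[OF _ _ \<open>l > 0\<close>]
  show ?thesis
    unfolding suminf_add[OF s[OF assms(1,2)] s[OF assms(2,3)]]
  proof (intro suminf_le s summable_add assms)
    show "l ^ k * N k (\<lambda>b. x b - z b)
        \<le> l ^ k * N k (\<lambda>b. x b - y b) + l ^ k * N k (\<lambda>b. y b - z b)" for k
      unfolding distrib_left[symmetric] using assms(4) by (intro mult_left_mono le) simp
  qed
qed

lemma dom_truncate: "dom c x \<Longrightarrow> dom c (\<lambda>b. if P b then x b else 0)"
proof -
  assume c: "dom c x"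
  have "l1 n (\<lambda>b. if P b then x b else 0) \<le> l1 n x" for n by (rule l1_mono) auto
  then show ?thesis using c unfolding dom_def by (auto intro: order_trans)
qed

lemma dom_zero: "dom (\<lambda>n. 0) (\<lambda>b. 0)"
  by (simp add: dom_def l1_def)

lemma dom_unit: "V b \<Longrightarrow> dom (\<lambda>n. if n = lev b then 1 else 0) (unit_coeff b)"
  unfolding dom_def l1_def unit_coeff_def
  using finite_level by (auto simp: if_distrib[of abs] sum.delta cong: if_cong)

lemma rapid_unit: "rapid (\<lambda>n. if n = k then 1 else 0)"
  by (rule rapid_finite) auto

lemma unit_entire: "V b \<Longrightarrow> unit_coeff b \<in> entire"
  by (rule dom_rapid_entire[OF dom_unit rapid_unit])

lemma dom_support: "dom c x \<Longrightarrow> \<not> V b \<Longrightarrow> x b = 0"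
  by (simp add: dom_def)

lemma l1_integral_le:
  fixes x :: "real \<Rightarrow> 'i \<Rightarrow> real"
  assumes x: "\<And>i. V i \<Longrightarrow> continuous_on {a..b} (\<lambda>t. x t i)"
    and le: "\<And>t. t \<in> {a..b} \<Longrightarrow> l1 n (x t) \<le> \<phi> t" and "\<phi> integrable_on {a..b}"
  shows "l1 n (\<lambda>i. integral {a..b} (\<lambda>t. x t i)) \<le> integral {a..b} \<phi>"
proof -
  let ?B = "{i. V i \<and> lev i = n}"
  have cabs: "continuous_on {a..b} (\<lambda>t. \<bar>x t i\<bar>)" if "V i" for i
    using x[OF that] by (intro continuous_intros)
  have "l1 n (\<lambda>i. integral {a..b} (\<lambda>t. x t i)) \<le> (\<Sum>i\<in>?B. integral {a..b} (\<lambda>t. \<bar>x t i\<bar>))"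
    unfolding l1_def real_norm_def[symmetric] using x cabs
    by (intro sum_mono integral_norm_bound_integral integrable_continuous_interval) simp_all
  also have "\<dots> = integral {a..b} (\<lambda>t. \<Sum>i\<in>?B. \<bar>x t i\<bar>)"
    using finite_level cabs by (intro integral_sum[symmetric] integrable_continuous_interval) simp_all
  also have "\<dots> \<le> integral {a..b} \<phi>"
    using le by (intro integral_le integrable_continuous_interval continuous_on_sum cabs assms(3)) (simp_all add: l1_def)
  finally show ?thesis .
qed

lemma dom_integral:
  fixes x :: "real \<Rightarrow> 'i \<Rightarrow> real"
  assumes "a \<le> b" "\<And>t. t \<in> {a..b} \<Longrightarrow> dom c (x t)" "\<And>i. V i \<Longrightarrow> continuous_on {a..b} (\<lambda>t. x t i)"
  shows "dom (\<lambda>n. (b - a) * c n) (\<lambda>i. integral {a..b} (\<lambda>t. x t i))"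
  unfolding dom_def
proof (intro conjI allI impI)
  fix i assume "\<not> V i"
  then have "integral {a..b} (\<lambda>t. x t i) = integral {a..b} (\<lambda>t. 0)"
    using dom_support[OF assms(2)] by (intro integral_cong) blast
  then show "integral {a..b} (\<lambda>t. x t i) = 0" by simp
next
  fix n
  have "l1 n (\<lambda>i. integral {a..b} (\<lambda>t. x t i)) \<le> integral {a..b} (\<lambda>t. c n)"
    using assms(2,3) by (intro l1_integral_le) (auto simp: dom_def)
  then show "l1 n (\<lambda>i. integral {a..b} (\<lambda>t. x t i)) \<le> (b - a) * c n" using \<open>a \<le> b\<close> by simp
qed

lemma dom_l1_self: "(\<And>b. \<not> V b \<Longrightarrow> x b = 0) \<Longrightarrow> dom (\<lambda>n. l1 n x) x"
  by (simp add: dom_def)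

end

section \<open>Continuous linear maps on graded sequence spaces, expanded in basis elements\<close>

locale graded_functional = graded_seminorms V lev N
  for V :: "'i \<Rightarrow> bool" and lev N +
  fixes f :: "('i \<Rightarrow> real) \<Rightarrow> 'c::banach" and A K :: real
  assumes lin: "\<And>x y c. x \<in> entire \<Longrightarrow> y \<in> entire \<Longrightarrow> f (\<lambda>b. c * x b + y b) = c *\<^sub>R f x + f y"
    and cont: "continuous_map (topology_generated_by
        {{b \<in> entire. (\<Sum>k. l ^ k * N k (\<lambda>i. b i - a i)) < r} | a l r. a \<in> entire \<and> l > 0 \<and> r > 0})
        euclidean f"
    and A_nonneg: "0 \<le> A" and K_pos: "0 < K"
    and f_unit_bound: "\<And>b. V b \<Longrightarrow> norm (f (unit_coeff b)) \<le> A * K ^ lev b"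
begin

lemma f_zero: "f (\<lambda>b. 0) = 0"
  using lin[of "\<lambda>b. 0" "\<lambda>b. 0" 1] dom_rapid_entire[OF dom_zero] by (simp add: rapid_def)

text \<open>Linearity is available only inside \<open>entire\<close>, so membership is carried along
  in the induction.\<close>

lemma f_finite_sum:
  assumes "finite I" "\<And>i. i \<in> I \<Longrightarrow> V i"
  shows "(\<lambda>b. if b \<in> I then x b else 0) \<in> entire \<and>
    f (\<lambda>b. if b \<in> I then x b else 0) = (\<Sum>i\<in>I. x i *\<^sub>R f (unit_coeff i))"
  using assms
proof (induction I)
  case empty
  show ?case using f_zero dom_rapid_entire[OF dom_zero] by (simp add: rapid_def)
next
  case (insert i I)
  have eq: "(\<lambda>b. if b \<in> insert i I then x b else 0)
      = (\<lambda>b. x i * unit_coeff i b + (if b \<in> I then x b else 0))"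
    using insert.hyps by (auto simp: unit_coeff_def fun_eq_iff)
  have "(\<lambda>b. if b \<in> insert i I then x b else 0) \<in> entire"
  proof (rule dom_rapid_entire)
    show "dom (\<lambda>n. l1 n (\<lambda>b. if b \<in> insert i I then x b else 0)) (\<lambda>b. if b \<in> insert i I then x b else 0)"
      using insert.prems by (auto simp: dom_def)
    have "l1 n (\<lambda>b. if b \<in> insert i I then x b else 0) = 0" if "n \<notin> lev ` insert i I" for n
      unfolding l1_def using that by (intro sum.neutral) auto
    then have "{n. l1 n (\<lambda>b. if b \<in> insert i I then x b else 0) \<noteq> 0} \<subseteq> lev ` insert i I" by blast
    then show "rapid (\<lambda>n. l1 n (\<lambda>b. if b \<in> insert i I then x b else 0))"
      using insert.hyps by (intro rapid_finite) (auto intro: finite_subset)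
  qed
  moreover have "f (\<lambda>b. if b \<in> insert i I then x b else 0)
      = x i *\<^sub>R f (unit_coeff i) + (\<Sum>i\<in>I. x i *\<^sub>R f (unit_coeff i))"
    unfolding eq using insert by (subst lin) (auto intro: unit_entire)
  ultimately show ?case using insert.hyps by simp
qed

text \<open>Truncations below level m converge to \<open>x\<close> in every seminorm, the error
  being at most the tail of a convergent series. Continuity then identifies \<open>f x\<close> as
  the limit of the values on truncations, which are finite sums.\<close>

lemma f_sums:
  assumes "dom c x" "rapid c"
  shows "(\<lambda>n. \<Sum>b | V b \<and> lev b = n. x b *\<^sub>R f (unit_coeff b)) sums f x"
proof -
  define tr where "tr m = (\<lambda>b. if lev b < m then x b else 0)" for m
  have tr: "tr m \<in> entire" "x \<in> entire" for m
    unfolding tr_def by (rule dom_rapid_entire[OF dom_truncate] dom_rapid_entire; use assms in blast)+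
  have "(\<lambda>m. f (tr m)) \<longlonglongrightarrow> f x"
  proof (rule tendsto_topology_generated_by[OF cont entire_triangle tr])
    show "(\<Sum>k. 1 ^ k * N k (\<lambda>i. x i - x i)) < 1" by (simp add: N_zero)
    fix l :: real assume l: "l > 0"
    note s = rapidD[OF assms(2) l]
    have cn: "0 \<le> c n" for n using dom_nonneg assms(1) by blast
    \<comment> \<open>The truncation agrees with \<open>x\<close> below level m; from level m on the
      error is \<open>x\<close> itself up to sign.\<close>
    have bnd: "N k (\<lambda>i. tr m i - x i) \<le> (if k < m then 0 else c k)" for k m
    proof -
      have "N k (\<lambda>i. tr m i - x i) \<le> l1 k (\<lambda>i. tr m i - x i)" using N_le_l1 by (simp add: l1_def)
      also have "\<dots> \<le> (if k < m then 0 else c k)"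
      proof (cases "k < m")
        case False
        have "l1 k (\<lambda>i. tr m i - x i) \<le> l1 k x" by (rule l1_mono) (auto simp: tr_def)
        then show ?thesis using False assms(1) by (auto simp: dom_def intro: order_trans)
      qed (auto simp: l1_def tr_def)
      finally show ?thesis .
    qed
    have le: "l ^ k * N k (\<lambda>i. tr m i - x i) \<le> (if k < m then 0 else l ^ k * c k)" for k m
      using mult_left_mono[OF bnd[of k m], of "l ^ k"] l by (cases "k < m") simp_all
    have tail: "(\<lambda>k. if k < m then 0 else l ^ k * c k) sums ((\<Sum>k. l ^ k * c k) - (\<Sum>k<m. l ^ k * c k))" for m
    proof -
      have "(\<lambda>k. l ^ k * c k - (if k \<in> {..<m} then l ^ k * c k else 0)) sums
         ((\<Sum>k. l ^ k * c k) - (\<Sum>k<m. l ^ k * c k))"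
        by (intro sums_diff summable_sums s sums_If_finite_set) auto
      moreover have "(\<lambda>k. l ^ k * c k - (if k \<in> {..<m} then l ^ k * c k else 0))
          = (\<lambda>k. if k < m then 0 else l ^ k * c k)" by auto
      ultimately show ?thesis by simp
    qed
    have up: "(\<Sum>k. l ^ k * N k (\<lambda>i. tr m i - x i)) \<le> (\<Sum>k. l ^ k * c k) - (\<Sum>k<m. l ^ k * c k)" for m
      using suminf_le[OF le entire_summable_diff[OF tr l] sums_summable[OF tail]] sums_unique[OF tail]
      by simp
    have lo: "0 \<le> (\<Sum>k. l ^ k * N k (\<lambda>i. tr m i - x i))" for m
      using l by (intro suminf_nonneg entire_summable_diff tr) (auto simp: N_nonneg)
    have "(\<lambda>m. (\<Sum>k. l ^ k * c k) - (\<Sum>k<m. l ^ k * c k)) \<longlonglongrightarrow> (\<Sum>k. l ^ k * c k) - (\<Sum>k. l ^ k * c k)"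
      by (intro tendsto_diff tendsto_const summable_LIMSEQ s)
    then have 0: "(\<lambda>m. (\<Sum>k. l ^ k * c k) - (\<Sum>k<m. l ^ k * c k)) \<longlonglongrightarrow> 0" by simp
    show "(\<lambda>m. \<Sum>k. l ^ k * N k (\<lambda>i. tr m i - x i)) \<longlonglongrightarrow> 0"
      by (rule real_tendsto_sandwich[OF _ _ tendsto_const 0]) (use up lo in auto)
  qed auto
  moreover have "f (tr m) = (\<Sum>n<m. \<Sum>b | V b \<and> lev b = n. x b *\<^sub>R f (unit_coeff b))" for m
  proof -
    have eq: "tr m = (\<lambda>b. if b \<in> (\<Union>n<m. {b. V b \<and> lev b = n}) then x b else 0)"
      using assms(1) by (auto simp: tr_def dom_def fun_eq_iff)
    have "f (tr m) = (\<Sum>b\<in>(\<Union>n<m. {b. V b \<and> lev b = n}). x b *\<^sub>R f (unit_coeff b))"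
      unfolding eq using finite_level by (intro conjunct2[OF f_finite_sum]) auto
    also have "\<dots> = (\<Sum>n<m. \<Sum>b | V b \<and> lev b = n. x b *\<^sub>R f (unit_coeff b))"
      using finite_level by (intro sum.UNION_disjoint) auto
    finally show ?thesis .
  qed
  ultimately show ?thesis by (simp add: sums_def)
qed

lemma norm_level_le:
  assumes "dom c x"
  shows "norm (\<Sum>b | V b \<and> lev b = n. x b *\<^sub>R f (unit_coeff b)) \<le> A * (K ^ n * c n)"
proof -
  have "norm (\<Sum>b | V b \<and> lev b = n. x b *\<^sub>R f (unit_coeff b)) \<le> (\<Sum>b | V b \<and> lev b = n. \<bar>x b\<bar> * (A * K ^ n))"
    by (rule sum_norm_le) (use f_unit_bound in \<open>auto simp: mult_left_mono\<close>)
  also have "\<dots> = l1 n x * (A * K ^ n)" by (simp add: l1_def sum_distrib_right)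
  also have "\<dots> \<le> c n * (A * K ^ n)"
    using assms A_nonneg K_pos by (intro mult_right_mono) (auto simp: dom_def)
  finally show ?thesis by (simp add: mult_ac)
qed

lemma summable_bound: "rapid c \<Longrightarrow> summable (\<lambda>n. A * (K ^ n * c n))"
  using K_pos by (intro summable_mult rapidD)

lemma norm_f_le:
  assumes "dom c x" "rapid c"
  shows "norm (f x) \<le> (\<Sum>n. A * (K ^ n * c n))"
proof -
  have "norm (\<Sum>n. \<Sum>b | V b \<and> lev b = n. x b *\<^sub>R f (unit_coeff b)) \<le> (\<Sum>n. A * (K ^ n * c n))"
    by (rule norm_suminf_le[OF norm_level_le[OF assms(1)] summable_bound[OF assms(2)]])
  then show ?thesis using sums_unique[OF f_sums[OF assms]] by simp
qed

lemma f_uniform_limit: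
  assumes "\<And>t. t \<in> S \<Longrightarrow> dom c (x t)" "rapid c"
  shows "uniform_limit S (\<lambda>m t. \<Sum>n<m. \<Sum>b | V b \<and> lev b = n. x t b *\<^sub>R f (unit_coeff b))
     (\<lambda>t. f (x t)) sequentially"
proof -
  have "uniform_limit S (\<lambda>m t. \<Sum>n<m. \<Sum>b | V b \<and> lev b = n. x t b *\<^sub>R f (unit_coeff b))
     (\<lambda>t. \<Sum>n. \<Sum>b | V b \<and> lev b = n. x t b *\<^sub>R f (unit_coeff b)) sequentially"
    by (rule Weierstrass_m_test[OF _ summable_bound[OF assms(2)]]) (use assms norm_level_le in blast)
  then show ?thesis
    by (rule uniform_limit_cong'[THEN iffD1, rotated -1])
      (simp_all add: sums_unique[symmetric, OF f_sums[OF assms(1) assms(2)]])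
qed

text \<open>Integrals commute with the uniform limit of partial sums, and each partial sum involves
  only finitely many scalar integrals. The assumptions \<open>dI\<close> allow the series of the
  integrated coefficients to be summed by \<open>f_sums\<close>.\<close>

lemma f_has_integral:
  fixes x :: "real \<Rightarrow> 'i \<Rightarrow> real"
  assumes "\<And>t. t \<in> {p..q} \<Longrightarrow> dom c (x t)" "rapid c" "\<And>b. V b \<Longrightarrow> continuous_on {p..q} (\<lambda>t. x t b)"
    and dI: "dom c' (\<lambda>b. integral {p..q} (\<lambda>t. x t b))" "rapid c'"
  shows "((\<lambda>t. f (x t)) has_integral f (\<lambda>b. integral {p..q} (\<lambda>t. x t b))) {p..q}"
proof -
  let ?P = "\<lambda>m t. \<Sum>n<m. \<Sum>b | V b \<and> lev b = n. x t b *\<^sub>R f (unit_coeff b)"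
  obtain I J where IJ: "\<And>n. (?P n has_integral I n) {p..q}"
      "((\<lambda>t. f (x t)) has_integral J) {p..q}" "I \<longlonglongrightarrow> J"
    by (rule uniform_limit_integral[OF f_uniform_limit[OF assms(1,2)]])
      (auto intro!: continuous_intros assms(3))
  have I: "I m = (\<Sum>n<m. \<Sum>b | V b \<and> lev b = n. integral {p..q} (\<lambda>t. x t b) *\<^sub>R f (unit_coeff b))" for m
  proof (rule has_integral_unique[OF IJ(1)])
    have "((\<lambda>t. x t b *\<^sub>R f (unit_coeff b)) has_integral integral {p..q} (\<lambda>t. x t b) *\<^sub>R f (unit_coeff b)) {p..q}"
      if "V b" for b
      by (intro has_integral_scaleR_left integrable_integral integrable_continuous_interval assms(3) that)
    then show "(?P m has_integral (\<Sum>n<m. \<Sum>b | V b \<and> lev b = n. integral {p..q} (\<lambda>t. x t b) *\<^sub>R f (unit_coeff b))) {p..q}"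
      using finite_level by (intro has_integral_sum) auto
  qed
  have "I \<longlonglongrightarrow> f (\<lambda>b. integral {p..q} (\<lambda>t. x t b))"
    using f_sums[OF dI] unfolding sums_def I .
  then have "J = f (\<lambda>b. integral {p..q} (\<lambda>t. x t b))" using IJ(3) LIMSEQ_unique by blast
  then show ?thesis using IJ(2) by simp
qed

text \<open>Termwise differentiation: the series of derivatives converges uniformly because
  \<open>x'\<close> has a rapid majorant of its own.\<close>

lemma f_has_vector_derivative:
  fixes x x' :: "real \<Rightarrow> 'i \<Rightarrow> real"
  assumes "convex S" "t \<in> S"
    and "\<And>t. t \<in> S \<Longrightarrow> dom c (x t)" "rapid c" "\<And>t. t \<in> S \<Longrightarrow> dom c' (x' t)" "rapid c'"
    and deriv: "\<And>t b. t \<in> S \<Longrightarrow> V b \<Longrightarrow> ((\<lambda>t. x t b) has_real_derivative x' t b) (at t within S)"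
  shows "((\<lambda>t. f (x t)) has_vector_derivative f (x' t)) (at t within S)"
proof -
  define F where "F y n = (\<Sum>b | V b \<and> lev b = n. y b *\<^sub>R f (unit_coeff b))" for y n
  have "\<exists>g. \<forall>t\<in>S. (\<lambda>n. F (x t) n) sums g t \<and> (g has_derivative (\<lambda>h. h *\<^sub>R f (x' t))) (at t within S)"
  proof (rule has_derivative_series[OF \<open>convex S\<close> _ _ \<open>t \<in> S\<close>])
    show "(\<lambda>n. F (x t) n) sums f (x t)" unfolding F_def using assms(2-4) by (intro f_sums) auto
    show "((\<lambda>t. F (x t) n) has_derivative (\<lambda>h. h *\<^sub>R F (x' t) n)) (at t within S)" if "t \<in> S" for n t
      unfolding F_def has_vector_derivative_def[symmetric] using deriv[OF that]
      by (intro has_vector_derivative_sum) (auto intro!: derivative_eq_intros)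
    fix e :: real assume "e > 0"
    have "uniform_limit S (\<lambda>m t. \<Sum>n<m. F (x' t) n) (\<lambda>t. f (x' t)) sequentially"
      unfolding F_def by (rule f_uniform_limit[OF assms(5,6)])
    from uniform_limitD[OF this \<open>e > 0\<close>]
    show "\<forall>\<^sub>F m in sequentially. \<forall>t\<in>S. \<forall>h. norm ((\<Sum>n<m. h *\<^sub>R F (x' t) n) - h *\<^sub>R f (x' t)) \<le> e * norm h"
    proof eventually_elim
      case (elim m)
      show ?case
      proof (intro ballI allI)
        fix t h assume "t \<in> S"
        have "(\<Sum>n<m. h *\<^sub>R F (x' t) n) - h *\<^sub>R f (x' t) = h *\<^sub>R ((\<Sum>n<m. F (x' t) n) - f (x' t))"
          by (simp add: scaleR_sum_right scaleR_diff_right)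
        moreover have "norm ((\<Sum>n<m. F (x' t) n) - f (x' t)) \<le> e"
          using elim \<open>t \<in> S\<close> by (auto simp: dist_norm intro: less_imp_le)
        ultimately show "norm ((\<Sum>n<m. h *\<^sub>R F (x' t) n) - h *\<^sub>R f (x' t)) \<le> e * norm h"
          by (simp add: mult.commute[of e] mult_left_mono)
      qed
    qed
  qed
  then obtain g where g: "\<And>t. t \<in> S \<Longrightarrow> (\<lambda>n. F (x t) n) sums g t"
      "\<And>t. t \<in> S \<Longrightarrow> (g has_derivative (\<lambda>h. h *\<^sub>R f (x' t))) (at t within S)" by blast
  have "g t = f (x t)" if "t \<in> S" for t
    using g(1)[OF that] f_sums[OF assms(3)[OF that] assms(4)] sums_unique2 unfolding F_def by blast
  then show ?thesis
    unfolding has_vector_derivative_def using g(2)[OF \<open>t \<in> S\<close>] \<open>t \<in> S\<close>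
    by (rule_tac has_derivative_transform) auto
qed

end

section \<open>The spaces of words and of bimodule basis elements\<close>

lemma finite_valid0_level: "finite {w. valid0 d w \<and> length w = n}"
  using finite_lists_length_eq[of "{..<d}" n] by (simp add: valid0_def)

lemma finite_valid1_level: "finite {b. valid1 d b \<and> level1 b = n}"
proof (rule finite_subset)
  let ?W = "{w. set w \<subseteq> {..<d} \<and> length w \<le> n}"
  show "{b. valid1 d b \<and> level1 b = n} \<subseteq> ?W \<times> ({..<d} \<times> {..<d}) \<times> ?W"
    by (auto simp: valid1_def level1_def)
  show "finite (?W \<times> ({..<d} \<times> {..<d}) \<times> ?W)"
    by (intro finite_cartesian_product finite_lists_length_le) auto
qed

lemma words_eq: "words d n = {w. valid0 d w \<and> length w = n}"
  by (auto simp: words_def)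

lemma norm0_eq_L2_set: "norm0 d k a = L2_set a {w. valid0 d w \<and> length w = k}"
  by (simp add: norm0_def L2_set_def words_eq)

interpretation T0: graded_seminorms "valid0 d" length "norm0 d" for d
proof
  fix n k :: nat and x y :: t0
  show "finite {b. valid0 d b \<and> length b = n}" by (rule finite_valid0_level)
  show "0 \<le> norm0 d k x" by (simp add: norm0_def sum_nonneg)
  show "norm0 d k (\<lambda>b. x b + y b) \<le> norm0 d k x + norm0 d k y"
    unfolding norm0_eq_L2_set by (rule L2_set_triangle_ineq)
  show "norm0 d k (\<lambda>b. - x b) = norm0 d k x" by (simp add: norm0_def)
  show "norm0 d k x \<le> (\<Sum>b | valid0 d b \<and> length b = k. \<bar>x b\<bar>)"
    unfolding norm0_eq_L2_set by (rule L2_set_le_sum_abs)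
qed

section \<open>Quotient seminorms modulo the Peiffer subspace\<close>

lemma Pfn_zero: "(\<lambda>b. 0) \<in> Pfn d n"
  by (simp add: Pfn_def Pf_zero)

lemma Pfn_add: "P \<in> Pfn d n \<Longrightarrow> Q \<in> Pfn d n \<Longrightarrow> (\<lambda>b. P b + Q b) \<in> Pfn d n"
  by (simp add: Pfn_def Pf_add)

lemma Pfn_uminus: "P \<in> Pfn d n \<Longrightarrow> (\<lambda>b. - P b) \<in> Pfn d n"
  using Pf_scale[of P d "-1"] by (simp add: Pfn_def)

lemma norm1_le:
  assumes "P \<in> Pfn d n"
  shows "norm1 d n E \<le> L2_set (\<lambda>b. E b - P b) (basis1 d n)"
  unfolding norm1_def L2_set_def
  by (rule cInf_lower) (use assms in \<open>auto intro!: bdd_belowI[of _ 0] sum_nonneg\<close>)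

lemma norm1_greatest:
  assumes "\<And>P. P \<in> Pfn d n \<Longrightarrow> c \<le> L2_set (\<lambda>b. E b - P b) (basis1 d n)"
  shows "c \<le> norm1 d n E"
  unfolding norm1_def
  by (rule cInf_greatest) (use assms Pfn_zero in \<open>auto simp: L2_set_def\<close>)

lemma norm1_uminus_le: "norm1 d n (\<lambda>b. - E b) \<le> norm1 d n E"
proof (rule norm1_greatest)
  fix P assume "P \<in> Pfn d n"
  from norm1_le[OF Pfn_uminus[OF this], of "\<lambda>b. - E b"]
  have "norm1 d n (\<lambda>b. - E b) \<le> L2_set (\<lambda>b. - (E b - P b)) (basis1 d n)" by simp
  then show "norm1 d n (\<lambda>b. - E b) \<le> L2_set (\<lambda>b. E b - P b) (basis1 d n)"
    by (simp only: L2_set_def power2_minus)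
qed

text \<open>If P and Q are competitors for E and F, then P + Q is one for E + F; the two infima are
  then taken one after the other.\<close>

lemma norm1_triangle: "norm1 d n (\<lambda>b. E b + F b) \<le> norm1 d n E + norm1 d n F"
proof -
  have "norm1 d n (\<lambda>b. E b + F b) \<le> L2_set (\<lambda>b. E b - P b) (basis1 d n) + L2_set (\<lambda>b. F b - Q b) (basis1 d n)"
    if "P \<in> Pfn d n" "Q \<in> Pfn d n" for P Q
  proof -
    have "norm1 d n (\<lambda>b. E b + F b) \<le> L2_set (\<lambda>b. (E b - P b) + (F b - Q b)) (basis1 d n)"
      using norm1_le[OF Pfn_add[OF that], of "\<lambda>b. E b + F b"] by (simp add: algebra_simps)
    also have "\<dots> \<le> L2_set (\<lambda>b. E b - P b) (basis1 d n) + L2_set (\<lambda>b. F b - Q b) (basis1 d n)"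
      by (rule L2_set_triangle_ineq)
    finally show ?thesis .
  qed
  then have "norm1 d n (\<lambda>b. E b + F b) - L2_set (\<lambda>b. E b - P b) (basis1 d n) \<le> norm1 d n F"
    if "P \<in> Pfn d n" for P
    using that by (intro norm1_greatest) (auto simp: algebra_simps)
  then have "norm1 d n (\<lambda>b. E b + F b) - norm1 d n F \<le> norm1 d n E"
    by (intro norm1_greatest) (auto simp: algebra_simps)
  then show ?thesis by simp
qed

text \<open>The comparison with l1 uses the competitor 0, so a bound on any representative bounds
  its class.\<close>

interpretation T1: graded_seminorms "valid1 d" level1 "norm1 d" for d
proof
  fix n k :: nat and x y :: t1
  show "finite {b. valid1 d b \<and> level1 b = n}" by (rule finite_valid1_level)
  show "0 \<le> norm1 d k x" by (rule norm1_greatest) (simp add: L2_set_nonneg)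
  show "norm1 d k (\<lambda>b. x b + y b) \<le> norm1 d k x + norm1 d k y" by (rule norm1_triangle)
  show "norm1 d k (\<lambda>b. - x b) = norm1 d k x"
    using norm1_uminus_le[of d k x] norm1_uminus_le[of d k "\<lambda>b. - x b"] by simp
  show "norm1 d k x \<le> (\<Sum>b | valid1 d b \<and> level1 b = k. \<bar>x b\<bar>)"
    using norm1_le[OF Pfn_zero, of d k x] L2_set_le_sum_abs[of x "basis1 d k"]
    by (simp add: basis1_def)
qed

lemma E0_eq_entire: "E0 d = T0.entire d"
  by (simp add: E0_def T0.entire_def)

lemma E1_eq_entire: "E1 d = T1.entire d"
  by (simp add: E1_def T1.entire_def)

subsection \<open>Products\<close>

lemma mul0_Nil: "mul0 a b [] = a [] * b []"
  by (simp add: mul0_def)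

text \<open>Peeling off the first letter turns the sum over all cuts of a word into a recursion, so
  the ring laws follow by induction on words.\<close>

lemma mul0_Cons: "mul0 a b (i # w) = a [] * b (i # w) + mul0 (\<lambda>v. a (i # v)) b w"
  unfolding mul0_def length_Cons sum.atMost_Suc_shift by simp

lemma mul0_add_left: "mul0 (\<lambda>v. a v + b v) c w = mul0 a c w + mul0 b c w"
  by (simp add: mul0_def distrib_right sum.distrib)

lemma mul0_scale_left: "mul0 (\<lambda>v. k * a v) c w = k * mul0 a c w"
  by (simp add: mul0_def sum_distrib_left mult.assoc)

lemma mul0_assoc: "mul0 (mul0 a b) c w = mul0 a (mul0 b c) w"
proof (induction w arbitrary: a)
  case (Cons i w)
  have eq: "(\<lambda>v. mul0 a b (i # v)) = (\<lambda>v. a [] * b (i # v) + mul0 (\<lambda>v. a (i # v)) b v)"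
    by (simp add: mul0_Cons)
  have "mul0 (mul0 a b) c (i # w)
      = a [] * b [] * c (i # w) + (a [] * mul0 (\<lambda>v. b (i # v)) c w + mul0 (mul0 (\<lambda>v. a (i # v)) b) c w)"
    unfolding mul0_Cons[of "mul0 a b"] eq mul0_add_left mul0_scale_left mul0_Nil ..
  also have "\<dots> = mul0 a (mul0 b c) (i # w)"
    by (simp add: Cons.IH mul0_Cons distrib_left)
  finally show ?case .
qed (simp add: mul0_Nil)

lemma mul0_one_left: "mul0 one0 a = a"
proof
  fix w show "mul0 one0 a w = a w"
  proof (cases w)
    case (Cons i v)
    have "mul0 (\<lambda>v. one0 (i # v)) a v = 0" by (simp add: mul0_def one0_def)
    then show ?thesis by (simp add: Cons mul0_Cons one0_def)
  qed (simp add: mul0_Nil one0_def)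
qed

lemma mul0_one_right: "mul0 a one0 = a"
proof
  fix w show "mul0 a one0 w = a w"
    by (induction w arbitrary: a) (simp_all add: mul0_Nil mul0_Cons, simp_all add: one0_def)
qed

text \<open>In the coefficient of a nonempty word, the term with the empty prefix has the nonzero
  factor \<open>a []\<close>, while all others read the right factor on shorter words; hence strong
  induction on the length.\<close>

lemma mul0_cancel_left:
  assumes eq: "mul0 a b = mul0 a c" and "a [] \<noteq> 0"
  shows "b = c"
proof
  fix w show "b w = c w"
  proof (induction w rule: length_induct)
    case (1 w)
    show ?case
    proof (cases w)
      case Nil
      then show ?thesis using fun_cong[OF eq, of "[]"] assms(2) by (simp add: mul0_Nil)
    next
      case (Cons i v)
      have "mul0 (\<lambda>v. a (i # v)) b v = mul0 (\<lambda>v. a (i # v)) c v"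
        unfolding mul0_def using 1 Cons by (intro sum.cong) auto
      then show ?thesis using fun_cong[OF eq, of w] assms(2) by (simp add: Cons mul0_Cons)
    qed
  qed
qed

text \<open>A right inverse is also a left inverse: a (b a) = (a b) a = a 1, and \<open>a\<close>
  can be cancelled.\<close>

lemma inv0_eq:
  assumes ab: "mul0 a b = one0" and a: "a [] \<noteq> 0"
  shows "inv0 a = b" and "mul0 b a = one0"
proof -
  have "mul0 a (mul0 b a) = mul0 (mul0 a b) a" by (simp add: fun_eq_iff mul0_assoc)
  also have "\<dots> = mul0 a one0" by (simp add: ab mul0_one_left mul0_one_right)
  finally show ba: "mul0 b a = one0" using mul0_cancel_left a by blast
  show "inv0 a = b"
    unfolding inv0_def
  proof (rule the_equality)
    fix c assume "mul0 a c = one0 \<and> mul0 c a = one0"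
    then show "c = b" using mul0_cancel_left[of a c b] ab a by simp
  qed (use ab ba in simp)
qed

section \<open>Products of basis elements\<close>

lemma take_drop_eq_iff: "k \<le> length w \<Longrightarrow> take k w = x \<and> drop k w = y \<longleftrightarrow> k = length x \<and> w = x @ y"
  by (auto simp: append_eq_conv_conj min_def)

lemma mul0_unit: "mul0 (unit_coeff x) (unit_coeff y) = unit_coeff (x @ y)"
proof
  fix w
  have "mul0 (unit_coeff x) (unit_coeff y) w
      = (\<Sum>k\<le>length w. if take k w = x \<and> drop k w = y then 1 else 0)"
    by (auto simp: mul0_def unit_coeff_def intro!: sum.cong)
  also have "\<dots> = (\<Sum>k\<le>length w. if k = length x then (if w = x @ y then 1 else 0) else 0)"
    by (intro sum.cong refl) (use take_drop_eq_iff[of _ w x y] in auto)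
  finally show "mul0 (unit_coeff x) (unit_coeff y) w = unit_coeff (x @ y) w"
    by (auto simp: unit_coeff_def)
qed

lemma lact_unit: "lact (unit_coeff x) (unit_coeff (y, p, v)) = unit_coeff (x @ y, p, v)"
proof
  fix b :: tb
  obtain u q z where b: "b = (u, q, z)" by (cases b)
  have "lact (unit_coeff x) (unit_coeff (y, p, v)) b
      = (\<Sum>k\<le>length u. if take k u = x \<and> drop k u = y then (if q = p \<and> z = v then 1 else 0) else 0)"
    by (auto simp: b lact_def unit_coeff_def intro!: sum.cong)
  also have "\<dots> = (\<Sum>k\<le>length u. if k = length x then (if u = x @ y \<and> q = p \<and> z = v then 1 else 0) else 0)"
    by (intro sum.cong refl) (use take_drop_eq_iff[of _ u x y] in auto)
  finally show "lact (unit_coeff x) (unit_coeff (y, p, v)) b = unit_coeff (x @ y, p, v) b"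
    by (auto simp: unit_coeff_def b)
qed

lemma ract_unit: "ract (unit_coeff (u, p, x)) (unit_coeff y) = unit_coeff (u, p, x @ y)"
proof
  fix b :: tb
  obtain z q v where b: "b = (z, q, v)" by (cases b)
  have "ract (unit_coeff (u, p, x)) (unit_coeff y) b
      = (\<Sum>k\<le>length v. if take k v = x \<and> drop k v = y then (if z = u \<and> q = p then 1 else 0) else 0)"
    by (auto simp: b ract_def unit_coeff_def intro!: sum.cong)
  also have "\<dots> = (\<Sum>k\<le>length v. if k = length x then (if v = x @ y \<and> z = u \<and> q = p then 1 else 0) else 0)"
    by (intro sum.cong refl) (use take_drop_eq_iff[of _ v x y] in auto)
  finally show "ract (unit_coeff (u, p, x)) (unit_coeff y) b = unit_coeff (u, p, x @ y) b"
    by (auto simp: unit_coeff_def b)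
qed

section \<open>Levelwise l1 bounds for products and actions\<close>

lemma valid0_take_drop: "valid0 d (take k w) \<Longrightarrow> valid0 d (drop k w) \<Longrightarrow> valid0 d w"
  unfolding valid0_def by (metis append_take_drop_id set_append Un_least)

lemma valid0_takeI: "valid0 d w \<Longrightarrow> valid0 d (take k w)"
  using set_take_subset unfolding valid0_def by fast

lemma valid0_dropI: "valid0 d w \<Longrightarrow> valid0 d (drop k w)"
  using set_drop_subset unfolding valid0_def by fast

lemma valid1_iff: "valid1 d (u, (i, j), v) \<longleftrightarrow> valid0 d u \<and> valid0 d v \<and> i < j \<and> j < d"
  by (simp add: valid1_def valid0_def)

text \<open>The map \<open>\<phi>\<close> glues the two factors of a split basis element back together.\<close>

lemma sum_sum_le_Cauchy:
  fixes f :: "'b \<Rightarrow> nat \<Rightarrow> real" and n :: nat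
  assumes fin: "finite S" "\<And>k. finite (W k)" "\<And>k. finite (B k)"
    and nonneg: "\<And>x. 0 \<le> g x" "\<And>y. 0 \<le> h y"
    and split: "\<And>b k. b \<in> S \<Longrightarrow> k \<le> len b \<Longrightarrow>
      \<exists>m\<le>n. \<exists>x\<in>W m. \<exists>y\<in>B (n - m). \<phi> (x, y) = (b, k) \<and> f b k \<le> g x * h y"
  shows "(\<Sum>b\<in>S. \<Sum>k\<le>len b. f b k) \<le> (\<Sum>k\<le>n. (\<Sum>x\<in>W k. g x) * (\<Sum>y\<in>B (n - k). h y))"
proof -
  have "(\<Sum>b\<in>S. \<Sum>k\<le>len b. f b k) = (\<Sum>(b, k)\<in>(SIGMA b:S. {..len b}). f b k)"
    using fin by (intro sum.Sigma) auto
  also have "\<dots> \<le> (\<Sum>(k, x, y)\<in>(SIGMA k:{..n}. W k \<times> B (n - k)). g x * h y)"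
  proof (rule sum_le_included[where i = "\<lambda>(k, x, y). \<phi> (x, y)"])
    show "\<forall>x\<in>SIGMA b:S. {..len b}. \<exists>y\<in>SIGMA k:{..n}. W k \<times> B (n - k).
       (case y of (k, x, y) \<Rightarrow> \<phi> (x, y)) = x \<and> (case x of (b, k) \<Rightarrow> f b k) \<le> (case y of (k, x, y) \<Rightarrow> g x * h y)"
    proof
      fix z assume z: "z \<in> (SIGMA b:S. {..len b})"
      obtain b k where bk: "z = (b, k)" by (cases z)
      with z have "b \<in> S" "k \<le> len b" by auto
      from split[OF this] obtain m x y where "m \<le> n" "x \<in> W m" "y \<in> B (n - m)"
        "\<phi> (x, y) = (b, k)" "f b k \<le> g x * h y" by blast
      then show "\<exists>y\<in>SIGMA k:{..n}. W k \<times> B (n - k).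
        (case y of (k, x, y) \<Rightarrow> \<phi> (x, y)) = z \<and> (case z of (b, k) \<Rightarrow> f b k) \<le> (case y of (k, x, y) \<Rightarrow> g x * h y)"
        by (intro bexI[of _ "(m, x, y)"]) (auto simp: bk)
    qed
  qed (use fin nonneg in \<open>auto intro!: finite_SigmaI finite_cartesian_product\<close>)
  also have "\<dots> = (\<Sum>k\<le>n. \<Sum>(x, y)\<in>W k \<times> B (n - k). g x * h y)"
    using fin by (subst sum.Sigma) auto
  also have "\<dots> = (\<Sum>k\<le>n. (\<Sum>x\<in>W k. g x) * (\<Sum>y\<in>B (n - k). h y))"
    by (simp add: sum_product sum.cartesian_product)
  finally show ?thesis .
qed

lemma l1_mul0_le: "T0.l1 d n (mul0 a b) \<le> (\<Sum>k\<le>n. T0.l1 d k a * T0.l1 d (n - k) b)"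
proof -
  have "T0.l1 d n (mul0 a b)
      \<le> (\<Sum>w | valid0 d w \<and> length w = n. \<Sum>k\<le>length w. \<bar>a (take k w)\<bar> * \<bar>b (drop k w)\<bar>)"
    unfolding T0.l1_def mul0_def abs_mult[symmetric] by (intro sum_mono sum_abs)
  also have "\<dots> \<le> (\<Sum>k\<le>n. T0.l1 d k a * T0.l1 d (n - k) b)"
    unfolding T0.l1_def
  proof (rule sum_sum_le_Cauchy[where \<phi> = "\<lambda>(x, y). (x @ y, length x)"])
    fix w k assume w: "w \<in> {w. valid0 d w \<and> length w = n}" "k \<le> length w"
    show "\<exists>m\<le>n. \<exists>x\<in>{b. valid0 d b \<and> length b = m}. \<exists>y\<in>{w. valid0 d w \<and> length w = n - m}.
          (case (x, y) of (x, y) \<Rightarrow> (x @ y, length x)) = (w, k) \<and> \<bar>a (take k w)\<bar> * \<bar>b (drop k w)\<bar> \<le> \<bar>a x\<bar> * \<bar>b y\<bar>"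
      by (rule exI[of _ k], intro conjI bexI[of _ "take k w"] bexI[of _ "drop k w"])
        (use w valid0_takeI valid0_dropI in auto)
  qed (auto simp: finite_valid0_level)
  finally show ?thesis .
qed

lemma l1_lact_le: "T1.l1 d n (lact a E) \<le> (\<Sum>k\<le>n. T0.l1 d k a * T1.l1 d (n - k) E)"
proof -
  have "T1.l1 d n (lact a E)
      \<le> (\<Sum>b | valid1 d b \<and> level1 b = n. \<Sum>k\<le>length (fst b).
            \<bar>a (take k (fst b))\<bar> * \<bar>E (drop k (fst b), snd b)\<bar>)"
    unfolding T1.l1_def lact_def abs_mult[symmetric]
    by (intro sum_mono) (auto split: prod.split intro: sum_abs)
  also have "\<dots> \<le> (\<Sum>k\<le>n. T0.l1 d k a * T1.l1 d (n - k) E)"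
    unfolding T0.l1_def T1.l1_def
  proof (rule sum_sum_le_Cauchy[where \<phi> = "\<lambda>(x, (u, pv)). ((x @ u, pv), length x)"])
    fix b :: tb and k assume b: "b \<in> {b. valid1 d b \<and> level1 b = n}" "k \<le> length (fst b)"
    obtain u i j v where bu: "b = (u, (i, j), v)" by (cases b) auto
    show "\<exists>m\<le>n. \<exists>x\<in>{b. valid0 d b \<and> length b = m}. \<exists>y\<in>{b. valid1 d b \<and> level1 b = n - m}.
          (case (x, y) of (x, u, pv) \<Rightarrow> ((x @ u, pv), length x)) = (b, k) \<and>
          \<bar>a (take k (fst b))\<bar> * \<bar>E (drop k (fst b), snd b)\<bar> \<le> \<bar>a x\<bar> * \<bar>E y\<bar>"
      by (rule exI[of _ k], intro conjI bexI[of _ "take k u"] bexI[of _ "(drop k u, (i, j), v)"])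
        (use b valid0_takeI valid0_dropI in \<open>auto simp: bu valid1_iff level1_def\<close>)
  qed (auto simp: finite_valid0_level finite_valid1_level)
  finally show ?thesis .
qed

lemma l1_ract_le: "T1.l1 d n (ract E a) \<le> (\<Sum>k\<le>n. T0.l1 d k a * T1.l1 d (n - k) E)"
proof -
  have "T1.l1 d n (ract E a)
      \<le> (\<Sum>b | valid1 d b \<and> level1 b = n. \<Sum>k\<le>length (snd (snd b)).
            \<bar>E (fst b, fst (snd b), take k (snd (snd b)))\<bar> * \<bar>a (drop k (snd (snd b)))\<bar>)"
    unfolding T1.l1_def ract_def abs_mult[symmetric]
    by (intro sum_mono) (auto split: prod.split intro: sum_abs)
  also have "\<dots> \<le> (\<Sum>k\<le>n. T0.l1 d k a * T1.l1 d (n - k) E)"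
    unfolding T0.l1_def T1.l1_def
  proof (rule sum_sum_le_Cauchy[where \<phi> = "\<lambda>(x, (u, p, v)). ((u, p, v @ x), length v)"])
    fix b :: tb and k assume b: "b \<in> {b. valid1 d b \<and> level1 b = n}" "k \<le> length (snd (snd b))"
    obtain u i j v where bu: "b = (u, (i, j), v)" by (cases b) auto
    show "\<exists>m\<le>n. \<exists>x\<in>{b. valid0 d b \<and> length b = m}. \<exists>y\<in>{b. valid1 d b \<and> level1 b = n - m}.
          (case (x, y) of (x, u, p, v) \<Rightarrow> ((u, p, v @ x), length v)) = (b, k) \<and>
          \<bar>E (fst b, fst (snd b), take k (snd (snd b)))\<bar> * \<bar>a (drop k (snd (snd b)))\<bar> \<le> \<bar>a x\<bar> * \<bar>E y\<bar>"
      \<comment> \<open>The Cauchy sum is indexed by the level of the tensor, which here is the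
        suffix split off on the right, of length \<open>length v - k\<close>.\<close>
      by (rule exI[of _ "length v - k"], intro conjI bexI[of _ "drop k v"] bexI[of _ "(u, (i, j), take k v)"])
        (use b valid0_takeI valid0_dropI in \<open>auto simp: bu valid1_iff level1_def\<close>)
  qed (auto simp: finite_valid0_level finite_valid1_level)
  finally show ?thesis .
qed

lemma Cauchy_mono:
  fixes a b c c' :: "nat \<Rightarrow> real"
  assumes "\<And>k. 0 \<le> a k" "\<And>k. 0 \<le> b k" "\<And>k. a k \<le> c k" "\<And>k. b k \<le> c' k"
  shows "(\<Sum>k\<le>n. a k * b (n - k)) \<le> (\<Sum>k\<le>n. c k * c' (n - k))"
  by (intro sum_mono mult_mono) (use assms order_trans in blast)+

lemma dom_mul0:
  assumes a: "T0.dom d c a" and b: "T0.dom d c' b"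
  shows "T0.dom d (\<lambda>n. \<Sum>k\<le>n. c k * c' (n - k)) (mul0 a b)"
  unfolding T0.dom_def
proof (intro conjI allI impI)
  fix w assume "\<not> valid0 d w"
  then have "a (take k w) * b (drop k w) = 0" for k
    using T0.dom_support[OF a] T0.dom_support[OF b] valid0_take_drop[of d k w] by fastforce
  then show "mul0 a b w = 0" unfolding mul0_def by (intro sum.neutral) blast
next
  fix n
  show "T0.l1 d n (mul0 a b) \<le> (\<Sum>k\<le>n. c k * c' (n - k))"
    by (rule order_trans[OF l1_mul0_le Cauchy_mono]) (use a b in \<open>auto simp: T0.dom_def T0.l1_nonneg\<close>)
qed

lemma dom_lact:
  assumes a: "T0.dom d c a" and E: "T1.dom d c' E"
  shows "T1.dom d (\<lambda>n. \<Sum>k\<le>n. c k * c' (n - k)) (lact a E)"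
  unfolding T1.dom_def
proof (intro conjI allI impI)
  fix b assume b: "\<not> valid1 d b"
  obtain u i j v where bu: "b = (u, (i, j), v)" by (cases b) auto
  have "a (take k u) * E (drop k u, (i, j), v) = 0" for k
    using T0.dom_support[OF a, of "take k u"] T1.dom_support[OF E, of "(drop k u, (i, j), v)"]
      b valid0_take_drop[of d k u] by (auto simp: bu valid1_iff)
  then show "lact a E b = 0" unfolding lact_def bu prod.case by (intro sum.neutral) blast
next
  fix n
  show "T1.l1 d n (lact a E) \<le> (\<Sum>k\<le>n. c k * c' (n - k))"
    by (rule order_trans[OF l1_lact_le Cauchy_mono])
      (use a E in \<open>auto simp: T0.dom_def T1.dom_def T0.l1_nonneg T1.l1_nonneg\<close>)
qed

lemma dom_ract:
  assumes a: "T0.dom d c a" and E: "T1.dom d c' E"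
  shows "T1.dom d (\<lambda>n. \<Sum>k\<le>n. c k * c' (n - k)) (ract E a)"
  unfolding T1.dom_def
proof (intro conjI allI impI)
  fix b assume b: "\<not> valid1 d b"
  obtain u i j v where bu: "b = (u, (i, j), v)" by (cases b) auto
  have "E (u, (i, j), take k v) * a (drop k v) = 0" for k
    using T0.dom_support[OF a, of "drop k v"] T1.dom_support[OF E, of "(u, (i, j), take k v)"]
      b valid0_take_drop[of d k v] by (auto simp: bu valid1_iff)
  then show "ract E a b = 0" unfolding ract_def bu prod.case by (intro sum.neutral) blast
next
  fix n
  show "T1.l1 d n (ract E a) \<le> (\<Sum>k\<le>n. c k * c' (n - k))"
    by (rule order_trans[OF l1_ract_le Cauchy_mono])
      (use a E in \<open>auto simp: T0.dom_def T1.dom_def T0.l1_nonneg T1.l1_nonneg\<close>)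
qed

section \<open>The boundary map and the product it induces\<close>

definition delta_term :: "t1 \<Rightarrow> nat list \<Rightarrow> nat \<Rightarrow> real" where
  "delta_term E w k = (if w ! k < w ! (k+1) then E (take k w, (w ! k, w ! (k+1)), drop (k+2) w)
     else if w ! (k+1) < w ! k then - E (take k w, (w ! (k+1), w ! k), drop (k+2) w) else 0)"

lemma delta_eq: "delta E w = (\<Sum>k<length w - 1. delta_term E w k)"
  unfolding delta_def delta_term_def Let_def ..

lemma split_word_at:
  assumes "k < length w - 1"
  shows "w = take k w @ [w ! k, w ! (k+1)] @ drop (k+2) w"
proof -
  have "drop k w = w ! k # w ! Suc k # drop (Suc (Suc k)) w"
    using assms by (simp add: Cons_nth_drop_Suc)
  then show ?thesis by (metis add_2_eq_Suc' append_Cons append_Nil append_take_drop_id Suc_eq_plus1)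
qed

lemma valid0_split_at:
  assumes "valid0 d w" "k < length w - 1"
  shows "valid0 d (take k w)" "valid0 d (drop (k+2) w)" "w ! k < d" "w ! (k+1) < d"
proof -
  have "w ! k \<in> set w" "w ! (k+1) \<in> set w" using assms(2) by auto
  then show "w ! k < d" "w ! (k+1) < d" using assms(1) by (auto simp: valid0_def)
qed (use assms(1) valid0_takeI valid0_dropI in blast)+

text \<open>The image of a basis element consists of the two words of a commutator, with
  coefficients 1 and -1; hence the factor 2.\<close>

lemma l1_delta_le: "T0.l1 d n (delta E) \<le> 2 * T1.l1 d n E"
proof -
  let ?W = "{w. valid0 d w \<and> length w = n}" and ?B = "{b. valid1 d b \<and> level1 b = n}"
  \<comment> \<open>Positions with equal adjacent letters contribute 0 and are not reached by
    \<open>\<phi>\<close> from a valid basis element, so they are left out.\<close>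
  define S where "S = {(w, k). w \<in> ?W \<and> k < n - 1 \<and> w ! k \<noteq> w ! (k+1)}"
  have Ssub: "S \<subseteq> ?W \<times> {..<n - 1}" by (auto simp: S_def)
  have "T0.l1 d n (delta E) \<le> (\<Sum>w\<in>?W. \<Sum>k<n - 1. \<bar>delta_term E w k\<bar>)"
    unfolding T0.l1_def delta_eq by (intro sum_mono) (auto intro: sum_abs)
  also have "\<dots> = (\<Sum>(w, k)\<in>?W \<times> {..<n - 1}. \<bar>delta_term E w k\<bar>)"
    by (rule sum.cartesian_product)
  also have "\<dots> = (\<Sum>x\<in>S. \<bar>delta_term E (fst x) (snd x)\<bar>)"
    using Ssub finite_valid0_level unfolding case_prod_unfold
    by (intro sum.mono_neutral_right) (auto simp: S_def delta_term_def)
  also have "\<dots> \<le> (\<Sum>y\<in>(UNIV :: bool set) \<times> ?B. \<bar>E (snd y)\<bar>)"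
  proof -
    \<comment> \<open>The Boolean selects which of the two terms of the commutator is written; the
      recorded length of \<open>u\<close> marks its position in the word.\<close>
    define \<phi> :: "bool \<times> tb \<Rightarrow> nat list \<times> nat" where
      "\<phi> = (\<lambda>(s, (u, (i, j), v)). (u @ (if s then [i, j] else [j, i]) @ v, length u))"
    have fin: "finite S" "finite ((UNIV :: bool set) \<times> ?B)"
      using Ssub finite_valid0_level finite_valid1_level
      by (meson finite_SigmaI finite_lessThan finite_subset) (simp add: finite_valid1_level)
    have "\<exists>y\<in>UNIV \<times> ?B. \<phi> y = x \<and> \<bar>delta_term E (fst x) (snd x)\<bar> \<le> \<bar>E (snd y)\<bar>"
      if "x \<in> S" for x
    proof -
      from that obtain w k where x: "x = (w, k)"
          and w: "valid0 d w" "length w = n" "k < length w - 1" "w ! k \<noteq> w ! (k+1)"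
        by (auto simp: S_def)
      note sp = split_word_at[OF w(3), symmetric] valid0_split_at[OF w(1,3)]
      let ?s = "w ! k < w ! (k+1)"
      let ?b = "(take k w, (min (w!k) (w!(k+1)), max (w!k) (w!(k+1))), drop (k+2) w)"
      have "?b \<in> ?B" using w sp by (auto simp: valid1_iff level1_def)
      moreover have "\<bar>delta_term E w k\<bar> \<le> \<bar>E ?b\<bar>"
        using w(4) by (auto simp: delta_term_def min_def max_def)
      moreover have "\<phi> (?s, ?b) = x"
        using sp(1) w(3,4) by (auto simp: \<phi>_def x min_def max_def)
      ultimately show ?thesis unfolding x by (intro bexI[of _ "(?s, ?b)"]) simp_all
    qed
    then show ?thesis by (intro sum_le_included[where i = \<phi>] fin) auto
  qed
  also have "\<dots> = 2 * T1.l1 d n E"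
    unfolding T1.l1_def using sum.cartesian_product[of "\<lambda>s b. \<bar>E b\<bar>" ?B "UNIV :: bool set"]
    by (simp add: UNIV_bool case_prod_unfold)
  finally show ?thesis .
qed

lemma dom_delta:
  assumes "T1.dom d c E"
  shows "T0.dom d (\<lambda>n. 2 * c n) (delta E)"
  unfolding T0.dom_def
proof (intro conjI allI impI)
  fix w assume w: "\<not> valid0 d w"
  have "delta_term E w k = 0" if "k < length w - 1" for k
  proof -
    have "valid0 d w" if "valid0 d (take k w)" "valid0 d (drop (k+2) w)" "w ! k < d" "w ! (k+1) < d"
    proof -
      have "valid0 d (take k w @ [w ! k, w ! (k+1)] @ drop (k+2) w)" using that by (auto simp: valid0_def)
      then show ?thesis using split_word_at[OF \<open>k < length w - 1\<close>] by simp
    qed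
    then have "\<not> valid1 d (take k w, (w ! k, w ! (k+1)), drop (k+2) w)"
        "\<not> valid1 d (take k w, (w ! (k+1), w ! k), drop (k+2) w)"
      using w unfolding valid1_iff by (meson order.strict_trans)+
    from this[THEN T1.dom_support[OF assms]] show ?thesis by (simp add: delta_term_def)
  qed
  then show "delta E w = 0" by (simp add: delta_eq)
next
  fix n show "T0.l1 d n (delta E) \<le> 2 * c n"
    using l1_delta_le[of d n E] assms by (simp add: T1.dom_def) (meson mult_left_mono order_trans zero_le_numeral)
qed

lemma dom_mul1:
  assumes "T1.dom d c E" "T1.dom d c' F"
  shows "T1.dom d (\<lambda>n. \<Sum>k\<le>n. 2 * c k * c' (n - k)) (mul1 E F)"
  unfolding mul1_def using dom_lact[OF dom_delta[OF assms(1)] assms(2)] .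

lemma delta_cong:
  assumes "\<And>b. level1 b = length w \<Longrightarrow> E b = F b"
  shows "delta E w = delta F w"
  unfolding delta_eq by (intro sum.cong refl) (auto simp: delta_term_def level1_def intro!: assms)

text \<open>\<open>delta\<close> preserves the level and the wedge in the right factor occupies two
  levels, so the coefficient at \<open>b\<close> reads the left factor only strictly below
  \<open>level1 b\<close>. This triangularity gives both existence and uniqueness of the surface
  signature.\<close>

lemma mul1_cong_below:
  assumes "\<And>b'. level1 b' < level1 b \<Longrightarrow> E b' = F b'"
  shows "mul1 E G b = mul1 F G b"
proof -
  obtain u p v where b: "b = (u, p, v)" by (cases b)
  have "delta E (take k u) = delta F (take k u)" for k
    by (rule delta_cong, rule assms) (auto simp: b level1_def)
  then show ?thesis by (simp add: mul1_def lact_def b)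
qed

section \<open>Linear differential equations\<close>

text \<open>One step of a factorial estimate. The offset \<open>c\<close> stands for length already
  travelled: when a second edge is added, the subtracted term cancels the bound for the first edge
  exactly.\<close>

lemma norm_integral_power_bound:
  fixes f :: "real \<Rightarrow> 'a::banach"
  assumes "a \<le> b" "f integrable_on {a..b}"
    and le: "\<And>x. x \<in> {a..b} \<Longrightarrow> norm (f x) \<le> C * K * (K * (c + (x - a))) ^ n / fact n"
  shows "norm (integral {a..b} f) \<le> C * ((K * (c + (b - a))) ^ Suc n / fact (Suc n) - (K * c) ^ Suc n / fact (Suc n))"
proof -
  let ?F = "\<lambda>x. C * ((K * (c + (x - a))) ^ Suc n / fact (Suc n))"
  have int: "((\<lambda>x. C * K * (K * (c + (x - a))) ^ n / fact n) has_integral ?F b - ?F a) {a..b}"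
  proof (rule fundamental_theorem_of_calculus[OF \<open>a \<le> b\<close>])
    fix x
    have "(?F has_real_derivative C * (real (Suc n) * (K * (c + (x - a))) ^ n * K / fact (Suc n))) (at x within {a..b})"
      by (rule derivative_eq_intros refl | simp)+
    moreover have "C * (real (Suc n) * (K * (c + (x - a))) ^ n * K / fact (Suc n)) = C * K * (K * (c + (x - a))) ^ n / fact n"
      by (simp add: divide_simps del: of_nat_Suc)
    ultimately show "(?F has_vector_derivative C * K * (K * (c + (x - a))) ^ n / fact n) (at x within {a..b})"
      unfolding has_real_derivative_iff_has_vector_derivative[symmetric] by (simp only:)
  qed
  have "norm (integral {a..b} f) \<le> ?F b - ?F a"
    using integral_norm_bound_integral[OF assms(2) has_integral_integrable[OF int] le]
    unfolding integral_unique[OF int] .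
  then show ?thesis by (simp add: right_diff_distrib)
qed

lemma power_over_fact_tendsto_0: "(\<lambda>n. (x::real) ^ n / fact n) \<longlonglongrightarrow> 0"
  using summable_LIMSEQ_zero[OF summable_exp[of x]] by (simp add: field_simps)

lemma at_within_Icc_interior: "x \<in> {a<..<b::real} \<Longrightarrow> at x within {a..b} = at x"
  by (intro at_within_interior) simp

text \<open>Feeding a bound on D back into the integral equation n times gives M (C (t - a))^n / n!,
  which tends to 0. The coefficient \<open>A\<close> is only assumed bounded off a finite set;
  integrability of D A comes from the fundamental theorem of calculus.\<close>

lemma linear_ode_zero:
  fixes D :: "real \<Rightarrow> 'a::{real_normed_algebra,banach}"
  assumes cont: "continuous_on {a..b} D" and "D a = 0" and "finite S"
    and deriv: "\<And>t. t \<in> {a..b} - S \<Longrightarrow> (D has_vector_derivative D t * A t) (at t within {a..b})"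
    and A: "\<And>t. t \<in> {a..b} - S \<Longrightarrow> norm (A t) \<le> C" and "0 \<le> C" and t: "t \<in> {a..b}"
  shows "D t = 0"
proof -
  have "bounded (D ` {a..b})" by (intro compact_imp_bounded compact_continuous_image cont) simp
  then obtain M where M: "0 < M" "\<And>t. t \<in> {a..b} \<Longrightarrow> norm (D t) \<le> M"
    unfolding bounded_pos by auto
  have le: "norm (D t) \<le> M * ((C * (0 + (t - a))) ^ n / fact n)" if "t \<in> {a..b}" for t n
    using that
  proof (induction n arbitrary: t)
    case (Suc n)
    \<comment> \<open>The value 0 on \<open>S\<close> makes the estimate hold at every point, while
      the integral does not see a finite set.\<close>
    define f where "f x = (if x \<in> S then 0 else D x * A x)" for x
    have fi: "(f has_integral D t - D a) {a..t}"
    proof (rule fundamental_theorem_of_calculus_interior_strong[OF \<open>finite S\<close>])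
      show "continuous_on {a..t} D" using Suc.prems by (auto intro: continuous_on_subset[OF cont])
      fix x assume x: "x \<in> {a<..<t} - S"
      then have "(D has_vector_derivative D x * A x) (at x within {a..b})"
        using Suc.prems by (intro deriv) auto
      then show "(D has_vector_derivative f x) (at x)"
        using x Suc.prems by (simp add: f_def at_within_Icc_interior)
    qed (use Suc.prems in auto)
    have "norm (f x) \<le> M * C * (C * (0 + (x - a))) ^ n / fact n" if "x \<in> {a..t}" for x
    proof (cases "x \<in> S")
      case False
      have "norm (f x) \<le> norm (D x) * norm (A x)" using False by (simp add: f_def norm_mult_ineq)
      also have "\<dots> \<le> (M * ((C * (0 + (x - a))) ^ n / fact n)) * C"
        using that Suc.prems False A[of x] Suc.IH[of x] \<open>0 \<le> C\<close> M(1)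
        by (intro mult_mono) (auto intro!: mult_nonneg_nonneg divide_nonneg_nonneg zero_le_power)
      finally show ?thesis by (simp add: mult_ac)
    next
      case True
      then show ?thesis using that \<open>0 \<le> C\<close> M(1) by (simp add: f_def)
    qed
    then have "norm (integral {a..t} f) \<le> M * ((C * (0 + (t - a))) ^ Suc n / fact (Suc n) - (C * 0) ^ Suc n / fact (Suc n))"
      using Suc.prems fi by (intro norm_integral_power_bound) (auto simp: has_integral_integrable)
    then show ?case using integral_unique[OF fi] \<open>D a = 0\<close> by simp
  qed (use M in auto)
  have "(\<lambda>n. M * ((C * (0 + (t - a))) ^ n / fact n)) \<longlonglongrightarrow> M * 0"
    by (intro tendsto_mult tendsto_const power_over_fact_tendsto_0)
  then have "norm (D t) \<le> M * 0"
    by (rule LIMSEQ_le_const) (use le t in blast)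
  then show ?thesis by simp
qed

lemma has_real_derivative_eq_imp_eq:
  fixes f g :: "real \<Rightarrow> real"
  assumes "\<And>t. t \<in> {a..b} \<Longrightarrow> (f has_real_derivative f' t) (at t within {a..b})"
    and "\<And>t. t \<in> {a..b} \<Longrightarrow> (g has_real_derivative f' t) (at t within {a..b})"
    and "f a = g a" "t \<in> {a..b}"
  shows "f t = g t"
proof -
  have "((\<lambda>t. f t - g t) has_real_derivative 0) (at t within {a..b})" if "t \<in> {a..b}" for t
    using DERIV_diff[OF assms(1)[OF that] assms(2)[OF that]] by simp
  from has_field_derivative_zero_constant[OF convex_real_interval(5) this]
  obtain c where "\<And>t. t \<in> {a..b} \<Longrightarrow> f t - g t = c" by blast
  from this[of a] this[of t] show ?thesis using assms(3,4) by simp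
qed

text \<open>Rescaling the variable upper limit to the fixed interval [0,1] turns this into
  continuity of a parameter integral.\<close>

lemma continuous_on_integral_upto:
  fixes f :: "real \<times> real \<Rightarrow> real"
  assumes f: "continuous_on (S \<times> {a..b}) f"
  shows "continuous_on (S \<times> {a..b}) (\<lambda>z. integral {a..snd z} (\<lambda>y. f (fst z, y)))"
proof -
  have eq: "integral {a..t} (\<lambda>y. f (s, y)) = integral (cbox 0 1) (\<lambda>x. (t - a) * f (s, a + x * (t - a)))"
    if "s \<in> S" "t \<in> {a..b}" for s t
  proof -
    have "((\<lambda>x. (t - a) *\<^sub>R f (s, a + x * (t - a))) has_integral
        integral {a + 0 * (t - a)..a + 1 * (t - a)} (\<lambda>y. f (s, y))) {0..1}"
    proof (rule has_integral_substitution[where c = a and d = t])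
      have "0 \<le> x * (t - a) \<and> x * (t - a) \<le> t - a" if "x \<in> {0..1}" for x
        using that \<open>t \<in> {a..b}\<close> by (auto intro: mult_left_le_one_le)
      then show "(\<lambda>x. a + x * (t - a)) ` {0..1} \<subseteq> {a..t}" by fastforce
      show "continuous_on {a..t} (\<lambda>y. f (s, y))"
        using that by (intro continuous_on_compose2[OF f]) (auto intro!: continuous_intros)
    qed (use that in \<open>auto intro!: derivative_eq_intros\<close>)
    from integral_unique[OF this] show ?thesis by simp
  qed
  have "continuous_on (S \<times> {a..b}) (\<lambda>z. integral (cbox 0 1) (\<lambda>x. (snd z - a) * f (fst z, a + x * (snd z - a))))"
  proof (rule integral_continuous_on_param)
    have "a + x * (t - a) \<in> {a..b}" if "t \<in> {a..b}" "x \<in> {0..1}" for x t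
    proof -
      have "0 \<le> x * (t - a)" "x * (t - a) \<le> t - a" using that by (auto intro: mult_left_le_one_le)
      then show ?thesis using that by auto
    qed
    then show "continuous_on ((S \<times> {a..b}) \<times> cbox 0 1) (\<lambda>(z, x). (snd z - a) * f (fst z, a + x * (snd z - a)))"
      unfolding case_prod_unfold
      by (intro continuous_intros continuous_on_compose2[OF f]) auto
  qed
  then show ?thesis
    by (rule continuous_on_eq) (use eq in auto)
qed

section \<open>Curves along the tail path\<close>

definition along_tail :: "(real \<Rightarrow> real \<Rightarrow> 'a) \<Rightarrow> real \<Rightarrow> real \<Rightarrow> real \<Rightarrow> real \<Rightarrow> 'a" where
  "along_tail P sm tm s u = (if u \<le> s - sm then P (u + sm) tm else P s (u - (s - sm) + tm))"

lemma tail_path_eq: "tail_path X sm tm s t i = along_tail (\<lambda>s t. X i (s, t)) sm tm s"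
  by (simp add: tail_path_def along_tail_def fun_eq_iff)

lemma along_tail_end: "t \<ge> tm \<Longrightarrow> along_tail P sm tm s (tail_len sm tm s t) = P s t"
  by (auto simp: along_tail_def tail_len_def)

lemma along_tail_start: "s \<ge> sm \<Longrightarrow> along_tail P sm tm s 0 = P sm tm"
  by (auto simp: along_tail_def)

lemma has_vector_derivative_shift:
  fixes f :: "real \<Rightarrow> 'a::real_normed_vector"
  assumes "(f has_vector_derivative D) (at (u + c) within T)" "(\<lambda>u. u + c) ` S \<subseteq> T"
  shows "((\<lambda>u. f (u + c)) has_vector_derivative D) (at u within S)"
proof -
  have "((f \<circ> (\<lambda>u. u + c)) has_vector_derivative 1 *\<^sub>R D) (at u within S)"
  proof (rule vector_diff_chain_within)
    show "((\<lambda>u. u + c) has_vector_derivative 1) (at u within S)"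
      by (auto intro!: derivative_eq_intros)
    show "(f has_vector_derivative D) (at (u + c) within (\<lambda>u. u + c) ` S)"
      by (rule has_vector_derivative_within_subset[OF assms])
  qed
  then show ?thesis by (simp add: o_def)
qed

text \<open>Derivatives are required only along the two edges traversed, so that the coordinates of
  the surface, the iterated integrals and the images under \<open>atl\<close> can all be inserted
  for \<open>P\<close>.\<close>

locale tail_curve =
  fixes P :: "real \<Rightarrow> real \<Rightarrow> 'a::real_normed_vector" and DS DT :: "real \<Rightarrow> 'a"
    and sm sp tm tp s t :: real
  assumes s: "s \<in> {sm..sp}" and t: "t \<in> {tm..tp}"
    and DS: "\<And>\<sigma>. \<sigma> \<in> {sm..sp} \<Longrightarrow> ((\<lambda>\<sigma>. P \<sigma> tm) has_vector_derivative DS \<sigma>) (at \<sigma> within {sm..sp})"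
    and DT: "\<And>\<tau>. \<tau> \<in> {tm..tp} \<Longrightarrow> ((\<lambda>\<tau>. P s \<tau>) has_vector_derivative DT \<tau>) (at \<tau> within {tm..tp})"
begin

lemma along_tail_continuous: "continuous_on {0..tail_len sm tm s t} (along_tail P sm tm s)"
proof -
  have S: "continuous_on {sm..sp} (\<lambda>\<sigma>. P \<sigma> tm)" and T: "continuous_on {tm..tp} (\<lambda>\<tau>. P s \<tau>)"
    using DS DT has_vector_derivative_continuous unfolding continuous_on_eq_continuous_within by blast+
  show ?thesis
    unfolding along_tail_def
  proof (rule continuous_on_cases_le)
    show "continuous_on {u \<in> {0..tail_len sm tm s t}. u \<le> s - sm} (\<lambda>u. P (u + sm) tm)"
      by (rule continuous_on_compose2[OF S]) (use s in \<open>auto intro!: continuous_intros\<close>)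
    show "continuous_on {u \<in> {0..tail_len sm tm s t}. s - sm \<le> u} (\<lambda>u. P s (u - (s - sm) + tm))"
      by (rule continuous_on_compose2[OF T]) (use s t in \<open>auto simp: tail_len_def intro!: continuous_intros\<close>)
  qed auto
qed

text \<open>The one-sided derivatives at the corner differ in general, so that parameter is
  excluded. At any other \<open>u\<close>, the full parameter interval agrees near \<open>u\<close>
  with that of a single edge.\<close>

lemma along_tail_deriv:
  assumes u: "u \<in> {0..tail_len sm tm s t}" "u \<noteq> s - sm"
  shows "(along_tail P sm tm s has_vector_derivative
    (if u \<le> s - sm then DS (u + sm) else DT (u - (s - sm) + tm))) (at u within {0..tail_len sm tm s t})"
proof (cases "u < s - sm")
  case True
  have "((\<lambda>u. P (u + sm) tm) has_vector_derivative DS (u + sm)) (at u within {0..s - sm})"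
    by (rule has_vector_derivative_shift[OF DS]) (use u True s in auto)
  also have "at u within {0..s - sm} = at u within {0..tail_len sm tm s t}"
    by (rule at_within_nhd[of u "{..<s - sm}"]) (use True t in \<open>auto simp: tail_len_def\<close>)
  finally have "(along_tail P sm tm s has_vector_derivative DS (u + sm)) (at u within {0..tail_len sm tm s t})"
    by (rule has_vector_derivative_transform_within[where d = "s - sm - u"])
      (use True u in \<open>auto simp: along_tail_def dist_real_def\<close>)
  then show ?thesis using True by simp
next
  case False
  with u have k: "s - sm < u" by simp
  have "((\<lambda>u. P s (u + (tm - (s - sm)))) has_vector_derivative DT (u + (tm - (s - sm))))
      (at u within {s - sm..tail_len sm tm s t})"
    by (rule has_vector_derivative_shift[OF DT]) (use u k s t in \<open>auto simp: tail_len_def\<close>)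
  also have "at u within {s - sm..tail_len sm tm s t} = at u within {0..tail_len sm tm s t}"
    by (rule at_within_nhd[of u "{s - sm<..}"]) (use k s in auto)
  finally have "(along_tail P sm tm s has_vector_derivative DT (u + (tm - (s - sm)))) (at u within {0..tail_len sm tm s t})"
    by (rule has_vector_derivative_transform_within[where d = "u - (s - sm)"])
      (use k u in \<open>auto simp: along_tail_def dist_real_def algebra_simps\<close>)
  then show ?thesis using k by (simp add: algebra_simps)
qed

end

section \<open>Iterated integrals along tail paths\<close>

text \<open>The word is read backwards: the letter at its head is integrated last. The first integral
  runs along the bottom edge of the rectangle, the second one up the vertical segment.\<close>

primrec tail_sig :: "nat \<Rightarrow> real \<Rightarrow> real \<Rightarrow> (nat \<Rightarrow> real \<times> real \<Rightarrow> real) \<Rightarrow> nat list \<Rightarrow> real \<Rightarrow> real \<Rightarrow> real" where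
  "tail_sig d sm tm X [] s t = 1"
| "tail_sig d sm tm X (i # w) s t = (if i < d then
      integral {sm..s} (\<lambda>\<sigma>. tail_sig d sm tm X w \<sigma> tm * dS X i (\<sigma>, tm))
      + integral {tm..t} (\<lambda>\<tau>. tail_sig d sm tm X w s \<tau> * dT X i (s, \<tau>)) else 0)"

locale surface =
  fixes d :: nat and sm sp tm tp :: real and X :: "nat \<Rightarrow> real \<times> real \<Rightarrow> real"
  assumes s_le: "sm \<le> sp" and t_le: "tm \<le> tp" and smooth: "smooth_surface d sm sp tm tp X"
begin

abbreviation rect :: "(real \<times> real) set" where
  "rect \<equiv> {sm..sp} \<times> {tm..tp}"

abbreviation ver :: "nat list \<Rightarrow> real \<Rightarrow> real \<Rightarrow> real" where
  "ver \<equiv> tail_sig d sm tm X"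

lemma X_smooth:
  assumes "i < d"
  shows "continuous_on rect (dS X i)" "continuous_on rect (dT X i)"
    "\<And>z. z \<in> rect \<Longrightarrow> (X i has_derivative frechet_derivative (X i) (at z)) (at z)"
proof -
  obtain U where U: "rect \<subseteq> U" "Ck (Suc 0) U (X i)"
    using smooth assms unfolding smooth_surface_def by blast
  show "continuous_on rect (dS X i)" "continuous_on rect (dT X i)"
    using U(2) by (auto intro!: continuous_on_subset[OF _ U(1)] simp: dS_def[abs_def] dT_def[abs_def])
  show "(X i has_derivative frechet_derivative (X i) (at z)) (at z)" if "z \<in> rect" for z
    using U that by (auto simp: frechet_derivative_works[symmetric])
qed

lemma X_partial:
  assumes "i < d" "(s, t) \<in> rect"
  shows "((\<lambda>s. X i (s, t)) has_vector_derivative dS X i (s, t)) (at s within T)"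
    "((\<lambda>t. X i (s, t)) has_vector_derivative dT X i (s, t)) (at t within T)"
proof -
  note D = X_smooth(3)[OF assms]
  interpret bounded_linear "frechet_derivative (X i) (at (s, t))"
    using D by (rule has_derivative_bounded_linear)
  have "((\<lambda>s. X i (s, t)) has_derivative (\<lambda>h. frechet_derivative (X i) (at (s, t)) (h, 0))) (at s within T)"
    by (rule has_derivative_compose[where g = "X i" and f = "\<lambda>s. (s, t)", OF _ D])
      (auto intro!: derivative_eq_intros)
  moreover have "frechet_derivative (X i) (at (s, t)) (h, 0) = h *\<^sub>R dS X i (s, t)" for h
    using scaleR[of h "(1, 0)"] by (simp add: dS_def)
  ultimately show "((\<lambda>s. X i (s, t)) has_vector_derivative dS X i (s, t)) (at s within T)"
    by (simp add: has_vector_derivative_def)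
  have "((\<lambda>t. X i (s, t)) has_derivative (\<lambda>h. frechet_derivative (X i) (at (s, t)) (0, h))) (at t within T)"
    by (rule has_derivative_compose[where g = "X i" and f = "\<lambda>t. (s, t)", OF _ D])
      (auto intro!: derivative_eq_intros)
  moreover have "frechet_derivative (X i) (at (s, t)) (0, h) = h *\<^sub>R dT X i (s, t)" for h
    using scaleR[of h "(0, 1)"] by (simp add: dT_def)
  ultimately show "((\<lambda>t. X i (s, t)) has_vector_derivative dT X i (s, t)) (at t within T)"
    by (simp add: has_vector_derivative_def)
qed

lemma derivative_bound:
  obtains K where "0 \<le> K" "\<And>i z. i < d \<Longrightarrow> z \<in> rect \<Longrightarrow> \<bar>dS X i z\<bar> \<le> K \<and> \<bar>dT X i z\<bar> \<le> K"
proof -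
  have "\<exists>B. \<forall>z\<in>rect. \<bar>dS X i z\<bar> \<le> B \<and> \<bar>dT X i z\<bar> \<le> B" if "i < d" for i
  proof -
    have "compact rect" by (intro compact_Times) auto
    then have "bounded (dS X i ` rect)" "bounded (dT X i ` rect)"
      using X_smooth[OF that] by (auto intro!: compact_imp_bounded compact_continuous_image)
    then obtain B1 B2 where B: "\<forall>z\<in>rect. \<bar>dS X i z\<bar> \<le> B1" "\<forall>z\<in>rect. \<bar>dT X i z\<bar> \<le> B2"
      unfolding bounded_iff by auto
    then show ?thesis by (intro exI[of _ "max B1 B2"]) (auto simp: le_max_iff_disj)
  qed
  then obtain B where B: "\<And>i z. i < d \<Longrightarrow> z \<in> rect \<Longrightarrow> \<bar>dS X i z\<bar> \<le> B i \<and> \<bar>dT X i z\<bar> \<le> B i"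
    by metis
  show thesis
  proof (rule that[of "\<Sum>i<d. \<bar>B i\<bar>"])
    fix i z assume iz: "i < d" "z \<in> rect"
    have "\<bar>B i\<bar> \<le> (\<Sum>i<d. \<bar>B i\<bar>)" using iz(1) by (intro member_le_sum) auto
    then show "\<bar>dS X i z\<bar> \<le> (\<Sum>i<d. \<bar>B i\<bar>) \<and> \<bar>dT X i z\<bar> \<le> (\<Sum>i<d. \<bar>B i\<bar>)"
      using B[OF iz] by linarith
  qed (simp add: sum_nonneg)
qed

lemma ver_continuous: "continuous_on rect (\<lambda>z. ver w (fst z) (snd z))"
proof (induction w)
  case (Cons i w)
  show ?case
  proof (cases "i < d")
    case True
    have S: "continuous_on {sm..sp} (\<lambda>\<sigma>. ver w \<sigma> tm * dS X i (\<sigma>, tm))"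
      by (intro continuous_intros continuous_on_compose2[OF Cons, of _ "\<lambda>\<sigma>. (\<sigma>, tm)", simplified]
          continuous_on_compose2[OF X_smooth(1)[OF True]]) (use t_le in auto)
    have "continuous_on rect (\<lambda>z. integral {sm..fst z} (\<lambda>\<sigma>. ver w \<sigma> tm * dS X i (\<sigma>, tm)))"
      by (rule continuous_on_compose2[OF indefinite_integral_continuous_1[OF integrable_continuous_interval[OF S]]])
        (auto intro!: continuous_intros)
    moreover have "continuous_on rect (\<lambda>z. integral {tm..snd z} (\<lambda>\<tau>. (\<lambda>z. ver w (fst z) (snd z) * dT X i z) (fst z, \<tau>)))"
      by (rule continuous_on_integral_upto) (intro continuous_intros Cons X_smooth True)
    ultimately show ?thesis using True by (simp add: continuous_on_add)
  qed simp
qed simp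

lemma ver_continuous_s: "t \<in> {tm..tp} \<Longrightarrow> continuous_on {sm..sp} (\<lambda>s. ver w s t)"
  by (rule continuous_on_compose2[OF ver_continuous, of "{sm..sp}" "\<lambda>s. (s, t)" w, simplified])
    (auto intro!: continuous_intros)

lemma ver_continuous_t: "s \<in> {sm..sp} \<Longrightarrow> continuous_on {tm..tp} (\<lambda>t. ver w s t)"
  by (rule continuous_on_compose2[OF ver_continuous, of "{tm..tp}" "\<lambda>t. (s, t)" w, simplified])
    (auto intro!: continuous_intros)

lemma integrand_continuous_s: "i < d \<Longrightarrow> continuous_on {sm..sp} (\<lambda>\<sigma>. ver w \<sigma> tm * dS X i (\<sigma>, tm))"
  by (intro continuous_intros ver_continuous_s continuous_on_compose2[OF X_smooth(1)]) (use t_le in auto)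

lemma integrand_continuous_t:
  "i < d \<Longrightarrow> s \<in> {sm..sp} \<Longrightarrow> continuous_on {tm..tp} (\<lambda>\<tau>. ver w s \<tau> * dT X i (s, \<tau>))"
  by (intro continuous_intros ver_continuous_t continuous_on_compose2[OF X_smooth(2)]) auto

lemma ver_invalid: "\<not> valid0 d w \<Longrightarrow> ver w s t = 0"
  by (induction w arbitrary: s t) (auto simp: valid0_def)

lemma ver_start: "ver w sm tm = (if w = [] then 1 else 0)"
  by (cases w) auto

text \<open>This holds along the bottom edge, where the vertical integral is over a single point.
  Higher up, moving s also displaces the vertical segment.\<close>

lemma ver_deriv_s:
  assumes "\<sigma> \<in> {sm..sp}"
  shows "((\<lambda>\<sigma>. ver (i # w) \<sigma> tm) has_real_derivative ver w \<sigma> tm * (if i < d then dS X i (\<sigma>, tm) else 0))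
    (at \<sigma> within {sm..sp})"
  using integral_has_vector_derivative[OF integrand_continuous_s[of i w] assms]
  by (auto simp: has_real_derivative_iff_has_vector_derivative)

lemma ver_deriv_t:
  assumes "s \<in> {sm..sp}" "\<tau> \<in> {tm..tp}"
  shows "((\<lambda>\<tau>. ver (i # w) s \<tau>) has_real_derivative ver w s \<tau> * (if i < d then dT X i (s, \<tau>) else 0))
    (at \<tau> within {tm..tp})"
proof (cases "i < d")
  case True
  have "((\<lambda>\<tau>. integral {tm..\<tau>} (\<lambda>\<tau>. ver w s \<tau> * dT X i (s, \<tau>))) has_real_derivative ver w s \<tau> * dT X i (s, \<tau>))
      (at \<tau> within {tm..tp})"
    using integral_has_vector_derivative[OF integrand_continuous_t[OF True assms(1), of w] assms(2)]
    by (simp add: has_real_derivative_iff_has_vector_derivative)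
  from DERIV_add[OF DERIV_const this] True show ?thesis by simp
qed simp

text \<open>The base of the power is K times the length (s - sm) + (t - tm) of the parameter
  interval of the tail path. The bottom edge is estimated with offset 0, the vertical one with
  offset s - sm, and the two estimates telescope.\<close>

lemma ver_bound:
  assumes "0 \<le> K" and K: "\<And>i z. i < d \<Longrightarrow> z \<in> rect \<Longrightarrow> \<bar>dS X i z\<bar> \<le> K \<and> \<bar>dT X i z\<bar> \<le> K"
    and st: "s \<in> {sm..sp}" "t \<in> {tm..tp}"
  shows "\<bar>ver w s t\<bar> \<le> (K * ((s - sm) + (t - tm))) ^ length w / fact (length w)"
  using st
proof (induction w arbitrary: s t)
  case (Cons i w)
  show ?case
  proof (cases "i < d")
    case True
    let ?n = "length w"
    have "\<bar>ver w \<sigma> tm * dS X i (\<sigma>, tm)\<bar> \<le> 1 * K * (K * (0 + (\<sigma> - sm))) ^ ?n / fact ?n"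
      if "\<sigma> \<in> {sm..s}" for \<sigma>
    proof -
      have "\<bar>ver w \<sigma> tm\<bar> * \<bar>dS X i (\<sigma>, tm)\<bar> \<le> ((K * ((\<sigma> - sm) + (tm - tm))) ^ ?n / fact ?n) * K"
        using that Cons.prems K[OF True, of "(\<sigma>, tm)"] t_le \<open>0 \<le> K\<close>
        by (intro mult_mono Cons.IH) (auto intro!: divide_nonneg_nonneg zero_le_power mult_nonneg_nonneg)
      then show ?thesis by (simp add: abs_mult mult_ac)
    qed
    then have 1: "norm (integral {sm..s} (\<lambda>\<sigma>. ver w \<sigma> tm * dS X i (\<sigma>, tm)))
        \<le> 1 * ((K * (0 + (s - sm))) ^ Suc ?n / fact (Suc ?n) - (K * 0) ^ Suc ?n / fact (Suc ?n))"
      using Cons.prems integrand_continuous_s[OF True, of w]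
      by (intro norm_integral_power_bound integrable_continuous_interval)
        (auto intro: continuous_on_subset)
    have "\<bar>ver w s \<tau> * dT X i (s, \<tau>)\<bar> \<le> 1 * K * (K * ((s - sm) + (\<tau> - tm))) ^ ?n / fact ?n"
      if "\<tau> \<in> {tm..t}" for \<tau>
    proof -
      have "\<bar>ver w s \<tau>\<bar> * \<bar>dT X i (s, \<tau>)\<bar> \<le> ((K * ((s - sm) + (\<tau> - tm))) ^ ?n / fact ?n) * K"
        using that Cons.prems K[OF True, of "(s, \<tau>)"] \<open>0 \<le> K\<close>
        by (intro mult_mono Cons.IH) (auto intro!: divide_nonneg_nonneg zero_le_power mult_nonneg_nonneg)
      then show ?thesis by (simp add: abs_mult mult_ac)
    qed
    then have 2: "norm (integral {tm..t} (\<lambda>\<tau>. ver w s \<tau> * dT X i (s, \<tau>)))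
        \<le> 1 * ((K * ((s - sm) + (t - tm))) ^ Suc ?n / fact (Suc ?n) - (K * (s - sm)) ^ Suc ?n / fact (Suc ?n))"
      using Cons.prems integrand_continuous_t[OF True, of s w]
      by (intro norm_integral_power_bound integrable_continuous_interval)
        (auto intro: continuous_on_subset)
    have "\<bar>ver (i # w) s t\<bar> \<le> (K * ((s - sm) + (t - tm))) ^ Suc ?n / fact (Suc ?n)"
      using 1 2 True by simp
    then show ?thesis by simp
  next
    case False
    then show ?thesis using Cons.prems \<open>0 \<le> K\<close>
      by (auto intro!: divide_nonneg_nonneg zero_le_power mult_nonneg_nonneg)
  qed
qed simp

end

text \<open>The inverse of a signature is its antipode: reverse the word and alternate the sign.
  Cutting \<open>w\<close> at k, differentiating the prefix removes its last letter and
  differentiating the suffix removes its first one; the prefix term of cut k + 1 cancels the suffix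
  term of cut k.\<close>

lemma telescoping_inverse_deriv:
  fixes Y :: "nat list \<Rightarrow> real \<Rightarrow> real"
  assumes Nil: "Y [] = (\<lambda>t. 1)"
    and Cons: "\<And>i w. (Y (i # w) has_real_derivative Y w t * h i) (at t within S)"
  shows "((\<lambda>t. mul0 (\<lambda>w. Y (rev w) t) (\<lambda>w. (-1) ^ length w * Y w t) w) has_real_derivative 0) (at t within S)"
proof -
  let ?n = "length w"
  define A where "A k t = Y (rev (take k w)) t" for k t
  define B where "B k t = (-1) ^ (?n - k) * Y (drop k w) t" for k t
  \<comment> \<open>At the outer cuts the empty prefix, or the empty suffix, has the constant
    coefficient 1 and hence derivative 0.\<close>
  define A' where "A' k = (if k = 0 then 0 else A (k - 1) t * h (w ! (k - 1)))" for k
  define B' where "B' k = (if k = ?n then 0 else - h (w ! k) * B (Suc k) t)" for k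
  have dA: "(A k has_real_derivative A' k) (at t within S)" if "k \<le> ?n" for k
  proof (cases k)
    case (Suc m)
    then have "rev (take k w) = w ! m # rev (take m w)" using that by (simp add: take_Suc_conv_app_nth)
    then show ?thesis using Cons[of "w ! m" "rev (take m w)"] by (simp add: A_def[abs_def] A'_def Suc)
  qed (simp add: A_def[abs_def] A'_def Nil)
  have dB: "(B k has_real_derivative B' k) (at t within S)" if "k \<le> ?n" for k
  proof (cases "k = ?n")
    case False
    then have k: "k < ?n" using that by simp
    have "drop k w = w ! k # drop (Suc k) w" using k by (simp add: Cons_nth_drop_Suc)
    moreover have "(-1) ^ (?n - k) = - ((-1::real) ^ (?n - Suc k))" using k by (metis Suc_diff_Suc power_Suc mult_minus1)
    ultimately show ?thesis
      using DERIV_cmult[OF Cons[of "w ! k" "drop (Suc k) w"], of "- ((-1) ^ (?n - Suc k))"] False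
      by (simp add: B_def[abs_def] B'_def mult_ac)
  qed (simp add: B_def[abs_def] B'_def Nil)
  have "((\<lambda>t. \<Sum>k\<le>?n. A k t * B k t) has_real_derivative (\<Sum>k\<le>?n. A k t * B' k + A' k * B k t)) (at t within S)"
    by (intro DERIV_sum DERIV_mult' dA dB) auto
  moreover have "(\<Sum>k\<le>?n. A k t * B' k + A' k * B k t) = 0"
  proof -
    have "(\<Sum>k\<le>?n. A' k * B k t) = (\<Sum>k<?n. A k t * h (w ! k) * B (Suc k) t)"
      by (simp add: sum.atMost_shift A'_def)
    moreover have "(\<Sum>k\<le>?n. A k t * B' k) = (\<Sum>k<?n. - (A k t * h (w ! k) * B (Suc k) t))"
      unfolding lessThan_Suc_atMost[symmetric] sum.lessThan_Suc by (auto simp: B'_def intro!: sum.cong)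
    ultimately show ?thesis by (simp add: sum.distrib sum_negf)
  qed
  moreover have "mul0 (\<lambda>w. Y (rev w) t) (\<lambda>w. (-1) ^ length w * Y w t) w = (\<Sum>k\<le>?n. A k t * B k t)" for t
    by (auto simp: mul0_def A_def B_def)
  ultimately show ?thesis by simp
qed

text \<open>The vector with coordinates \<open>v\<close>, as an element of level one; it serves as
  the velocity of the tail path.\<close>

definition letters :: "nat \<Rightarrow> (nat \<Rightarrow> real) \<Rightarrow> t0" where
  "letters d v w = (if length w = 1 \<and> hd w < d then v (hd w) else 0)"

lemma mul0_letters_Nil: "mul0 a (letters d v) [] = 0"
  by (simp add: mul0_def letters_def)

lemma mul0_letters_snoc: "mul0 a (letters d v) (u @ [i]) = a u * (if i < d then v i else 0)"
proof -
  have "letters d v (drop k (u @ [i])) = (if k = length u then (if i < d then v i else 0) else 0)"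
    if "k \<le> length (u @ [i])" for k
    using that by (auto simp: letters_def)
  then have "mul0 a (letters d v) (u @ [i])
      = (\<Sum>k\<le>length (u @ [i]). if k = length u then a u * (if i < d then v i else 0) else 0)"
    unfolding mul0_def by (intro sum.cong) auto
  then show ?thesis by simp
qed

lemma dom_letters:
  fixes K :: real
  assumes "\<And>i. i < d \<Longrightarrow> \<bar>v i\<bar> \<le> K"
  shows "T0.dom d (\<lambda>n. if n = 1 then card {w. valid0 d w \<and> length w = 1} * K else 0) (letters d v)"
  unfolding T0.dom_def
proof (intro conjI allI impI)
  fix w assume "\<not> valid0 d w"
  then show "letters d v w = 0" by (cases w) (auto simp: letters_def valid0_def)
next
  fix n
  have "\<bar>letters d v w\<bar> \<le> K" if "valid0 d w" "length w = 1" for w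
    using that assms by (cases w) (auto simp: letters_def valid0_def)
  then have "(\<Sum>w | valid0 d w \<and> length w = 1. \<bar>letters d v w\<bar>) \<le> card {w. valid0 d w \<and> length w = 1} * K"
    by (intro sum_bounded_above) auto
  then show "T0.l1 d n (letters d v) \<le> (if n = 1 then card {w. valid0 d w \<and> length w = 1} * K else 0)"
    by (auto simp: T0.l1_def letters_def)
qed

lemma Jt1_eq_0: "level1 b \<noteq> 2 \<Longrightarrow> Jt1 d X z b = 0"
  by (auto simp: Jt1_def level1_def split: prod.splits)

context surface
begin

text \<open>The signature of the tail path ending at (s, t), see \<open>sig_tail\<close>; the
  reversal undoes the backward reading of words in \<open>tail_sig\<close>.\<close>

definition g :: "real \<Rightarrow> real \<Rightarrow> t0" where
  "g s t = (\<lambda>w. ver (rev w) s t)"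

text \<open>The antipode of \<open>g s t\<close>, hence its inverse; being explicit, it inherits
  continuity and bounds from \<open>ver\<close>.\<close>

definition g' :: "real \<Rightarrow> real \<Rightarrow> t0" where
  "g' s t = (\<lambda>w. (-1) ^ length w * ver w s t)"

lemma tail_path_deriv:
  assumes "i < d" "s \<in> {sm..sp}" "t \<in> {tm..tp}" "u \<in> {0..tail_len sm tm s t}" "u \<noteq> s - sm"
  shows "vector_derivative (tail_path X sm tm s t i) (at u within {0..tail_len sm tm s t})
     = (if u \<le> s - sm then dS X i (u + sm, tm) else dT X i (s, u - (s - sm) + tm))"
proof -
  interpret tail_curve "\<lambda>s t. X i (s, t)" "\<lambda>\<sigma>. dS X i (\<sigma>, tm)" "\<lambda>\<tau>. dT X i (s, \<tau>)" sm sp tm tp s t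
    by standard (use assms t_le in \<open>auto intro!: X_partial\<close>)
  \<comment> \<open>A tail path of length 0 has only the excluded corner as parameter. On a
    nondegenerate interval the derivative within it is unique.\<close>
  have "0 < tail_len sm tm s t" using assms by (auto simp: tail_len_def)
  then show ?thesis
    unfolding tail_path_eq using assms(4,5)
    by (intro vector_derivative_within_closed_interval along_tail_deriv)
qed

text \<open>\<open>sigr\<close> integrates along the whole path, \<open>tail_sig\<close> edge by
  edge. Both are primitives of the same integrand away from the corner, both are continuous, and for
  a nonempty word both vanish at the start.\<close>

lemma sigr_tail:
  assumes st: "s \<in> {sm..sp}" "t \<in> {tm..tp}" and "u \<in> {0..tail_len sm tm s t}"
  shows "sigr d (tail_len sm tm s t) (tail_path X sm tm s t) u w = along_tail (ver w) sm tm s u"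
  using assms(3)
proof (induction w arbitrary: u)
  case Nil
  show ?case by (simp add: along_tail_def)
next
  case (Cons i w)
  let ?L = "tail_len sm tm s t"
  let ?v = "\<lambda>u. vector_derivative (tail_path X sm tm s t i) (at u within {0..?L})"
  show ?case
  proof (cases "i < d")
    case True
    interpret tail_curve "ver (i # w)" "\<lambda>\<sigma>. ver w \<sigma> tm * dS X i (\<sigma>, tm)" "\<lambda>\<tau>. ver w s \<tau> * dT X i (s, \<tau>)" sm sp tm tp s t
      using ver_deriv_s[of _ i w] ver_deriv_t[OF st(1), of _ i w] True
      by unfold_locales
        (use st in \<open>auto simp: has_real_derivative_iff_has_vector_derivative simp del: tail_sig.simps\<close>)
    have "((\<lambda>v. along_tail (ver w) sm tm s v * ?v v) has_integral
        along_tail (ver (i # w)) sm tm s u - along_tail (ver (i # w)) sm tm s 0) {0..u}"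
    proof (rule fundamental_theorem_of_calculus_interior_strong[of "{s - sm}"])
      show "continuous_on {0..u} (along_tail (ver (i # w)) sm tm s)"
        using Cons.prems by (intro continuous_on_subset[OF along_tail_continuous]) auto
      fix v assume v: "v \<in> {0<..<u} - {s - sm}"
      then have v': "v \<in> {0..?L}" "v \<noteq> s - sm" "v \<in> {0<..<?L}" using Cons.prems by auto
      have "along_tail (ver w) sm tm s v * ?v v
          = (if v \<le> s - sm then ver w (v + sm) tm * dS X i (v + sm, tm)
             else ver w s (v - (s - sm) + tm) * dT X i (s, v - (s - sm) + tm))"
        unfolding tail_path_deriv[OF True st v'(1,2)] by (simp add: along_tail_def)
      then show "(along_tail (ver (i # w)) sm tm s has_vector_derivative along_tail (ver w) sm tm s v * ?v v) (at v)"
        using along_tail_deriv[OF v'(1,2)] v'(3) by (simp only: at_within_Icc_interior)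
    qed (use Cons.prems in auto)
    moreover have "along_tail (ver (i # w)) sm tm s 0 = 0"
      using st by (simp add: along_tail_start)
    ultimately have "integral {0..u} (\<lambda>v. along_tail (ver w) sm tm s v * ?v v) = along_tail (ver (i # w)) sm tm s u"
      by (simp add: integral_unique)
    moreover have "integral {0..u} (\<lambda>v. sigr d ?L (tail_path X sm tm s t) v w * ?v v)
        = integral {0..u} (\<lambda>v. along_tail (ver w) sm tm s v * ?v v)"
      using Cons by (intro integral_cong) auto
    ultimately show ?thesis using True by (simp del: tail_sig.simps)
  qed (simp add: along_tail_def)
qed

lemma sig_tail:
  assumes "s \<in> {sm..sp}" "t \<in> {tm..tp}"
  shows "sig d (tail_len sm tm s t) (tail_path X sm tm s t) = g s t"
proof
  fix w
  have "tail_len sm tm s t \<in> {0..tail_len sm tm s t}" using assms by (auto simp: tail_len_def)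
  from sigr_tail[OF assms this] show "sig d (tail_len sm tm s t) (tail_path X sm tm s t) w = g s t w"
    using assms by (simp add: sig_def g_def along_tail_end)
qed

lemma g_start: "g sm tm = one0"
  by (auto simp: g_def one0_def ver_start)

lemma g'_start: "g' sm tm = one0"
  by (auto simp: g'_def one0_def ver_start)

text \<open>The product is constant up the vertical edge and along the bottom edge, and both factors
  are 1 at the lower left corner.\<close>

lemma g_inverse:
  assumes st: "s \<in> {sm..sp}" "t \<in> {tm..tp}"
  shows "mul0 (g s t) (g' s t) = one0"
proof
  fix w
  define M where "M s t = mul0 (g s t) (g' s t) w" for s t
  have dt: "((\<lambda>t. M s t) has_real_derivative 0) (at \<tau> within {tm..tp})" if "\<tau> \<in> {tm..tp}" for \<tau>
    unfolding M_def g_def g'_def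
    by (rule telescoping_inverse_deriv[where Y = "\<lambda>w t. ver w s t"])
      (use ver_deriv_t[OF st(1) that] in \<open>auto simp del: tail_sig.simps(2)\<close>)
  have ds: "((\<lambda>s. M s tm) has_real_derivative 0) (at \<sigma> within {sm..sp})" if "\<sigma> \<in> {sm..sp}" for \<sigma>
    unfolding M_def g_def g'_def
    by (rule telescoping_inverse_deriv[where Y = "\<lambda>w s. ver w s tm"])
      (use ver_deriv_s[OF that] in \<open>auto simp del: tail_sig.simps(2)\<close>)
  have "M s t = M s tm"
    by (rule has_real_derivative_eq_imp_eq[OF dt, where g = "\<lambda>_. M s tm"]) (use st in auto)
  also have "\<dots> = M sm tm"
    by (rule has_real_derivative_eq_imp_eq[OF ds, where g = "\<lambda>_. M sm tm"]) (use st in auto)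
  also have "\<dots> = one0 w" by (simp add: M_def g_start g'_start mul0_one_left)
  finally show "mul0 (g s t) (g' s t) w = one0 w" by (simp add: M_def)
qed

lemma g_inverse':
  assumes "s \<in> {sm..sp}" "t \<in> {tm..tp}"
  shows "inv0 (g s t) = g' s t" "mul0 (g' s t) (g s t) = one0"
  using inv0_eq[OF g_inverse[OF assms]] by (auto simp: g_def)

lemma g_continuous: "continuous_on rect (\<lambda>z. g (fst z) (snd z) w)" "continuous_on rect (\<lambda>z. g' (fst z) (snd z) w)"
  unfolding g_def g'_def by (intro continuous_intros ver_continuous)+

lemma g_deriv_s:
  assumes "\<sigma> \<in> {sm..sp}"
  shows "((\<lambda>\<sigma>. g \<sigma> tm w) has_real_derivative mul0 (g \<sigma> tm) (letters d (\<lambda>i. dS X i (\<sigma>, tm))) w) (at \<sigma> within {sm..sp})"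
proof (cases w rule: rev_cases)
  case (snoc u i)
  then show ?thesis using ver_deriv_s[OF assms, of i "rev u"]
    by (simp add: g_def mul0_letters_snoc del: tail_sig.simps(2))
qed (simp add: g_def mul0_letters_Nil)

lemma g_deriv_t:
  assumes "s \<in> {sm..sp}" "\<tau> \<in> {tm..tp}"
  shows "((\<lambda>\<tau>. g s \<tau> w) has_real_derivative mul0 (g s \<tau>) (letters d (\<lambda>i. dT X i (s, \<tau>))) w) (at \<tau> within {tm..tp})"
proof (cases w rule: rev_cases)
  case (snoc u i)
  then show ?thesis using ver_deriv_t[OF assms, of i "rev u"]
    by (simp add: g_def mul0_letters_snoc del: tail_sig.simps(2))
qed (simp add: g_def mul0_letters_Nil)

lemma g_dominated:
  obtains c where "rapid c" "\<And>s t. s \<in> {sm..sp} \<Longrightarrow> t \<in> {tm..tp} \<Longrightarrow> T0.dom d c (g s t)"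
    "\<And>s t. s \<in> {sm..sp} \<Longrightarrow> t \<in> {tm..tp} \<Longrightarrow> T0.dom d c (g' s t)"
proof -
  obtain K where K: "0 \<le> K" "\<And>i z. i < d \<Longrightarrow> z \<in> rect \<Longrightarrow> \<bar>dS X i z\<bar> \<le> K \<and> \<bar>dT X i z\<bar> \<le> K"
    using derivative_bound by blast
  define L where "L = K * ((sp - sm) + (tp - tm))"
  have bound: "\<bar>ver w s t\<bar> \<le> L ^ length w / fact (length w)" if "s \<in> {sm..sp}" "t \<in> {tm..tp}" for w s t
  proof -
    have "(K * ((s - sm) + (t - tm))) ^ length w \<le> L ^ length w"
      unfolding L_def using that K(1) by (intro power_mono mult_left_mono) auto
    then show ?thesis
      using ver_bound[OF K that, of w] by (meson divide_right_mono fact_ge_zero order_trans)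
  qed
  \<comment> \<open>There are d^n words of length n, each with coefficient at most L^n / n!.\<close>
  define c where "c n = (real d * L) ^ n / fact n" for n
  have card: "card {w. valid0 d w \<and> length w = n} = d ^ n" for n
    using card_lists_length_eq[of "{..<d}" n] by (simp add: valid0_def)
  \<comment> \<open>One claim for both: reversal with sign 1 gives \<open>g\<close>, the identity
    with alternating sign gives \<open>g'\<close>.\<close>
  have "T0.dom d c (\<lambda>w. \<epsilon> w * ver (\<phi> w) s t)"
    if st: "s \<in> {sm..sp}" "t \<in> {tm..tp}" and \<phi>: "\<And>w. valid0 d (\<phi> w) \<longleftrightarrow> valid0 d w" "\<And>w. length (\<phi> w) = length w"
      and \<epsilon>: "\<And>w. \<bar>\<epsilon> w\<bar> = 1" for s t \<phi> and \<epsilon> :: t0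
    unfolding T0.dom_def
  proof (intro conjI allI impI)
    fix n
    have "T0.l1 d n (\<lambda>w. \<epsilon> w * ver (\<phi> w) s t) \<le> card {w. valid0 d w \<and> length w = n} * (L ^ n / fact n)"
      unfolding T0.l1_def
    proof (rule sum_bounded_above)
      fix w assume "w \<in> {w. valid0 d w \<and> length w = n}"
      then show "\<bar>\<epsilon> w * ver (\<phi> w) s t\<bar> \<le> L ^ n / fact n"
        using bound[OF st, of "\<phi> w"] \<phi>(2)[of w] \<epsilon>[of w] by (simp add: abs_mult)
    qed
    then show "T0.l1 d n (\<lambda>w. \<epsilon> w * ver (\<phi> w) s t) \<le> c n"
      by (simp add: card c_def power_mult_distrib)
  qed (simp add: ver_invalid \<phi>)
  from this[of _ _ rev "\<lambda>_. 1"] this[of _ _ "\<lambda>w. w" "\<lambda>w. (-1) ^ length w"]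
  have dom: "T0.dom d c (g s t)" "T0.dom d c (g' s t)" if "s \<in> {sm..sp}" "t \<in> {tm..tp}" for s t
    using that by (auto simp: g_def g'_def valid0_def power_abs)
  have "rapid c"
    unfolding rapid_def
  proof (intro allI impI)
    fix l :: real
    show "summable (\<lambda>n. l ^ n * c n)"
      using summable_exp[of "l * (real d * L)"] by (simp add: c_def power_mult_distrib field_simps)
  qed
  with dom that show thesis by blast
qed

lemma letters_dominated:
  obtains c where "rapid c" "\<And>s t. s \<in> {sm..sp} \<Longrightarrow> t \<in> {tm..tp} \<Longrightarrow>
    T0.dom d c (letters d (\<lambda>i. dS X i (s, t))) \<and> T0.dom d c (letters d (\<lambda>i. dT X i (s, t)))"
proof -
  obtain K where K: "0 \<le> K" "\<And>i z. i < d \<Longrightarrow> z \<in> rect \<Longrightarrow> \<bar>dS X i z\<bar> \<le> K \<and> \<bar>dT X i z\<bar> \<le> K"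
    using derivative_bound by blast
  define c :: "nat \<Rightarrow> real" where
    "c n = (if n = 1 then card {w. valid0 d w \<and> length w = 1} * K else 0)" for n
  have "rapid c" by (rule rapid_finite, rule finite_subset[of _ "{1}"]) (auto simp: c_def)
  moreover have "T0.dom d c (letters d (\<lambda>i. dS X i (s, t))) \<and> T0.dom d c (letters d (\<lambda>i. dT X i (s, t)))"
    if "s \<in> {sm..sp}" "t \<in> {tm..tp}" for s t
    unfolding c_def using K(2)[of _ "(s, t)"] that by (intro conjI dom_letters) auto
  ultimately show thesis using that by blast
qed

lemma Jt1_dominated:
  obtains c where "rapid c" "\<And>z. z \<in> rect \<Longrightarrow> T1.dom d c (Jt1 d X z)"
proof -
  obtain K where K: "0 \<le> K" "\<And>i z. i < d \<Longrightarrow> z \<in> rect \<Longrightarrow> \<bar>dS X i z\<bar> \<le> K \<and> \<bar>dT X i z\<bar> \<le> K"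
    using derivative_bound by blast
  have J: "\<bar>Jt1 d X z b\<bar> \<le> K * K + K * K" if "z \<in> rect" for z b
  proof -
    obtain u i j v where b: "b = (u, (i, j), v)" by (cases b) auto
    have "\<bar>Jco X i j z\<bar> \<le> K * K + K * K" if "i < d" "j < d"
    proof -
      have "\<bar>dS X i z * dT X j z\<bar> \<le> K * K" "\<bar>dS X j z * dT X i z\<bar> \<le> K * K"
        unfolding abs_mult using K that \<open>z \<in> rect\<close> by (auto intro!: mult_mono)
      then show ?thesis unfolding Jco_def by linarith
    qed
    then show ?thesis using K(1) by (auto simp: Jt1_def b)
  qed
  define c :: "nat \<Rightarrow> real" where
    "c n = (if n = 2 then card {b. valid1 d b \<and> level1 b = 2} * (K * K + K * K) else 0)" for n
  have "rapid c" by (rule rapid_finite, rule finite_subset[of _ "{2}"]) (auto simp: c_def)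
  moreover have "T1.dom d c (Jt1 d X z)" if "z \<in> rect" for z
    unfolding T1.dom_def
  proof (intro conjI allI impI)
    fix b assume "\<not> valid1 d b"
    then show "Jt1 d X z b = 0" by (auto simp: Jt1_def valid1_def split: prod.splits)
  next
    fix n
    show "T1.l1 d n (Jt1 d X z) \<le> c n"
    proof (cases "n = 2")
      case True
      then show ?thesis unfolding T1.l1_def c_def
        using J[OF that] by (auto intro!: sum_bounded_above)
    qed (simp add: T1.l1_def c_def Jt1_eq_0)
  qed
  ultimately show thesis using that by blast
qed

end

section \<open>The equation of the surface signature\<close>

lemma mul1_continuous_on:
  assumes E: "\<And>b. continuous_on S (\<lambda>t. E t b)" and F: "\<And>b. continuous_on S (\<lambda>t. F t b)"
  shows "continuous_on S (\<lambda>t. mul1 (E t) (F t) b)"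
proof -
  obtain u p v where b: "b = (u, p, v)" by (cases b)
  have "continuous_on S (\<lambda>t. delta_term (E t) w k)" for w k
    unfolding delta_term_def
    by (cases "w ! k < w ! (k+1)"; cases "w ! (k+1) < w ! k") (simp_all add: E continuous_on_minus)
  then show ?thesis
    unfolding mul1_def lact_def delta_eq b prod.case by (intro continuous_intros F)
qed

lemma mul1_support:
  assumes "\<And>b. \<not> valid1 d b \<Longrightarrow> E b = 0" "\<And>b. \<not> valid1 d b \<Longrightarrow> F b = 0" "\<not> valid1 d b"
  shows "mul1 E F b = 0"
  using T1.dom_support[OF dom_mul1[OF T1.dom_l1_self T1.dom_l1_self]] assms by blast

lemma l1_mul1_le: "T1.l1 d n (mul1 E F) \<le> (\<Sum>k\<le>n. 2 * T1.l1 d k E * T1.l1 d (n - k) F)"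
  unfolding mul1_def
  by (rule order_trans[OF l1_lact_le]) (intro sum_mono mult_right_mono l1_delta_le T1.l1_nonneg)

text \<open>This kills the term of the convolution in which the left factor has the full level n, so
  that an estimate at level n refers only to lower levels.\<close>

lemma l1_level_0: "T1.l1 d 0 E = 0"
  by (auto simp: T1.l1_def level1_def intro!: sum.neutral)

text \<open>With scalar part 1, the equation H' = H * (0, G) becomes R' = G + R * G.\<close>

locale driven_equation =
  fixes d :: nat and a b :: real and G :: "real \<Rightarrow> t1" and c :: "nat \<Rightarrow> real"
  assumes ab: "a \<le> b" and rapid_c: "rapid c"
    and G_dom: "\<And>t. t \<in> {a..b} \<Longrightarrow> T1.dom d c (G t)"
    and G_cont: "\<And>e. continuous_on {a..b} (\<lambda>t. G t e)"
begin

primrec picard :: "nat \<Rightarrow> real \<Rightarrow> t1" where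
  "picard 0 = (\<lambda>t e. 0)"
| "picard (Suc m) = (\<lambda>t e. integral {a..t} (\<lambda>\<tau>. G \<tau> e + mul1 (picard m \<tau>) (G \<tau>) e))"

lemma picard_continuous: "continuous_on {a..b} (\<lambda>t. picard m t e)"
proof (induction m arbitrary: e)
  case (Suc m)
  have "continuous_on {a..b} (\<lambda>\<tau>. G \<tau> e + mul1 (picard m \<tau>) (G \<tau>) e)"
    by (intro continuous_on_add G_cont mul1_continuous_on Suc)
  then show ?case
    using indefinite_integral_continuous_1[OF integrable_continuous_interval] by simp
qed simp

text \<open>Level n of a new iterate depends only on lower levels of the previous one, so each
  iteration settles at least one more level.\<close>

lemma picard_stable_Suc: "level1 e \<le> m \<Longrightarrow> picard (Suc m) t e = picard m t e"
proof (induction m arbitrary: t e)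
  case 0
  then show ?case by (auto simp: level1_def split: prod.splits)
next
  case (Suc m)
  have "mul1 (picard (Suc m) \<tau>) (G \<tau>) e = mul1 (picard m \<tau>) (G \<tau>) e" for \<tau>
    by (rule mul1_cong_below, rule Suc.IH) (use Suc.prems in simp)
  then show ?case by (simp only: picard.simps(2))
qed

lemma picard_stable: "level1 e \<le> m \<Longrightarrow> picard m t e = picard (level1 e) t e"
  by (induction m rule: dec_induct) (simp_all add: picard_stable_Suc del: picard.simps)

text \<open>The diagonal of the Picard scheme: each coefficient is read off at an iteration where it
  is already stationary, so no limit is taken.\<close>

definition R :: "real \<Rightarrow> t1" where
  "R t e = picard (level1 e) t e"

lemma R_eq: "R t e = integral {a..t} (\<lambda>\<tau>. G \<tau> e + mul1 (R \<tau>) (G \<tau>) e)"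
proof -
  have "mul1 (picard (level1 e) \<tau>) (G \<tau>) e = mul1 (R \<tau>) (G \<tau>) e" for \<tau>
    by (rule mul1_cong_below, unfold R_def, rule picard_stable) simp
  then have "picard (Suc (level1 e)) t e = integral {a..t} (\<lambda>\<tau>. G \<tau> e + mul1 (R \<tau>) (G \<tau>) e)"
    by simp
  then show ?thesis using picard_stable_Suc[of e "level1 e" t] by (simp add: R_def del: picard.simps)
qed

lemma R_continuous: "continuous_on {a..b} (\<lambda>t. R t e)"
  unfolding R_def by (rule picard_continuous)

lemma integrand_continuous: "continuous_on {a..b} (\<lambda>\<tau>. G \<tau> e + mul1 (R \<tau>) (G \<tau>) e)"
  by (intro continuous_on_add G_cont mul1_continuous_on R_continuous)

lemma R_deriv:
  assumes "t \<in> {a..b}"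
  shows "((\<lambda>t. R t e) has_real_derivative G t e + mul1 (R t) (G t) e) (at t within {a..b})"
proof -
  have "(\<lambda>t. R t e) = (\<lambda>t. integral {a..t} (\<lambda>\<tau>. G \<tau> e + mul1 (R \<tau>) (G \<tau>) e))"
    by (rule ext) (rule R_eq)
  then show ?thesis
    using integral_has_vector_derivative[OF integrand_continuous assms, of e]
    unfolding has_real_derivative_iff_has_vector_derivative by (simp only:)
qed

lemma R_start: "R a e = 0"
  using R_eq[of a e] by simp

lemma R_support: "t \<in> {a..b} \<Longrightarrow> \<not> valid1 d e \<Longrightarrow> R t e = 0"
proof -
  have "picard m t e = 0" if "t \<in> {a..b}" "\<not> valid1 d e" for m t e
    using that
  proof (induction m arbitrary: t e)
    case (Suc m)
    have "G \<tau> e + mul1 (picard m \<tau>) (G \<tau>) e = 0" if "\<tau> \<in> {a..t}" for \<tau>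
    proof -
      have \<tau>: "\<tau> \<in> {a..b}" using that Suc.prems by auto
      have "mul1 (picard m \<tau>) (G \<tau>) e = 0"
        by (rule mul1_support[OF Suc.IH[OF \<tau>] T1.dom_support[OF G_dom[OF \<tau>]] Suc.prems(2)])
      then show ?thesis using T1.dom_support[OF G_dom[OF \<tau>] Suc.prems(2)] by simp
    qed
    then have "integral {a..t} (\<lambda>\<tau>. G \<tau> e + mul1 (picard m \<tau>) (G \<tau>) e) = integral {a..t} (\<lambda>_. 0)"
      by (intro integral_cong) blast
    then show ?case by simp
  qed simp
  then show "t \<in> {a..b} \<Longrightarrow> \<not> valid1 d e \<Longrightarrow> R t e = 0" by (simp add: R_def)
qed

text \<open>Let C be the weighted sum of \<open>c\<close>. If the exponential bounds all lower
  levels, the weighted integrand is at most C + 2 C exp(...), hence at most 3 C exp(...). The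
  summand 1 of the constant 3 comes from G, the 2 from the norm of \<open>delta\<close>. Treating
  each level separately, instead of the weighted sum over levels, avoids assuming convergence in
  advance.\<close>

lemma R_l1_bound:
  assumes "0 < \<rho>" "t \<in> {a..b}"
  shows "\<rho> ^ n * T1.l1 d n (R t) \<le> exp (3 * (\<Sum>n. \<rho> ^ n * c n) * (t - a))"
  using assms(2)
proof (induction n arbitrary: t rule: less_induct)
  case (less n)
  define C where "C = (\<Sum>n. \<rho> ^ n * c n)"
  let ?e = "\<lambda>\<tau>. exp (3 * C * (\<tau> - a))"
  have c0: "0 \<le> c k" for k using T1.dom_nonneg[OF G_dom[OF less.prems]] .
  have sum_C: "(\<Sum>k\<in>I. \<rho> ^ k * c k) \<le> C" if "finite I" for I
    unfolding C_def using rapidD[OF rapid_c \<open>0 < \<rho>\<close>] that c0 \<open>0 < \<rho>\<close> by (intro sum_le_suminf) auto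
  from sum_C[of "{}"] have "0 \<le> C" by simp
  have bound: "T1.l1 d n (\<lambda>e. G \<tau> e + mul1 (R \<tau>) (G \<tau>) e) \<le> (3 * C * ?e \<tau>) / \<rho> ^ n" if "\<tau> \<in> {a..t}" for \<tau>
  proof -
    have \<tau>: "\<tau> \<in> {a..b}" using that less.prems by auto
    have e1: "1 \<le> ?e \<tau>" using that \<open>0 \<le> C\<close> by simp
    have Gc: "T1.l1 d k (G \<tau>) \<le> c k" for k using G_dom[OF \<tau>] by (simp add: T1.dom_def)
    have term_le: "\<rho> ^ n * (2 * T1.l1 d k (R \<tau>) * T1.l1 d (n - k) (G \<tau>)) \<le> 2 * ?e \<tau> * (\<rho> ^ (n - k) * c (n - k))"
      if "k \<le> n" for k
    proof (cases "k = n")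
      case True
      then show ?thesis using c0 by (simp add: l1_level_0)
    next
      case False
      then have "k < n" using that by simp
      have "\<rho> ^ n = \<rho> ^ k * \<rho> ^ (n - k)" using that by (simp flip: power_add)
      then have "\<rho> ^ n * (2 * T1.l1 d k (R \<tau>) * T1.l1 d (n - k) (G \<tau>))
          = 2 * (\<rho> ^ k * T1.l1 d k (R \<tau>)) * (\<rho> ^ (n - k) * T1.l1 d (n - k) (G \<tau>))" by (simp add: mult_ac)
      also have "\<dots> \<le> 2 * ?e \<tau> * (\<rho> ^ (n - k) * c (n - k))"
        using less.IH[OF \<open>k < n\<close> \<tau>] Gc \<open>0 < \<rho>\<close>
        by (intro mult_mono) (auto simp: C_def T1.l1_nonneg)
      finally show ?thesis .
    qed
    have "\<rho> ^ n * T1.l1 d n (\<lambda>e. G \<tau> e + mul1 (R \<tau>) (G \<tau>) e)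
        \<le> \<rho> ^ n * (c n + (\<Sum>k\<le>n. 2 * T1.l1 d k (R \<tau>) * T1.l1 d (n - k) (G \<tau>)))"
      using \<open>0 < \<rho>\<close> by (intro mult_left_mono order_trans[OF T1.l1_add] add_mono Gc l1_mul1_le) simp
    also have "\<dots> = \<rho> ^ n * c n + (\<Sum>k\<le>n. \<rho> ^ n * (2 * T1.l1 d k (R \<tau>) * T1.l1 d (n - k) (G \<tau>)))"
      by (simp add: distrib_left sum_distrib_left)
    also have "\<dots> \<le> C + (\<Sum>k\<le>n. 2 * ?e \<tau> * (\<rho> ^ (n - k) * c (n - k)))"
      using sum_C[of "{n}"] term_le by (intro add_mono sum_mono) auto
    also have "(\<Sum>k\<le>n. 2 * ?e \<tau> * (\<rho> ^ (n - k) * c (n - k))) = 2 * ?e \<tau> * (\<Sum>k\<le>n. \<rho> ^ (n - k) * c (n - k))"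
      by (simp add: sum_distrib_left)
    also have "(\<Sum>k\<le>n. \<rho> ^ (n - k) * c (n - k)) = (\<Sum>k\<le>n. \<rho> ^ k * c k)"
      by (rule sum.reindex_bij_witness[of _ "\<lambda>k. n - k" "\<lambda>k. n - k"]) auto
    also have "C + 2 * ?e \<tau> * (\<Sum>k\<le>n. \<rho> ^ k * c k) \<le> C * ?e \<tau> + 2 * ?e \<tau> * C"
      using e1 \<open>0 \<le> C\<close> sum_C by (intro add_mono mult_left_mono) (auto simp: mult_le_cancel_left1)
    finally show ?thesis using \<open>0 < \<rho>\<close> by (simp add: field_simps)
  qed
  \<comment> \<open>The estimate 3 C \<open>?e\<close> is the derivative of \<open>?e\<close>, so
    integration reproduces the claimed bound, even less 1.\<close>
  have int: "((\<lambda>\<tau>. (3 * C * ?e \<tau>) / \<rho> ^ n) has_integral (?e t / \<rho> ^ n - ?e a / \<rho> ^ n)) {a..t}"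
  proof (rule fundamental_theorem_of_calculus)
    fix \<tau>
    have "((\<lambda>\<tau>. ?e \<tau> / \<rho> ^ n) has_real_derivative (3 * C * ?e \<tau>) / \<rho> ^ n) (at \<tau> within {a..t})"
      using \<open>0 < \<rho>\<close> by (auto intro!: derivative_eq_intros)
    then show "((\<lambda>\<tau>. ?e \<tau> / \<rho> ^ n) has_vector_derivative (3 * C * ?e \<tau>) / \<rho> ^ n) (at \<tau> within {a..t})"
      by (simp add: has_real_derivative_iff_has_vector_derivative)
  qed (use less.prems in auto)
  have "R t = (\<lambda>e. integral {a..t} (\<lambda>\<tau>. G \<tau> e + mul1 (R \<tau>) (G \<tau>) e))"
    by (rule ext) (rule R_eq)
  then have "T1.l1 d n (R t) \<le> integral {a..t} (\<lambda>\<tau>. (3 * C * ?e \<tau>) / \<rho> ^ n)"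
    using less.prems
    by (simp only:) (intro T1.l1_integral_le bound has_integral_integrable[OF int]
        continuous_on_subset[OF integrand_continuous], auto)
  also have "\<dots> = (?e t - 1) / \<rho> ^ n" using integral_unique[OF int] by (simp add: diff_divide_distrib)
  finally show ?case using \<open>0 < \<rho>\<close> by (simp add: C_def field_simps)
qed

lemma R_dominated:
  obtains c' where "rapid c'" "\<And>t. t \<in> {a..b} \<Longrightarrow> T1.dom d c' (R t)"
proof -
  \<comment> \<open>The majorant must not depend on the weight; the supremum over time is one
    sequence that inherits the bounds for all weights.\<close>
  define c' where "c' n = (SUP t\<in>{a..b}. T1.l1 d n (R t))" for n
  define B where "B \<rho> = exp (3 * (\<Sum>n. \<rho> ^ n * c n) * (b - a))" for \<rho>
  have l1B: "\<rho> ^ n * T1.l1 d n (R t) \<le> B \<rho>" if "0 < \<rho>" "t \<in> {a..b}" for \<rho> n t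
  proof -
    have "0 \<le> (\<Sum>n. \<rho> ^ n * c n)"
      using rapidD[OF rapid_c that(1)] T1.dom_nonneg[OF G_dom[OF that(2)]] that(1) by (intro suminf_nonneg) auto
    then have "exp (3 * (\<Sum>n. \<rho> ^ n * c n) * (t - a)) \<le> B \<rho>"
      unfolding B_def using that by (auto intro!: mult_left_mono)
    then show ?thesis using R_l1_bound[OF that, of n] by linarith
  qed
  have bdd: "bdd_above ((\<lambda>t. T1.l1 d n (R t)) ` {a..b})" for n
    by (rule bdd_aboveI2[of _ _ "B 1"]) (use l1B[of 1] in auto)
  have le: "T1.l1 d n (R t) \<le> c' n" if "t \<in> {a..b}" for n t
    unfolding c'_def by (rule cSUP_upper[OF that bdd])
  have "rapid c'"
  proof (rule rapid_if_geometric)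
    fix \<rho> :: real assume "\<rho> > 0"
    have "c' n \<le> B \<rho> / \<rho> ^ n" for n
      unfolding c'_def using ab l1B[OF \<open>\<rho> > 0\<close>] \<open>\<rho> > 0\<close> by (intro cSUP_least) (auto simp: field_simps)
    then have "\<rho> ^ n * c' n \<le> B \<rho>" for n
      using \<open>\<rho> > 0\<close> by (simp add: field_simps)
    then show "\<exists>B. \<forall>n. \<rho> ^ n * c' n \<le> B" by blast
  next
    fix n show "0 \<le> c' n" using le[of a n] T1.l1_nonneg[of d n "R a"] ab by simp
  qed
  moreover have "T1.dom d c' (R t)" if "t \<in> {a..b}" for t
    using le R_support that by (simp add: T1.dom_def)
  ultimately show thesis using that by blast
qed

end

section \<open>Continuous morphisms out of the universal crossed module\<close>

lemma zeta_eq_unit: "zeta i = unit_coeff [i]"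
  by (auto simp: zeta_def unit_coeff_def)

lemma one0_eq_unit: "one0 = unit_coeff []"
  by (auto simp: one0_def unit_coeff_def)

lemma Zc_eq_unit: "Zc i j = unit_coeff ([], (i, j), [])"
  by (auto simp: Zc_def unit_coeff_def)

locale xmod_morphism =
  fixes d :: nat
    and dA :: "'b::{real_normed_algebra,banach} \<Rightarrow> 'a::{real_normed_algebra,real_algebra_1,banach}"
    and l :: "'a \<Rightarrow> 'b \<Rightarrow> 'b" and r :: "'b \<Rightarrow> 'a \<Rightarrow> 'b"
    and alp :: "nat \<Rightarrow> 'a" and gam :: "nat \<Rightarrow> nat \<Rightarrow> 'b"
    and atl :: "t0 \<Rightarrow> 'a" and gt :: "t1 \<Rightarrow> 'b"
  assumes xm: "xmod_banach dA l r" and morph: "ext_morphism d dA l r alp gam atl gt"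
begin

lemma atl_mul: "x \<in> T0.entire d \<Longrightarrow> y \<in> T0.entire d \<Longrightarrow> atl (mul0 x y) = atl x * atl y"
  using morph by (simp add: ext_morphism_def E0_eq_entire)

lemma atl_one: "atl one0 = 1"
  using morph by (simp add: ext_morphism_def)

lemma atl_letter: "i < d \<Longrightarrow> atl (unit_coeff [i]) = alp i"
  using morph by (simp add: ext_morphism_def zeta_eq_unit)

lemma gt_mul: "E \<in> T1.entire d \<Longrightarrow> F \<in> T1.entire d \<Longrightarrow> gt (mul1 E F) = gt E * gt F"
  using morph by (simp add: ext_morphism_def E1_eq_entire)

lemma gt_lact: "x \<in> T0.entire d \<Longrightarrow> E \<in> T1.entire d \<Longrightarrow> gt (lact x E) = l (atl x) (gt E)"
  and gt_ract: "x \<in> T0.entire d \<Longrightarrow> E \<in> T1.entire d \<Longrightarrow> gt (ract E x) = r (gt E) (atl x)"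
  using morph by (simp_all add: ext_morphism_def E0_eq_entire E1_eq_entire)

lemma gt_Zc: "i < j \<Longrightarrow> j < d \<Longrightarrow> gt (unit_coeff ([], (i, j), [])) = gam i j"
  using morph by (simp add: ext_morphism_def Zc_eq_unit)

lemma act_bound: "norm (l x E) \<le> norm x * norm E" "norm (r E x) \<le> norm E * norm x"
  using xm unfolding xmod_banach_def by blast+

text \<open>The summand 1 makes powers of \<open>M\<close> increasing in the exponent.\<close>

definition M :: real where
  "M = 1 + (\<Sum>i<d. norm (alp i))"

lemma M_ge_1: "1 \<le> M"
  by (simp add: M_def sum_nonneg)

lemma atl_unit_bound: "valid0 d w \<Longrightarrow> norm (atl (unit_coeff w)) \<le> norm (1::'a) * M ^ length w"
proof (induction w)
  case Nil
  then show ?case using atl_one by (simp add: one0_eq_unit)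
next
  case (Cons i w)
  then have i: "i < d" and w: "valid0 d w" by (auto simp: valid0_def)
  have "atl (unit_coeff (i # w)) = atl (mul0 (unit_coeff [i]) (unit_coeff w))" by (simp add: mul0_unit)
  also have "\<dots> = alp i * atl (unit_coeff w)"
    using i w by (simp add: atl_mul T0.unit_entire atl_letter valid0_def)
  finally have "norm (atl (unit_coeff (i # w))) \<le> norm (alp i) * norm (atl (unit_coeff w))"
    by (simp add: norm_mult_ineq)
  also have "\<dots> \<le> M * (norm (1::'a) * M ^ length w)"
  proof (intro mult_mono Cons.IH w)
    have "norm (alp i) \<le> (\<Sum>i<d. norm (alp i))" using i by (intro member_le_sum) auto
    then show "norm (alp i) \<le> M" by (simp add: M_def)
  qed (use M_ge_1 in auto)
  finally show ?case by (simp add: mult_ac)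
qed

text \<open>The norm of the unit of the algebra is not assumed to be 1; it enters once for the word
  on each side of the wedge.\<close>

definition A :: real where
  "A = norm (1::'a) * (\<Sum>i<d. \<Sum>j<d. norm (gam i j)) * norm (1::'a)"

text \<open>A basis element is u acting from the left and v from the right on a generator
  \<open>Zc i j\<close>, so its image is obtained from \<open>gam i j\<close> by the two contractive
  actions.\<close>

lemma gt_unit_bound:
  assumes "valid1 d b"
  shows "norm (gt (unit_coeff b)) \<le> A * M ^ level1 b"
proof -
  obtain u i j v where b: "b = (u, (i, j), v)" by (cases b) auto
  have v: "valid0 d u" "valid0 d v" "i < j" "j < d" using assms by (auto simp: b valid1_iff)
  have e: "unit_coeff u \<in> T0.entire d" "unit_coeff v \<in> T0.entire d"
      "unit_coeff ([], (i, j), []) \<in> T1.entire d" "unit_coeff (u, (i, j), []) \<in> T1.entire d"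
    using v by (auto intro!: T0.unit_entire T1.unit_entire simp: valid1_iff valid0_def)
  have "gt (unit_coeff (u, (i, j), [])) = l (atl (unit_coeff u)) (gam i j)"
    using gt_lact[OF e(1,3)] gt_Zc[OF v(3,4)] by (simp add: lact_unit)
  then have "gt (unit_coeff b) = r (l (atl (unit_coeff u)) (gam i j)) (atl (unit_coeff v))"
    using gt_ract[OF e(2,4)] by (simp add: ract_unit b)
  then have "norm (gt (unit_coeff b)) \<le> (norm (atl (unit_coeff u)) * norm (gam i j)) * norm (atl (unit_coeff v))"
    by (simp add: order_trans[OF act_bound(2) mult_right_mono[OF act_bound(1)]])
  also have "\<dots> \<le> ((norm (1::'a) * M ^ length u) * (\<Sum>i<d. \<Sum>j<d. norm (gam i j))) * (norm (1::'a) * M ^ length v)"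
  proof (intro mult_mono atl_unit_bound v)
    have "norm (gam i j) \<le> (\<Sum>j<d. norm (gam i j))" using v by (intro member_le_sum) auto
    also have "\<dots> \<le> (\<Sum>i<d. \<Sum>j<d. norm (gam i j))"
      using v by (intro member_le_sum[of i _ "\<lambda>i. \<Sum>j<d. norm (gam i j)"]) (auto intro: sum_nonneg)
    finally show "norm (gam i j) \<le> (\<Sum>i<d. \<Sum>j<d. norm (gam i j))" .
  qed (use M_ge_1 in \<open>auto intro!: sum_nonneg mult_nonneg_nonneg\<close>)
  also have "\<dots> = A * M ^ (length u + length v)" by (simp add: A_def power_add mult_ac)
  also have "\<dots> \<le> A * M ^ level1 b"
    using M_ge_1 by (intro mult_left_mono power_increasing)
      (auto simp: b level1_def A_def intro!: sum_nonneg mult_nonneg_nonneg)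
  finally show ?thesis .
qed

sublocale A0: graded_functional "valid0 d" length "norm0 d" atl "norm (1::'a)" M
proof (intro graded_functional.intro graded_functional_axioms.intro T0.graded_seminorms_axioms)
  show "continuous_map (topology_generated_by
        {{b \<in> T0.entire d. (\<Sum>k. l ^ k * norm0 d k (\<lambda>i. b i - a i)) < r} | a l r. a \<in> T0.entire d \<and> l > 0 \<and> r > 0})
        euclidean atl"
    using morph by (simp add: ext_morphism_def top0_def sn0_def E0_eq_entire)
qed (use morph M_ge_1 atl_unit_bound in \<open>auto simp: ext_morphism_def E0_eq_entire\<close>)

sublocale A1: graded_functional "valid1 d" level1 "norm1 d" gt A M
proof (intro graded_functional.intro graded_functional_axioms.intro T1.graded_seminorms_axioms)
  show "continuous_map (topology_generated_by
        {{b \<in> T1.entire d. (\<Sum>k. l ^ k * norm1 d k (\<lambda>i. b i - a i)) < r} | a l r. a \<in> T1.entire d \<and> l > 0 \<and> r > 0})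
        euclidean gt"
    using morph by (simp add: ext_morphism_def top1_def sn1_def E1_eq_entire)
  show "0 \<le> A" by (auto simp: A_def intro!: mult_nonneg_nonneg sum_nonneg)
  show "0 < M" using M_ge_1 by simp
  show "gt (\<lambda>b. c * x b + y b) = c *\<^sub>R gt x + gt y" if "x \<in> T1.entire d" "y \<in> T1.entire d" for x y c
    using morph that by (simp add: ext_morphism_def E1_eq_entire)
qed (rule gt_unit_bound)

lemma atl_letters: "atl (letters d v) = (\<Sum>i<d. v i *\<^sub>R alp i)"
proof -
  let ?I = "(\<lambda>i. [i]) ` {..<d}"
  have eq: "letters d v = (\<lambda>w. if w \<in> ?I then v (hd w) else 0)"
    by (auto simp: letters_def fun_eq_iff length_Suc_conv)
  have "atl (letters d v) = (\<Sum>w\<in>?I. v (hd w) *\<^sub>R atl (unit_coeff w))"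
    unfolding eq by (rule conjunct2[OF A0.f_finite_sum]) (auto simp: valid0_def)
  also have "\<dots> = (\<Sum>i<d. v i *\<^sub>R alp i)"
    by (subst sum.reindex) (auto simp: inj_on_def atl_letter)
  finally show ?thesis .
qed

lemma gt_Jt1: "gt (Jt1 d X z) = (\<Sum>i<d. \<Sum>j<d. if i < j then Jco X i j z *\<^sub>R gam i j else 0)"
proof -
  let ?P = "{p \<in> {..<d} \<times> {..<d}. fst p < snd p}"
  let ?I = "(\<lambda>p. ([], p, [])) ` ?P :: tb set"
  have eq: "Jt1 d X z = (\<lambda>b. if b \<in> ?I then Jt1 d X z b else 0)"
    by (auto simp: Jt1_def fun_eq_iff image_iff)
  have "gt (Jt1 d X z) = (\<Sum>b\<in>?I. Jt1 d X z b *\<^sub>R gt (unit_coeff b))"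
    by (subst eq, rule conjunct2[OF A1.f_finite_sum]) (auto simp: valid1_def)
  also have "\<dots> = (\<Sum>p\<in>?P. Jco X (fst p) (snd p) z *\<^sub>R gam (fst p) (snd p))"
    by (subst sum.reindex) (auto simp: inj_on_def gt_Zc Jt1_def intro!: sum.cong)
  also have "\<dots> = (\<Sum>p\<in>{..<d} \<times> {..<d}. if fst p < snd p then Jco X (fst p) (snd p) z *\<^sub>R gam (fst p) (snd p) else 0)"
    by (rule sum.inter_filter) simp
  also have "\<dots> = (\<Sum>i<d. \<Sum>j<d. if i < j then Jco X i j z *\<^sub>R gam i j else 0)"
    unfolding sum.cartesian_product by (simp add: case_prod_unfold)
  finally show ?thesis .
qed

end

section \<open>The image of the path signature\<close>

locale surface_morphism = surface d sm sp tm tp X + xmod_morphism d dA l r alp gam atl gt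
  for d sm sp tm tp X
    and dA :: "'b::{real_normed_algebra,banach} \<Rightarrow> 'a::{real_normed_algebra,real_algebra_1,banach}"
    and l r alp gam atl gt
begin

text \<open>The signature satisfies g' = g v with v the velocity in level one; \<open>atl\<close>
  passes through the derivative, is multiplicative, and sends v to the image of the velocity under
  the connection.\<close>

lemma atl_g_deriv_t:
  assumes "s \<in> {sm..sp}" "\<tau> \<in> {tm..tp}"
  shows "((\<lambda>\<tau>. atl (g s \<tau>)) has_vector_derivative atl (g s \<tau>) * (\<Sum>i<d. dT X i (s, \<tau>) *\<^sub>R alp i))
    (at \<tau> within {tm..tp})"
proof -
  obtain c where c: "rapid c" "\<And>s t. s \<in> {sm..sp} \<Longrightarrow> t \<in> {tm..tp} \<Longrightarrow> T0.dom d c (g s t)"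
      "\<And>s t. s \<in> {sm..sp} \<Longrightarrow> t \<in> {tm..tp} \<Longrightarrow> T0.dom d c (g' s t)"
    by (rule g_dominated) (rule that)
  obtain c' where c': "rapid c'" "\<And>s t. s \<in> {sm..sp} \<Longrightarrow> t \<in> {tm..tp} \<Longrightarrow>
      T0.dom d c' (letters d (\<lambda>i. dS X i (s, t))) \<and> T0.dom d c' (letters d (\<lambda>i. dT X i (s, t)))"
    by (rule letters_dominated) (rule that)
  note dc = c(2)[OF assms] conjunct2[OF c'(2)[OF assms]]
  have "((\<lambda>\<tau>. atl (g s \<tau>)) has_vector_derivative atl (mul0 (g s \<tau>) (letters d (\<lambda>i. dT X i (s, \<tau>)))))
      (at \<tau> within {tm..tp})"
  proof (rule A0.f_has_vector_derivative[where c = c and c' = "\<lambda>n. \<Sum>k\<le>n. c k * c' (n - k)"])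
    show "rapid (\<lambda>n. \<Sum>k\<le>n. c k * c' (n - k))"
      using T0.dom_nonneg[OF dc(1)] T0.dom_nonneg[OF dc(2)] by (intro rapid_Cauchy_product c c')
    show "T0.dom d (\<lambda>n. \<Sum>k\<le>n. c k * c' (n - k)) (mul0 (g s t) (letters d (\<lambda>i. dT X i (s, t))))"
      if "t \<in> {tm..tp}" for t
      using c(2)[OF assms(1) that] c'(2)[OF assms(1) that] by (intro dom_mul0) auto
  qed (use assms c g_deriv_t in auto)
  also have "atl (mul0 (g s \<tau>) (letters d (\<lambda>i. dT X i (s, \<tau>)))) = atl (g s \<tau>) * (\<Sum>i<d. dT X i (s, \<tau>) *\<^sub>R alp i)"
    using T0.dom_rapid_entire[OF dc(1) c(1)] T0.dom_rapid_entire[OF dc(2) c'(1)]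
    by (simp add: atl_mul atl_letters)
  finally show ?thesis .
qed

lemma atl_g_deriv_s:
  assumes "\<sigma> \<in> {sm..sp}"
  shows "((\<lambda>\<sigma>. atl (g \<sigma> tm)) has_vector_derivative atl (g \<sigma> tm) * (\<Sum>i<d. dS X i (\<sigma>, tm) *\<^sub>R alp i))
    (at \<sigma> within {sm..sp})"
proof -
  obtain c where c: "rapid c" "\<And>s t. s \<in> {sm..sp} \<Longrightarrow> t \<in> {tm..tp} \<Longrightarrow> T0.dom d c (g s t)"
      "\<And>s t. s \<in> {sm..sp} \<Longrightarrow> t \<in> {tm..tp} \<Longrightarrow> T0.dom d c (g' s t)"
    by (rule g_dominated) (rule that)
  obtain c' where c': "rapid c'" "\<And>s t. s \<in> {sm..sp} \<Longrightarrow> t \<in> {tm..tp} \<Longrightarrow>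
      T0.dom d c' (letters d (\<lambda>i. dS X i (s, t))) \<and> T0.dom d c' (letters d (\<lambda>i. dT X i (s, t)))"
    by (rule letters_dominated) (rule that)
  have tm: "tm \<in> {tm..tp}" using t_le by simp
  note dc = c(2)[OF assms tm] conjunct1[OF c'(2)[OF assms tm]]
  have "((\<lambda>\<sigma>. atl (g \<sigma> tm)) has_vector_derivative atl (mul0 (g \<sigma> tm) (letters d (\<lambda>i. dS X i (\<sigma>, tm)))))
      (at \<sigma> within {sm..sp})"
  proof (rule A0.f_has_vector_derivative[where c = c and c' = "\<lambda>n. \<Sum>k\<le>n. c k * c' (n - k)"])
    show "rapid (\<lambda>n. \<Sum>k\<le>n. c k * c' (n - k))"
      using T0.dom_nonneg[OF dc(1)] T0.dom_nonneg[OF dc(2)] by (intro rapid_Cauchy_product c c')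
    show "T0.dom d (\<lambda>n. \<Sum>k\<le>n. c k * c' (n - k)) (mul0 (g s tm) (letters d (\<lambda>i. dS X i (s, tm))))"
      if "s \<in> {sm..sp}" for s
      using c(2)[OF that tm] c'(2)[OF that tm] by (intro dom_mul0) auto
  qed (use assms c tm g_deriv_s in auto)
  also have "atl (mul0 (g \<sigma> tm) (letters d (\<lambda>i. dS X i (\<sigma>, tm)))) = atl (g \<sigma> tm) * (\<Sum>i<d. dS X i (\<sigma>, tm) *\<^sub>R alp i)"
    using T0.dom_rapid_entire[OF dc(1) c(1)] T0.dom_rapid_entire[OF dc(2) c'(1)]
    by (simp add: atl_mul atl_letters)
  finally show ?thesis .
qed

text \<open>The image of the signature, followed along the tail path, solves the transport equation
  with the corner as its only exceptional point.\<close>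

lemma ptrans_tail:
  assumes st: "s \<in> {sm..sp}" "t \<in> {tm..tp}"
  shows "ptrans d alp (tail_len sm tm s t) (tail_path X sm tm s t) = atl (g s t)"
proof -
  let ?L = "tail_len sm tm s t"
  let ?a = "\<lambda>u. \<Sum>i<d. vector_derivative (tail_path X sm tm s t i) (at u within {0..?L}) *\<^sub>R alp i"
  let ?F = "along_tail (\<lambda>s t. atl (g s t)) sm tm s"
  have L: "0 \<le> ?L" using st by (auto simp: tail_len_def)
  interpret tail_curve "\<lambda>s t. atl (g s t)" "\<lambda>\<sigma>. atl (g \<sigma> tm) * (\<Sum>i<d. dS X i (\<sigma>, tm) *\<^sub>R alp i)"
    "\<lambda>\<tau>. atl (g s \<tau>) * (\<Sum>i<d. dT X i (s, \<tau>) *\<^sub>R alp i)" sm sp tm tp s t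
    by standard (use st in \<open>auto intro!: atl_g_deriv_s atl_g_deriv_t\<close>)
  have a: "?a u = (if u \<le> s - sm then \<Sum>i<d. dS X i (u + sm, tm) *\<^sub>R alp i else \<Sum>i<d. dT X i (s, u - (s - sm) + tm) *\<^sub>R alp i)"
    if "u \<in> {0..?L} - {s - sm}" for u
    using tail_path_deriv[OF _ st] that by auto
  have deriv: "(?F has_vector_derivative ?F u * ?a u) (at u within {0..?L})" if "u \<in> {0..?L} - {s - sm}" for u
    using along_tail_deriv[of u] that unfolding a[OF that] by (auto simp: along_tail_def split: if_splits)
  obtain K where K: "0 \<le> K" "\<And>i z. i < d \<Longrightarrow> z \<in> rect \<Longrightarrow> \<bar>dS X i z\<bar> \<le> K \<and> \<bar>dT X i z\<bar> \<le> K"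
    by (rule derivative_bound) (rule that)
  have a_bound: "norm (?a u) \<le> (\<Sum>i<d. K * norm (alp i))" if u: "u \<in> {0..?L} - {s - sm}" for u
  proof -
    have "(u + sm, tm) \<in> rect" if "u \<le> s - sm" using u st t_le that by auto
    moreover have "(s, u - (s - sm) + tm) \<in> rect" if "\<not> u \<le> s - sm" using u st that by (auto simp: tail_len_def)
    ultimately show ?thesis
      unfolding a[OF u] using K(2) by (auto intro!: sum_norm_le mult_right_mono)
  qed
  show ?thesis
    unfolding ptrans_def
  proof (rule the_equality)
    show "\<exists>F. F 0 = 1 \<and> F ?L = atl (g s t) \<and> continuous_on {0..?L} F \<and>
      (\<exists>S. finite S \<and> (\<forall>u\<in>{0..?L} - S. (F has_vector_derivative F u * ?a u) (at u within {0..?L})))"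
      using along_tail_continuous deriv st
      by (intro exI[of _ ?F] conjI exI[of _ "{s - sm}"])
        (auto simp: along_tail_start along_tail_end g_start atl_one)
  next
    fix y assume "\<exists>F. F 0 = 1 \<and> F ?L = y \<and> continuous_on {0..?L} F \<and>
      (\<exists>S. finite S \<and> (\<forall>u\<in>{0..?L} - S. (F has_vector_derivative F u * ?a u) (at u within {0..?L})))"
    then obtain F S where F: "F 0 = 1" "F ?L = y" "continuous_on {0..?L} F" "finite S"
        "\<And>u. u \<in> {0..?L} - S \<Longrightarrow> (F has_vector_derivative F u * ?a u) (at u within {0..?L})" by blast
    \<comment> \<open>A competing solution comes with its own finite exceptional set. Off this set
      and the corner, the difference solves the homogeneous equation with initial value 0.\<close>
    have "F ?L - ?F ?L = 0"
    proof (rule linear_ode_zero[where D = "\<lambda>u. F u - ?F u" and S = "insert (s - sm) S" and A = ?a])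
      show "continuous_on {0..?L} (\<lambda>u. F u - ?F u)"
        by (intro continuous_on_diff F along_tail_continuous)
      show "((\<lambda>u. F u - ?F u) has_vector_derivative (F u - ?F u) * ?a u) (at u within {0..?L})"
        if "u \<in> {0..?L} - insert (s - sm) S" for u
        unfolding left_diff_distrib using that by (intro has_vector_derivative_diff F deriv) auto
      show "norm (?a u) \<le> (\<Sum>i<d. K * norm (alp i))" if "u \<in> {0..?L} - insert (s - sm) S" for u
        using that by (intro a_bound) auto
      show "F 0 - ?F 0 = 0" using F(1) st by (simp add: along_tail_start g_start atl_one)
    qed (use F L K(1) in \<open>auto intro!: sum_nonneg\<close>)
    then show "y = atl (g s t)" using F(2) st by (simp add: along_tail_end)
  qed
qed

lemma ainv_atl_g:
  assumes st: "s \<in> {sm..sp}" "t \<in> {tm..tp}"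
  shows "ainv (atl (g s t)) = atl (g' s t)"
proof -
  have e: "g s t \<in> T0.entire d" "g' s t \<in> T0.entire d"
    using g_dominated T0.dom_rapid_entire st by metis+
  have 1: "atl (g s t) * atl (g' s t) = 1" "atl (g' s t) * atl (g s t) = 1"
    using atl_mul[OF e] atl_mul[OF e(2,1)] g_inverse[OF st] g_inverse'(2)[OF st] by (simp_all add: atl_one)
  show ?thesis
    unfolding ainv_def
  proof (rule the_equality)
    fix c assume "atl (g s t) * c = 1 \<and> c * atl (g s t) = 1"
    then show "c = atl (g' s t)" using 1 by (metis mult.assoc mult.left_neutral mult.right_neutral)
  qed (use 1 in simp)
qed

end

section \<open>Surface signature and surface holonomy\<close>

context surface
begin

text \<open>The action of the path signature on J, written with the explicit \<open>g'\<close> in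
  place of \<open>inv0\<close> to make bounds and continuity accessible.\<close>

definition conj_J :: "real \<Rightarrow> real \<Rightarrow> t1" where
  "conj_J s t = ract (lact (g s t) (Jt1 d X (s, t))) (g' s t)"

definition driver :: "real \<Rightarrow> t1" where
  "driver t = (\<lambda>b. integral {sm..sp} (\<lambda>s. conj_J s t b))"

lemma conj_J_dominated:
  obtains c where "rapid c" "\<And>s t. s \<in> {sm..sp} \<Longrightarrow> t \<in> {tm..tp} \<Longrightarrow> T1.dom d c (conj_J s t)"
proof -
  obtain c where c: "rapid c" "\<And>s t. s \<in> {sm..sp} \<Longrightarrow> t \<in> {tm..tp} \<Longrightarrow> T0.dom d c (g s t)"
      "\<And>s t. s \<in> {sm..sp} \<Longrightarrow> t \<in> {tm..tp} \<Longrightarrow> T0.dom d c (g' s t)"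
    by (rule g_dominated) (rule that)
  obtain c' where c': "rapid c'" "\<And>z. z \<in> rect \<Longrightarrow> T1.dom d c' (Jt1 d X z)"
    by (rule Jt1_dominated) (rule that)
  have c0: "0 \<le> c n" "0 \<le> c' n" for n
    using T0.dom_nonneg[OF c(2)[of sm tm]] T1.dom_nonneg[OF c'(2)[of "(sm, tm)"]] s_le t_le by auto
  let ?c1 = "\<lambda>n. \<Sum>k\<le>n. c k * c' (n - k)"
  let ?c2 = "\<lambda>n. \<Sum>k\<le>n. c k * ?c1 (n - k)"
  have c1: "rapid ?c1" "\<And>n. 0 \<le> ?c1 n"
    by (intro rapid_Cauchy_product c c' c0) (intro sum_nonneg mult_nonneg_nonneg c0)
  have "rapid ?c2" by (rule rapid_Cauchy_product[OF c(1) c1(1) c0(1) c1(2)])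
  moreover have "T1.dom d ?c2 (conj_J s t)" if "s \<in> {sm..sp}" "t \<in> {tm..tp}" for s t
    unfolding conj_J_def using that by (intro dom_ract dom_lact c c') auto
  ultimately show thesis using that by blast
qed

lemma Jt1_continuous: "continuous_on rect (\<lambda>z. Jt1 d X z b)"
proof -
  obtain u i j v where b: "b = (u, (i, j), v)" by (cases b) auto
  show ?thesis
  proof (cases "u = [] \<and> v = [] \<and> i < j \<and> j < d")
    case True
    then have "continuous_on rect (\<lambda>z. Jco X i j z)"
      unfolding Jco_def by (intro continuous_intros X_smooth) auto
    then show ?thesis using True by (simp add: Jt1_def b)
  next
    case False
    then have "Jt1 d X z b = 0" for z unfolding Jt1_def b prod.case by (rule if_not_P)
    then show ?thesis by simp
  qed
qed

lemma conj_J_continuous: "continuous_on rect (\<lambda>z. conj_J (fst z) (snd z) b)"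
proof -
  obtain u p v where b: "b = (u, p, v)" by (cases b)
  show ?thesis
    unfolding conj_J_def ract_def lact_def b prod.case prod.collapse
    by (intro continuous_intros g_continuous Jt1_continuous)
qed

lemma conj_J_continuous_s: "t \<in> {tm..tp} \<Longrightarrow> continuous_on {sm..sp} (\<lambda>s. conj_J s t b)"
  by (rule continuous_on_compose2[OF conj_J_continuous, of "{sm..sp}" "\<lambda>s. (s, t)" b, simplified])
    (auto intro!: continuous_intros)

lemma driver_continuous: "continuous_on {tm..tp} (\<lambda>t. driver t b)"
proof -
  have "continuous_on ({tm..tp} \<times> cbox sm sp) (\<lambda>z. conj_J (snd z) (fst z) b)"
    by (rule continuous_on_compose2[OF conj_J_continuous, of _ "\<lambda>z. (snd z, fst z)" b, simplified])
      (auto intro!: continuous_intros)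
  then have "continuous_on {tm..tp} (\<lambda>t. integral (cbox sm sp) (\<lambda>s. conj_J s t b))"
    by (intro integral_continuous_on_param) (simp add: case_prod_unfold)
  then show ?thesis by (simp add: driver_def)
qed

lemma driver_driven: obtains c where "driven_equation d tm tp driver c"
proof -
  obtain c where c: "rapid c" "\<And>s t. s \<in> {sm..sp} \<Longrightarrow> t \<in> {tm..tp} \<Longrightarrow> T1.dom d c (conj_J s t)"
    by (rule conj_J_dominated) (rule that)
  have "driven_equation d tm tp driver (\<lambda>n. (sp - sm) * c n)"
  proof
    show "T1.dom d (\<lambda>n. (sp - sm) * c n) (driver t)" if "t \<in> {tm..tp}" for t
      unfolding driver_def using that by (intro T1.dom_integral s_le c conj_J_continuous_s)
  qed (intro t_le rapid_cmult c driver_continuous)+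
  then show thesis by (rule that)
qed

lemma Rhat_integrand:
  assumes "t \<in> {tm..tp}"
  shows "(\<lambda>b. integral {sm..sp} (\<lambda>s'. let g = sig d (tail_len sm tm s' t) (tail_path X sm tm s' t)
     in ract (lact g (Jt1 d X (s', t))) (inv0 g) b)) = driver t"
  unfolding driver_def conj_J_def Let_def
  by (intro ext integral_cong) (use assms in \<open>simp add: sig_tail g_inverse'\<close>)

text \<open>Existence is the diagonal solution. A competitor satisfies the equation coefficient by
  coefficient without further conditions, and triangularity identifies it with \<open>R\<close> by
  induction on the level.\<close>

lemma Rhat_eq:
  assumes "driven_equation d tm tp driver c"
  shows "Rhat d sm sp tm tp X = (1, driven_equation.R tm driver tp)"
proof -
  interpret driven_equation d tm tp driver c by fact
  define GG where "GG = (\<lambda>t b. integral {sm..sp} (\<lambda>s'. let g = sig d (tail_len sm tm s' t) (tail_path X sm tm s' t)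
     in ract (lact g (Jt1 d X (s', t))) (inv0 g) b))"
  have GG: "GG t = driver t" if "t \<in> {tm..tp}" for t
    unfolding GG_def by (rule Rhat_integrand[OF that])
  have um: "umul1 x (0, F) = (0, \<lambda>b. fst x * F b + mul1 (snd x) F b)" for x F
    by (cases x) (simp add: umul1_def)
  define sol where "sol Q \<longleftrightarrow> (\<forall>t\<in>{tm..tp}.
     ((\<lambda>t. fst (Q t)) has_real_derivative fst (umul1 (Q t) (0, GG t))) (at t within {tm..tp}) \<and>
     (\<forall>b. ((\<lambda>t. snd (Q t) b) has_real_derivative snd (umul1 (Q t) (0, GG t)) b) (at t within {tm..tp})))" for Q
  have "(THE y. \<exists>Q. Q tm = (1, \<lambda>b. 0) \<and> Q tp = y \<and> sol Q) = (1, R tp)"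
  proof (rule the_equality)
    show "\<exists>Q. Q tm = (1, \<lambda>b. 0) \<and> Q tp = (1, R tp) \<and> sol Q"
      by (rule exI[of _ "\<lambda>t. (1, R t)"]) (auto simp: sol_def um GG R_start R_deriv)
  next
    fix y assume "\<exists>Q. Q tm = (1, \<lambda>b. 0) \<and> Q tp = y \<and> sol Q"
    then obtain Q where Q: "Q tm = (1, \<lambda>b. 0)" "Q tp = y" "sol Q" by blast
    have Q1: "fst (Q t) = 1" if "t \<in> {tm..tp}" for t
      by (rule has_real_derivative_eq_imp_eq[where f = "\<lambda>t. fst (Q t)" and g = "\<lambda>t. 1" and f' = "\<lambda>t. 0"])
        (use Q that in \<open>auto simp: sol_def um\<close>)
    have Q2: "((\<lambda>t. snd (Q t) e) has_real_derivative driver t e + mul1 (snd (Q t)) (driver t) e) (at t within {tm..tp})"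
      if "t \<in> {tm..tp}" for t e
    proof -
      have "((\<lambda>t. snd (Q t) e) has_real_derivative snd (umul1 (Q t) (0, GG t)) e) (at t within {tm..tp})"
        using Q(3) that unfolding sol_def by blast
      then show ?thesis by (simp add: um GG[OF that] Q1[OF that])
    qed
    have "snd (Q t) e = R t e" if "t \<in> {tm..tp}" for t e
      using that
    \<comment> \<open>Once all lower levels agree, both coefficients at \<open>e\<close> have the
      same derivative and the same initial value.\<close>
    proof (induction "level1 e" arbitrary: e t rule: less_induct)
      case less
      show ?case
      proof (rule has_real_derivative_eq_imp_eq[OF _ R_deriv _ less.prems])
        fix t assume t: "t \<in> {tm..tp}"
        have "mul1 (snd (Q t)) (driver t) e = mul1 (R t) (driver t) e"
          by (rule mul1_cong_below) (use less.hyps t in blast)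
        then show "((\<lambda>t. snd (Q t) e) has_real_derivative driver t e + mul1 (R t) (driver t) e) (at t within {tm..tp})"
          using Q2[OF t, of e] by simp
      qed (simp_all add: Q(1) R_start)
    qed
    then show "y = (1, R tp)"
      using Q1[of tp] Q(2) t_le by (intro prod_eqI ext) auto
  qed
  then show ?thesis
    unfolding Rhat_def sol_def GG_def Let_def .
qed

end

context surface_morphism
begin

section \<open>The image of the surface signature\<close>

lemma gt_conj_J:
  assumes "s \<in> {sm..sp}" "t \<in> {tm..tp}"
  shows "gt (conj_J s t) = (let F = ptrans d alp (tail_len sm tm s t) (tail_path X sm tm s t)
     in r (l F (\<Sum>i<d. \<Sum>j<d. if i < j then Jco X i j (s, t) *\<^sub>R gam i j else 0)) (ainv F))"
proof -
  obtain c where c: "rapid c" "T0.dom d c (g s t)" "T0.dom d c (g' s t)"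
    using g_dominated assms by metis
  obtain c' where c': "rapid c'" "T1.dom d c' (Jt1 d X (s, t))"
    using Jt1_dominated assms by (metis SigmaI)
  have e: "g s t \<in> T0.entire d" "g' s t \<in> T0.entire d" "Jt1 d X (s, t) \<in> T1.entire d"
    using c c' T0.dom_rapid_entire T1.dom_rapid_entire by blast+
  have "lact (g s t) (Jt1 d X (s, t)) \<in> T1.entire d"
    using T0.dom_nonneg[OF c(2)] T1.dom_nonneg[OF c'(2)] c c'
    by (intro T1.dom_rapid_entire[OF dom_lact rapid_Cauchy_product])
  with e show ?thesis
    unfolding conj_J_def Let_def ptrans_tail[OF assms] ainv_atl_g[OF assms] gt_Jt1[symmetric]
    by (simp add: gt_ract gt_lact)
qed

text \<open>The left integral is taken in the Banach algebra, the one in \<open>driver\<close>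
  coefficientwise; the common rapid majorant of the integrands lets \<open>gt\<close> pass between
  them.\<close>

lemma gt_driver:
  assumes "t \<in> {tm..tp}"
  shows "integral {sm..sp} (\<lambda>s'. let F = ptrans d alp (tail_len sm tm s' t) (tail_path X sm tm s' t)
     in r (l F (\<Sum>i<d. \<Sum>j<d. if i < j then Jco X i j (s', t) *\<^sub>R gam i j else 0)) (ainv F)) = gt (driver t)"
proof -
  obtain c where c: "rapid c" "\<And>s t. s \<in> {sm..sp} \<Longrightarrow> t \<in> {tm..tp} \<Longrightarrow> T1.dom d c (conj_J s t)"
    by (rule conj_J_dominated) (rule that)
  have "((\<lambda>s. gt (conj_J s t)) has_integral gt (\<lambda>b. integral {sm..sp} (\<lambda>s. conj_J s t b))) {sm..sp}"
  proof (rule A1.f_has_integral)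
    show "T1.dom d (\<lambda>n. (sp - sm) * c n) (\<lambda>b. integral {sm..sp} (\<lambda>s. conj_J s t b))"
      using assms by (intro T1.dom_integral s_le c conj_J_continuous_s)
  qed (use assms c in \<open>auto intro: conj_J_continuous_s rapid_cmult\<close>)
  then have "integral {sm..sp} (\<lambda>s. gt (conj_J s t)) = gt (driver t)"
    unfolding driver_def by (rule integral_unique)
  moreover have "integral {sm..sp} (\<lambda>s. gt (conj_J s t))
      = integral {sm..sp} (\<lambda>s'. let F = ptrans d alp (tail_len sm tm s' t) (tail_path X sm tm s' t)
     in r (l F (\<Sum>i<d. \<Sum>j<d. if i < j then Jco X i j (s', t) *\<^sub>R gam i j else 0)) (ainv F))"
    by (intro integral_cong gt_conj_J assms)
  ultimately show ?thesis by simp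
qed

text \<open>\<open>mul1\<close> of rapidly dominated families is again rapidly dominated, so the
  whole right-hand side of the equation for \<open>R\<close> admits termwise differentiation under
  \<open>gt\<close>.\<close>

lemma gt_R_deriv:
  assumes "driven_equation d tm tp driver c" and t: "t \<in> {tm..tp}"
  defines "Q \<equiv> driven_equation.R tm driver"
  shows "((\<lambda>t. gt (Q t)) has_vector_derivative gt (driver t) + gt (Q t) * gt (driver t)) (at t within {tm..tp})"
proof -
  interpret driven_equation d tm tp driver c by fact
  obtain c' where c': "rapid c'" "\<And>t. t \<in> {tm..tp} \<Longrightarrow> T1.dom d c' (R t)" by (rule R_dominated) (rule that)
  have rm: "rapid (\<lambda>n. \<Sum>k\<le>n. 2 * c' k * c (n - k))"
    using T1.dom_nonneg[OF c'(2)[OF t]] T1.dom_nonneg[OF G_dom[OF t]]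
    by (intro rapid_Cauchy_product rapid_cmult c' rapid_c) auto
  have dm: "T1.dom d (\<lambda>n. \<Sum>k\<le>n. 2 * c' k * c (n - k)) (mul1 (R t) (driver t))" if "t \<in> {tm..tp}" for t
    by (intro dom_mul1 c' G_dom that)
  have "((\<lambda>t. gt (R t)) has_vector_derivative gt (\<lambda>e. driver t e + mul1 (R t) (driver t) e)) (at t within {tm..tp})"
    by (rule A1.f_has_vector_derivative[OF _ t c'(2,1) T1.dom_add[OF G_dom dm] rapid_add[OF rapid_c rm] R_deriv])
      (auto simp: convex_real_interval)
  also have "gt (\<lambda>e. driver t e + mul1 (R t) (driver t) e) = gt (driver t) + gt (R t) * gt (driver t)"
    using A1.lin[of "driver t" "mul1 (R t) (driver t)" 1] gt_mul
      T1.dom_rapid_entire[OF G_dom[OF t] rapid_c] T1.dom_rapid_entire[OF c'(2)[OF t] c'(1)]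
      T1.dom_rapid_entire[OF dm[OF t] rm] by simp
  finally show ?thesis by (simp add: Q_def)
qed

text \<open>The image of \<open>R\<close> solves the holonomy equation, and the norm of
  \<open>gt (driver t)\<close> is bounded uniformly in t by the majorant of the driver, which gives
  uniqueness.\<close>

lemma Hhat_eq:
  assumes de: "driven_equation d tm tp driver c"
  shows "Hhat d alp gam l r sm sp tm tp X = (1, gt (driven_equation.R tm driver tp))"
proof -
  interpret driven_equation d tm tp driver c by fact
  define GG where "GG = (\<lambda>t. integral {sm..sp} (\<lambda>s'. let F = ptrans d alp (tail_len sm tm s' t) (tail_path X sm tm s' t)
     in r (l F (\<Sum>i<d. \<Sum>j<d. if i < j then Jco X i j (s', t) *\<^sub>R gam i j else 0)) (ainv F)))"
  have GG: "GG t = gt (driver t)" if "t \<in> {tm..tp}" for t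
    unfolding GG_def by (rule gt_driver[OF that])
  have um: "umul x (0, F) = (0, fst x *\<^sub>R F + snd x * F)" for x :: "real \<times> 'b" and F
    by (cases x) (simp add: umul_def)
  note dR = gt_R_deriv[OF de]
  have R0: "gt (R tm) = 0"
  proof -
    have "R tm = (\<lambda>b. 0)" by (rule ext) (rule R_start)
    then show ?thesis by (simp add: A1.f_zero)
  qed
  define sol where "sol H \<longleftrightarrow> (\<forall>t\<in>{tm..tp}. (H has_vector_derivative umul (H t) (0, GG t)) (at t within {tm..tp}))"
    for H :: "real \<Rightarrow> real \<times> 'b"
  have "(THE y. \<exists>H. H tm = (1, 0) \<and> H tp = y \<and> sol H) = (1, gt (R tp))"
  proof (rule the_equality)
    have "((\<lambda>t. (1::real, gt (R t))) has_vector_derivative umul (1, gt (R t)) (0, GG t)) (at t within {tm..tp})"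
      if "t \<in> {tm..tp}" for t
      unfolding um GG[OF that] using dR[OF that]
      by (auto intro!: has_vector_derivative_Pair)
    then show "\<exists>H. H tm = (1, 0) \<and> H tp = (1, gt (R tp)) \<and> sol H"
      by (intro exI[of _ "\<lambda>t. (1, gt (R t))"]) (auto simp: sol_def R0)
  next
    fix y assume "\<exists>H. H tm = (1, 0) \<and> H tp = y \<and> sol H"
    then obtain H where H: "H tm = (1, 0)" "H tp = y" "sol H" by blast
    have dH: "((\<lambda>t. fst (H t)) has_vector_derivative 0) (at t within {tm..tp})"
        "((\<lambda>t. snd (H t)) has_vector_derivative fst (H t) *\<^sub>R gt (driver t) + snd (H t) * gt (driver t)) (at t within {tm..tp})"
      if "t \<in> {tm..tp}" for t
    proof -
      have "(H has_vector_derivative (0, fst (H t) *\<^sub>R gt (driver t) + snd (H t) * gt (driver t))) (at t within {tm..tp})"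
      proof -
        have "(H has_vector_derivative umul (H t) (0, GG t)) (at t within {tm..tp})"
          using H(3) that unfolding sol_def by blast
        then show ?thesis by (simp add: um GG[OF that])
      qed
      from bounded_linear.has_vector_derivative[OF bounded_linear_fst this]
        bounded_linear.has_vector_derivative[OF bounded_linear_snd this]
      show "((\<lambda>t. fst (H t)) has_vector_derivative 0) (at t within {tm..tp})"
        "((\<lambda>t. snd (H t)) has_vector_derivative fst (H t) *\<^sub>R gt (driver t) + snd (H t) * gt (driver t)) (at t within {tm..tp})"
        by simp_all
    qed
    have H1: "fst (H t) = 1" if "t \<in> {tm..tp}" for t
      by (rule has_real_derivative_eq_imp_eq[where f = "\<lambda>t. fst (H t)" and g = "\<lambda>t. 1" and f' = "\<lambda>t. 0"])
        (use H(1) dH(1) that in \<open>auto simp: has_real_derivative_iff_has_vector_derivative\<close>)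
    \<comment> \<open>Both scalar parts are 1, so the inhomogeneous terms cancel and a homogeneous
      linear equation remains.\<close>
    have dD: "((\<lambda>t. snd (H t) - gt (R t)) has_vector_derivative (snd (H t) - gt (R t)) * gt (driver t)) (at t within {tm..tp})"
      if "t \<in> {tm..tp}" for t
      using has_vector_derivative_diff[OF dH(2)[OF that] dR[OF that]] H1[OF that]
      by (simp add: left_diff_distrib)
    have "snd (H tp) - gt (R tp) = 0"
    proof (rule linear_ode_zero[where D = "\<lambda>t. snd (H t) - gt (R t)" and A = "\<lambda>t. gt (driver t)" and S = "{}"])
      show "continuous_on {tm..tp} (\<lambda>t. snd (H t) - gt (R t))"
        using dD has_vector_derivative_continuous unfolding continuous_on_eq_continuous_within by blast
      show "norm (gt (driver t)) \<le> (\<Sum>n. A * (M ^ n * c n))" if "t \<in> {tm..tp} - {}" for t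
        using that by (intro A1.norm_f_le G_dom rapid_c) auto
      show "0 \<le> (\<Sum>n. A * (M ^ n * c n))"
        using A1.norm_f_le[OF G_dom rapid_c, of tm] t_le norm_ge_zero order_trans by (metis atLeastAtMost_iff order_refl)
    qed (use dD H(1) R0 t_le in auto)
    then show "y = (1, gt (R tp))" using H(2) H1[of tp] t_le by (intro prod_eqI) auto
  qed
  then show ?thesis
    unfolding Hhat_def sol_def GG_def Let_def .
qed

end

theorem theorem4p29:
  fixes d :: nat
    and dA :: "'b::{real_normed_algebra,banach} \<Rightarrow> 'a::{real_normed_algebra,real_algebra_1,banach}"
    and l :: "'a \<Rightarrow> 'b \<Rightarrow> 'b" and r :: "'b \<Rightarrow> 'a \<Rightarrow> 'b"
    and alp :: "nat \<Rightarrow> 'a" and gam :: "nat \<Rightarrow> nat \<Rightarrow> 'b"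
    and atl :: "t0 \<Rightarrow> 'a" and gt :: "t1 \<Rightarrow> 'b"
    and sm sp tm tp :: real and X :: "nat \<Rightarrow> real \<times> real \<Rightarrow> real"
  assumes "xmod_banach dA l r"
    and "two_connection d dA alp gam"
    and "ext_morphism d dA l r alp gam atl gt"
    and "sm \<le> sp" and "tm \<le> tp"
    and "smooth_surface d sm sp tm tp X"
  shows "Hhat d alp gam l r sm sp tm tp X = uext gt (Rhat d sm sp tm tp X)"
proof -
  interpret surface_morphism d sm sp tm tp X dA l r alp gam atl gt
    by unfold_locales (use assms in auto)
  obtain c where "driven_equation d tm tp driver c" by (rule driver_driven) (rule that)
  then show ?thesis by (simp add: Hhat_eq Rhat_eq uext_def)
qed

end
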